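(* Let $k$ be a field, $R=k[x_1,\dots,x_n]$, $d\ge 1$, and let $\alpha^1,\dots,\alpha^r$ be exponent vectors in $\mathbb{Z}_{\ge 0}^n$ with $|\alpha^s|=d$ for all $s$ and $\deg \operatorname{lcm}(x^{\alpha^s},x^{\alpha^t})\ge d+2$ for all $s\ne t$. Put $B=\{\alpha^1,\dots,\alpha^r\}$. Let $K'$ be the equigenerated monomial ideal whose complementary ideal is $\overline{K'}=(x^{\alpha^1},\dots,x^{\alpha^r})$, i.e. $K'$ is generated by all monomials of degree $d$ other than $x^{\alpha^1},\dots,x^{\alpha^r}$. Then the minimal free resolution of $R/K'$ is the complex $F_\bullet$ with $$F_0=R,\qquad F_i=L_d^{i-1,B}\oplus\Big(\bigoplus_{s=1}^{r}K^{\alpha^s}_{i-n_{\alpha^s}}\Big)\quad (i>0),$$ and differentials $\ell_i:F_i\to F_{i-1}$ given by $$\ell_1=S_d(\psi)|_{L_d^{0,B}},\qquad \ell_2=\begin{pmatrix}\mathrm{Kos}^\psi\otimes 1 & \Theta_2\end{pmatrix},\qquad \ell_i=\begin{pmatrix}\mathrm{Kos}^\psi\otimes 1&\Theta_i\\ 0&-\bigoplus_{s=1}^r \mathrm{Kos}^\psi\end{pmatrix}\quad(i>2),$$ where the restriction of $\Theta_p$ to the summand $K^{\alpha^s}_{p-n_{\alpha^s}}$ (nonzero only if $n_{\alpha^s}>1$) is the map $K^{\alpha^s}_{p-n_{\alpha^s}}\to L_d^{p-2,B}$ which, writing $\operatorname{Supp}(\alpha^s)=\{k_1<\dots<k_m\}$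 with $m=n_{\alpha^s}$, sends a basis element $e_J$ ($J\cap \operatorname{Supp}(\alpha^s)=\varnothing$, $|J|=p-m$) to $$\operatorname{sgn}(J)\sum_{i=1}^{m}\operatorname{sgn}(k_i)\,x_{k_i}^2\; e_{\{k_1,\dots,\widehat{k_i},\dots,k_m\}\cup J}\otimes e^{\alpha^s-\epsilon_{k_i}}$$ $$+\operatorname{sgn}(J)\sum_{i<j}x_{k_i}x_{k_j}\Big(\operatorname{sgn}(k_j)\,e_{\{k_1,\dots,\widehat{k_j},\dots,k_m\}\cup J}\otimes e^{\alpha^s-\epsilon_{k_i}}+\operatorname{sgn}(k_i)\,e_{\{k_1,\dots,\widehat{k_i},\dots,k_m\}\cup J}\otimes e^{\alpha^s-\epsilon_{k_j}}\Big).$$ Here $\operatorname{sgn}(k_i)$ means $\operatorname{sgn}(k_i\in \operatorname{Supp}(\alpha^s)\cup J)$.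
   Context: Notation. $F=\bigoplus_{i=1}^n Re_i$, $\psi:F\to R$, $e_i\mapsto x_i$. For $\beta\in\mathbb{Z}_{\ge0}^n$: $|\beta|=\sum\beta_i$, $x^\beta=\prod x_i^{\beta_i}$, $e^\beta=\prod e_i^{\beta_i}\in S_{|\beta|}(F)$ (symmetric power), $\operatorname{Supp}(\beta)=\{i:\beta_i>0\}$, $n_\beta=|\operatorname{Supp}(\beta)|$; $\epsilon_i$ is the $i$th unit vector. For $A=\{a_0<\dots<a_m\}\subseteq[n]$: $e_A=e_{a_0}\wedge\cdots\wedge e_{a_m}$ and $\operatorname{sgn}(a_j\in A)=(-1)^j$. $\mathrm{Kos}^\psi:\bigwedge^iF\to\bigwedge^{i-1}F$ is the Koszul differential, $e_A\mapsto\sum_{a\in A}\operatorname{sgn}(a\in A)x_a e_{A\setminus a}$. For $J$ disjoint from $\operatorname{Supp}(\alpha)$, $\operatorname{sgn}(J)=\pm1$ is defined by $e_J\wedge e_{\operatorname{Supp}(\alpha)}=\operatorname{sgn}(J)\,e_{\operatorname{Supp}(\alpha)\cup J}$. The modules $L$. Let $\kappa_{a,b}:\bigwedge^aF\otimes S_b(F)\to\bigwedge^{a-1}F\otimes S_{b+1}(F)$, $e_A\otimes e^\beta\mapsto\sum_{a\in A}\operatorname{sgn}(a\in A)\,e_{A\setminus a}\otimes e_ae^\beta$, and $L_d^i=L_d^i(F)=\ker\kappa_{i,d}\subseteq\bigwedge^iF\otimes S_d(F)$ (so $L_d^0=S_d(F)$). The map $\mathrm{Kos}^\psi\otimes1$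 restricts to $L_d^i\to L_d^{i-1}$. For $|A|=i+1$ and $|\beta|=d-1$, the symbol $e_A\otimes e^\beta$, regarded as an element of $L_d^i$, denotes $\kappa_{i+1,d-1}(e_A\otimes e^\beta)$. Such an element is called standard if $\min A\le\min\operatorname{Supp}(\beta)$ (no condition if $d=1$); the standard elements form a basis of $L_d^i$. $S_d(\psi):S_d(F)\to R$ sends $e^\beta\mapsto x^\beta$. The submodules $L_d^{i,B}$. Write $\operatorname{Supp}(\alpha^s)=\{k_1^s<\dots<k^s_{n_{\alpha^s}}\}$. For $i\ge0$, $L_d^{i,B}\subseteq L_d^i$ is the free submodule generated by the following elements (all terms $e_A\otimes e^\beta$ appearing being standard, $|A|=i+1$), for $1\le s\le r$, $1\le p\le n_{\alpha^s}$: (1) $e_A\otimes e^\beta$ with $\beta\ne\alpha^s-\epsilon_{k^s_p}$ for all $s,p$; (2) $e_A\otimes e^{\alpha^s-\epsilon_{k_p^s}}$ with $k_p^s\notin A$; (3) $\operatorname{sgn}(k^s_p\in J\cup\{k^s_p\})\,e_{J\cup\{k_p^s\}}\otimes e^{\alpha^s-\epsilon_{k_p^s}}-\operatorname{sgn}(k^s_t\in J\cup\{k^s_t\})\,e_{J\cup\{k_t^s\}}\otimes e^{\alpha^s-\epsilon_{k_t^s}}$, where $|J|=i$, $k_p^s\notin J$, and $t$ is the index with $\{k_1^s,\dots,k_{t-1}^s\}\subseteq J$, $k_t^s\notin J$. The complexes $K^\alpha_\bullet$. If $n_\alpha>1$, $K_\bullet^\alpha$ is the Koszul complex on the map $\bigoplus_{i\notin\operatorname{Supp}(\alpha)}Re_i\to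 R$, $e_i\mapsto x_i$, with $K_j^\alpha=\bigwedge^j\big(\bigoplus_{i\notin\operatorname{Supp}(\alpha)}Re_i\big)$, its differential again denoted $\mathrm{Kos}^\psi$. If $n_\alpha=1$, $K^\alpha_\bullet=0$. *)

theory Defs
  imports Complex_Main "HOL-Library.Poly_Mapping" "HOL-Library.Product_Plus"
begin

section \<open>Polynomials and free modules\<close>

text \<open>
  The index set \<open>[n]\<close> is a finite linearly ordered type \<open>'n\<close>, so that \<open>R = k[x\<^sub>1,\<dots>,x\<^sub>n]\<close> is the
  type \<open>('n, 'k) mpoly\<close> with its ring structure from \<open>Poly_Mapping\<close> (convolution product).
  The free \<open>R\<close>-module with basis indexed by \<open>'b\<close> is \<open>'b \<Rightarrow>\<^sub>0 R\<close>, with basis vectors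
  \<open>Poly_Mapping.single b 1\<close>.
\<close>

type_synonym 'n expo = "'n \<Rightarrow>\<^sub>0 nat"
type_synonym ('n, 'k) mpoly = "'n expo \<Rightarrow>\<^sub>0 'k"

abbreviation unit_expo :: "'n \<Rightarrow> 'n expo" (\<open>\<epsilon>\<close>)
  where "\<epsilon> i \<equiv> Poly_Mapping.single i 1"

abbreviation Supp :: "'n expo \<Rightarrow> 'n set"
  where "Supp \<beta> \<equiv> Poly_Mapping.keys \<beta>"

definition expo_deg :: "'n::finite expo \<Rightarrow> nat"
  where "expo_deg \<beta> = (\<Sum>i\<in>UNIV. Poly_Mapping.lookup \<beta> i)"

text \<open>The exponent vector of \<open>lcm(x\<^sup>\<alpha>, x\<^sup>\<beta>)\<close>.\<close>

definition expo_lcm :: "'n::finite expo \<Rightarrow> 'n expo \<Rightarrow> 'n expo"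
  where "expo_lcm \<alpha> \<beta> =
    Abs_poly_mapping (\<lambda>i. max (Poly_Mapping.lookup \<alpha> i) (Poly_Mapping.lookup \<beta> i))"

lemma lookup_expo_lcm:
  "Poly_Mapping.lookup (expo_lcm \<alpha> \<beta>) i = max (Poly_Mapping.lookup \<alpha> i) (Poly_Mapping.lookup \<beta> i)"
  by (simp add: expo_lcm_def)

definition monom :: "'n expo \<Rightarrow> ('n, 'k::comm_ring_1) mpoly"
  where "monom \<beta> = Poly_Mapping.single \<beta> 1"

definition var :: "'n \<Rightarrow> ('n, 'k::comm_ring_1) mpoly"
  where "var i = monom (\<epsilon> i)"

definition homogeneous :: "int \<Rightarrow> ('n::finite, 'k::comm_ring_1) mpoly \<Rightarrow> bool"
  where "homogeneous j p \<longleftrightarrow> (\<forall>\<beta>\<in>Poly_Mapping.keys p. int (expo_deg \<beta>) = j)"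

lemma module_ring: "module ((*) :: 'r::comm_ring_1 \<Rightarrow> 'r \<Rightarrow> 'r)"
  by unfold_locales (simp_all add: algebra_simps)

abbreviation ideal :: "'r::comm_ring_1 set \<Rightarrow> 'r set"
  where "ideal \<equiv> module.span (*)"

definition scale :: "'r::comm_ring_1 \<Rightarrow> ('b \<Rightarrow>\<^sub>0 'r) \<Rightarrow> ('b \<Rightarrow>\<^sub>0 'r)"
  where "scale c u = Poly_Mapping.map ((*) c) u"

lemma lookup_scale: "Poly_Mapping.lookup (scale c u) b = c * Poly_Mapping.lookup u b"
  by (simp add: scale_def Poly_Mapping.map.rep_eq when_def)

lemma module_scale: "module (scale :: 'r::comm_ring_1 \<Rightarrow> ('b \<Rightarrow>\<^sub>0 'r) \<Rightarrow> _)"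
  by unfold_locales (rule poly_mapping_eqI; simp add: lookup_scale lookup_add algebra_simps)+

text \<open>The \<open>R\<close>-linear extension of a map given on basis vectors.\<close>

definition lin_ext :: "('b \<Rightarrow> ('c \<Rightarrow>\<^sub>0 'r)) \<Rightarrow> ('b \<Rightarrow>\<^sub>0 'r::comm_ring_1) \<Rightarrow> ('c \<Rightarrow>\<^sub>0 'r)"
  where "lin_ext f u = (\<Sum>b\<in>Poly_Mapping.keys u. scale (Poly_Mapping.lookup u b) (f b))"

lemma lin_ext_superset:
  fixes f :: "'b \<Rightarrow> ('c \<Rightarrow>\<^sub>0 'r::comm_ring_1)"
  assumes "finite X" "Poly_Mapping.keys u \<subseteq> X"
  shows "lin_ext f u = (\<Sum>b\<in>X. scale (Poly_Mapping.lookup u b) (f b))"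
proof -
  have z: "scale 0 v = 0" for v :: "'c \<Rightarrow>\<^sub>0 'r" by (rule poly_mapping_eqI) (simp add: lookup_scale)
  show ?thesis unfolding lin_ext_def
    by (rule sum.mono_neutral_left) (use assms in \<open>auto simp: in_keys_iff z\<close>)
qed

lemma module_hom_lin_ext:
  fixes f :: "'a \<Rightarrow> ('c \<Rightarrow>\<^sub>0 'r::comm_ring_1)"
  shows "module_hom scale scale (lin_ext f)"
proof -
  interpret a: module "scale :: 'r \<Rightarrow> ('a \<Rightarrow>\<^sub>0 'r) \<Rightarrow> _" by (rule module_scale)
  interpret b: module "scale :: 'r \<Rightarrow> ('c \<Rightarrow>\<^sub>0 'r) \<Rightarrow> _" by (rule module_scale)
  show ?thesis
  proof
    fix u v :: "'a \<Rightarrow>\<^sub>0 'r"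
    let ?X = "Poly_Mapping.keys u \<union> Poly_Mapping.keys v"
    have 1: "finite ?X" "Poly_Mapping.keys (u + v) \<subseteq> ?X" "Poly_Mapping.keys u \<subseteq> ?X"
      "Poly_Mapping.keys v \<subseteq> ?X"
      using Poly_Mapping.keys_add[of u v] by auto
    show "lin_ext f (u + v) = lin_ext f u + lin_ext f v"
      by (simp only: lin_ext_superset[OF 1(1) 1(2)] lin_ext_superset[OF 1(1) 1(3)]
           lin_ext_superset[OF 1(1) 1(4)] lookup_add b.scale_left_distrib sum.distrib)
  next
    fix c and u :: "'a \<Rightarrow>\<^sub>0 'r"
    have 1: "finite (Poly_Mapping.keys u)" "Poly_Mapping.keys (scale c u) \<subseteq> Poly_Mapping.keys u"
      by (auto simp: in_keys_iff lookup_scale)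
    show "lin_ext f (scale c u) = scale c (lin_ext f u)"
      by (simp only: lin_ext_superset[OF 1] lin_ext_superset[OF 1(1) subset_refl]
            lookup_scale b.scale_sum_right b.scale_scale)
  qed
qed

lemma lin_ext_single: "lin_ext f (Poly_Mapping.single b 1) = f b"
  by (rule poly_mapping_eqI) (simp add: lin_ext_def lookup_scale)


section \<open>Minimal graded free resolutions\<close>

text \<open>
  The modules \<open>F 0, F 1, \<dots>\<close> are submodules of one ambient \<open>R\<close>-module with scalar multiplication
  \<open>sc\<close>, and \<open>\<eta>\<close> is an isomorphism \<open>R \<cong> F 0\<close>.
\<close>

definition is_basis :: "('r::comm_ring_1 \<Rightarrow> 'm::ab_group_add \<Rightarrow> 'm) \<Rightarrow> 'm set \<Rightarrow> 'm set \<Rightarrow> bool"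
  where "is_basis sc X M \<longleftrightarrow> \<not> module.dependent sc X \<and> module.span sc X = M"

definition linear_between ::
    "('r::comm_ring_1 \<Rightarrow> 'm::ab_group_add \<Rightarrow> 'm) \<Rightarrow> 'm set \<Rightarrow> 'm set \<Rightarrow> ('m \<Rightarrow> 'm) \<Rightarrow> bool"
  where "linear_between sc M N f \<longleftrightarrow> f ` M \<subseteq> N \<and>
    (\<forall>u\<in>M. \<forall>v\<in>M. f (u + v) = f u + f v) \<and> (\<forall>c. \<forall>u\<in>M. f (sc c u) = sc c (f u))"

definition free_resolution ::
    "('r::comm_ring_1 \<Rightarrow> 'm::ab_group_add \<Rightarrow> 'm) \<Rightarrow> ('r \<Rightarrow> 'm) \<Rightarrow> (nat \<Rightarrow> 'm set) \<Rightarrow>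
     (nat \<Rightarrow> 'm \<Rightarrow> 'm) \<Rightarrow> 'r set \<Rightarrow> bool"
  where "free_resolution sc \<eta> F l I \<longleftrightarrow>
    module_hom (*) sc \<eta> \<and> bij_betw \<eta> UNIV (F 0) \<and>
    (\<forall>i. \<exists>X. finite X \<and> is_basis sc X (F i)) \<and>
    (\<forall>i\<ge>1. linear_between sc (F i) (F (i - 1)) (l i)) \<and>
    l 1 ` F 1 = \<eta> ` I \<and>
    (\<forall>i\<ge>1. {u \<in> F i. l i u = 0} = l (i + 1) ` F (i + 1))"

text \<open>
  The \<open>F i\<close> are graded free, \<open>F 0\<close> carries the standard grading of \<open>R\<close>, and all \<open>l i\<close> have degree \<open>0\<close>:
  there are bases \<open>X i\<close> whose elements \<open>x\<close> can be assigned degrees \<open>\<delta> i x\<close> such that the matrix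
  entry of \<open>l i\<close> from \<open>x\<close> to \<open>y\<close> is homogeneous of degree \<open>\<delta> i x - \<delta> (i - 1) y\<close>
  (hence zero if this is negative).
\<close>

definition graded_complex ::
    "(('n::finite, 'k::comm_ring_1) mpoly \<Rightarrow> 'm::ab_group_add \<Rightarrow> 'm) \<Rightarrow> (('n, 'k) mpoly \<Rightarrow> 'm) \<Rightarrow>
     (nat \<Rightarrow> 'm set) \<Rightarrow> (nat \<Rightarrow> 'm \<Rightarrow> 'm) \<Rightarrow> bool"
  where "graded_complex sc \<eta> F l \<longleftrightarrow>
    (\<exists>X. \<exists>\<delta> :: nat \<Rightarrow> 'm \<Rightarrow> int.
      (\<forall>i. finite (X i) \<and> is_basis sc (X i) (F i)) \<and>
      X 0 = {\<eta> 1} \<and> \<delta> 0 (\<eta> 1) = 0 \<and>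
      (\<forall>i\<ge>1. \<forall>x\<in>X i. \<exists>c. l i x = (\<Sum>y\<in>X (i - 1). sc (c y) y) \<and>
        (\<forall>y\<in>X (i - 1). homogeneous (\<delta> i x - \<delta> (i - 1) y) (c y))))"

definition max_ideal :: "('n, 'k::comm_ring_1) mpoly set"
  where "max_ideal = ideal (range var)"

definition ideal_times ::
    "('r::comm_ring_1 \<Rightarrow> 'm::ab_group_add \<Rightarrow> 'm) \<Rightarrow> 'r set \<Rightarrow> 'm set \<Rightarrow> 'm set"
  where "ideal_times sc I M = module.span sc {sc a u |a u. a \<in> I \<and> u \<in> M}"

definition minimal_free_resolution ::
    "(('n::finite, 'k::comm_ring_1) mpoly \<Rightarrow> 'm::ab_group_add \<Rightarrow> 'm) \<Rightarrow> (('n, 'k) mpoly \<Rightarrow> 'm) \<Rightarrow>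
     (nat \<Rightarrow> 'm set) \<Rightarrow> (nat \<Rightarrow> 'm \<Rightarrow> 'm) \<Rightarrow> ('n, 'k) mpoly set \<Rightarrow> bool"
  where "minimal_free_resolution sc \<eta> F l I \<longleftrightarrow>
    free_resolution sc \<eta> F l I \<and> graded_complex sc \<eta> F l \<and>
    (\<forall>i\<ge>1. l i ` F i \<subseteq> ideal_times sc max_ideal (F (i - 1)))"


section \<open>Exterior and symmetric powers, and the modules $L$\<close>

text \<open>
  \<open>\<And>F \<otimes> S(F)\<close>, the sum over all degrees, is the free module on the symbols \<open>e\<^sub>A \<otimes> e\<^sup>\<beta>\<close>, coded as
  pairs \<open>(A, \<beta>)\<close>; \<open>wedge_sym i d\<close> is \<open>\<And>\<^sup>i F \<otimes> S\<^sub>d(F)\<close>.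
\<close>

type_synonym ('n, 'k) WS = "('n set \<times> 'n expo) \<Rightarrow>\<^sub>0 ('n, 'k) mpoly"

definition wedge_sym :: "nat \<Rightarrow> nat \<Rightarrow> ('n::finite, 'k::comm_ring_1) WS set"
  where "wedge_sym i d = {u. \<forall>(A, \<beta>)\<in>Poly_Mapping.keys u. card A = i \<and> expo_deg \<beta> = d}"

definition sgn_in :: "'n::linorder \<Rightarrow> 'n set \<Rightarrow> 'r::comm_ring_1"
  where "sgn_in a A = (-1) ^ card {b \<in> A. b < a}"

text \<open>
  For disjoint \<open>J\<close> and \<open>S\<close>, \<open>e\<^sub>J \<and> e\<^sub>S = wedge_sgn J S e\<^bsub>J \<union> S\<^esub>\<close>: the sign of the permutation sorting
  the concatenation of \<open>J\<close> and \<open>S\<close>.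
\<close>

definition wedge_sgn :: "'n::linorder set \<Rightarrow> 'n set \<Rightarrow> 'r::comm_ring_1"
  where "wedge_sgn J S = (-1) ^ card {(j, s). j \<in> J \<and> s \<in> S \<and> s < j}"

definition kappa :: "('n::{finite,linorder}, 'k::comm_ring_1) WS \<Rightarrow> ('n, 'k) WS"
  where "kappa = lin_ext (\<lambda>(A, \<beta>).
    \<Sum>a\<in>A. scale (sgn_in a A) (Poly_Mapping.single (A - {a}, \<beta> + \<epsilon> a) 1))"

text \<open>\<open>Kos\<^sup>\<psi> \<otimes> 1\<close>\<close>

definition Kos_tensor :: "('n::{finite,linorder}, 'k::comm_ring_1) WS \<Rightarrow> ('n, 'k) WS"
  where "Kos_tensor = lin_ext (\<lambda>(A, \<beta>).
    \<Sum>a\<in>A. scale (sgn_in a A * var a) (Poly_Mapping.single (A - {a}, \<beta>) 1))"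

definition L :: "nat \<Rightarrow> nat \<Rightarrow> ('n::{finite,linorder}, 'k::comm_ring_1) WS set"
  where "L d i = {u \<in> wedge_sym i d. kappa u = 0}"

text \<open>The element of \<open>L\<close> denoted by \<open>e\<^sub>A \<otimes> e\<^sup>\<beta>\<close>.\<close>

definition Lsym :: "'n::{finite,linorder} set \<Rightarrow> 'n expo \<Rightarrow> ('n, 'k::comm_ring_1) WS"
  where "Lsym A \<beta> = kappa (Poly_Mapping.single (A, \<beta>) 1)"

definition standard :: "'n::{finite,linorder} set \<Rightarrow> 'n expo \<Rightarrow> bool"
  where "standard A \<beta> \<longleftrightarrow> Supp \<beta> = {} \<or> Min A \<le> Min (Supp \<beta>)"

lemma kappa_Lsym: "kappa (Lsym A \<beta>) = (0 :: ('n::{finite,linorder}, 'k::comm_ring_1) WS)"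
proof -
  interpret m: module "scale :: ('n, 'k) mpoly \<Rightarrow> ('n, 'k) WS \<Rightarrow> _" by (rule module_scale)
  interpret k: module_hom scale scale "kappa :: ('n, 'k) WS \<Rightarrow> _"
    unfolding kappa_def by (rule module_hom_lin_ext)
  define g :: "'n \<Rightarrow> 'n \<Rightarrow> ('n, 'k) WS" where
    "g a b = scale (sgn_in a A * sgn_in b (A - {a}))
      (Poly_Mapping.single (A - {a} - {b}, \<beta> + \<epsilon> a + \<epsilon> b) 1)" for a b
  have anti: "g a b = - g b a" if "a \<in> A" "b \<in> A" "a < b" for a b
  proof -
    have "{c \<in> A. c < b} = insert a {c \<in> A - {a}. c < b}" using that by auto
    then have 1: "sgn_in b A = - (sgn_in b (A - {a}) :: ('n, 'k) mpoly)" by (simp add: sgn_in_def)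
    have "{c \<in> A - {b}. c < a} = {c \<in> A. c < a}" using that by auto
    then have 2: "sgn_in a (A - {b}) = (sgn_in a A :: ('n, 'k) mpoly)" by (simp add: sgn_in_def)
    have "A - {a} - {b} = A - {b} - {a}" "\<beta> + \<epsilon> a + \<epsilon> b = \<beta> + \<epsilon> b + \<epsilon> a" by (auto simp: ac_simps)
    then show ?thesis unfolding g_def 1 2
      by (simp add: m.scale_minus_left mult.commute)
  qed
  have kap: "kappa (Poly_Mapping.single (A, \<beta>) 1) =
      (\<Sum>a\<in>A. scale (sgn_in a A) (Poly_Mapping.single (A - {a}, \<beta> + \<epsilon> a) (1 :: ('n, 'k) mpoly)))"
    for A :: "'n set" and \<beta>
    by (simp add: kappa_def lin_ext_single)
  have "kappa (Lsym A \<beta>) = (\<Sum>a\<in>A. \<Sum>b\<in>A - {a}. g a b)"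
    by (simp add: Lsym_def kap k.sum k.scale m.scale_sum_right g_def)
  also have "\<dots> = (\<Sum>a\<in>A. (\<Sum>b\<in>{b \<in> A. a < b}. g a b) + (\<Sum>b\<in>{b \<in> A. b < a}. g a b))"
    by (intro sum.cong refl, subst sum.union_disjoint[symmetric]) (auto intro!: sum.cong)
  also have "\<dots> = (\<Sum>a\<in>A. \<Sum>b\<in>{b \<in> A. a < b}. g a b) + (\<Sum>a\<in>A. \<Sum>b\<in>{b \<in> A. b < a}. g a b)"
    by (rule sum.distrib)
  also have "(\<Sum>a\<in>A. \<Sum>b\<in>{b \<in> A. b < a}. g a b) = (\<Sum>b\<in>A. \<Sum>a\<in>{a \<in> A. b < a}. g a b)"
    by (rule sum.swap_restrict) auto
  also have "\<dots> = - (\<Sum>a\<in>A. \<Sum>b\<in>{b \<in> A. a < b}. g a b)"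
    by (simp add: sum_negf[symmetric] anti)
  finally show ?thesis by simp
qed

lemma expo_deg_plus: "expo_deg (\<beta> + \<epsilon> a) = expo_deg \<beta> + 1"
  by (simp add: expo_deg_def lookup_add sum.distrib lookup_single when_def)

lemma subspace_L: "module.subspace scale (L d i :: ('n::{finite,linorder}, 'k::comm_ring_1) WS set)"
proof -
  interpret m: module "scale :: ('n, 'k) mpoly \<Rightarrow> ('n, 'k) WS \<Rightarrow> _" by (rule module_scale)
  interpret k: module_hom scale scale "kappa :: ('n, 'k) WS \<Rightarrow> _"
    unfolding kappa_def by (rule module_hom_lin_ext)
  have "Poly_Mapping.keys (scale c u) \<subseteq> Poly_Mapping.keys u" for c and u :: "('n, 'k) WS"
    by (auto simp: in_keys_iff lookup_scale)
  then show ?thesis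
    unfolding m.subspace_def L_def wedge_sym_def
    by (auto simp: k.add k.scale dest!: subsetD[OF Poly_Mapping.keys_add] dest: subsetD)
       blast+
qed

lemma Lsym_in_L:
  assumes "card A = i + 1" "expo_deg \<beta> + 1 = d"
  shows "Lsym A \<beta> \<in> (L d i :: ('n::{finite,linorder}, 'k::comm_ring_1) WS set)"
proof -
  interpret m: module "scale :: ('n, 'k) mpoly \<Rightarrow> ('n, 'k) WS \<Rightarrow> _" by (rule module_scale)
  have "Poly_Mapping.keys (Lsym A \<beta> :: ('n, 'k) WS) \<subseteq> (\<Union>a\<in>A. {(A - {a}, \<beta> + \<epsilon> a)})"
    unfolding Lsym_def kappa_def lin_ext_single split
    by (rule order_trans[OF keys_sum UN_mono])
      (auto simp: in_keys_iff lookup_scale lookup_single when_def split: if_splits)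
  then have "Lsym A \<beta> \<in> (wedge_sym i d :: ('n, 'k) WS set)"
    using assms by (auto simp: wedge_sym_def expo_deg_plus[simplified] card_Diff_singleton dest!: subsetD)
  then show ?thesis by (simp add: L_def kappa_Lsym)
qed

text \<open>
  The generators of \<open>L\<^sub>d\<^bsup>i,B\<^esup>\<close>, for a family \<open>\<alpha> 1, \<dots>, \<alpha> r\<close>.  An index \<open>k = k\<^sub>p\<^sup>s\<close> is represented by
  itself as an element of \<open>Supp (\<alpha> s)\<close>, and \<open>kt\<close> is \<open>k\<^sub>t\<^sup>s\<close>.
\<close>

definition LB_gens ::
    "nat \<Rightarrow> nat \<Rightarrow> (nat \<Rightarrow> 'n expo) \<Rightarrow> nat \<Rightarrow> ('n::{finite,linorder}, 'k::comm_ring_1) WS set"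
  where "LB_gens d r \<alpha> i =
    {Lsym A \<beta> |A \<beta>. card A = i + 1 \<and> expo_deg \<beta> = d - 1 \<and> standard A \<beta> \<and>
       (\<forall>s\<in>{1..r}. \<forall>k\<in>Supp (\<alpha> s). \<beta> \<noteq> \<alpha> s - \<epsilon> k)} \<union>
    {Lsym A (\<alpha> s - \<epsilon> k) |A s k. s \<in> {1..r} \<and> k \<in> Supp (\<alpha> s) \<and> card A = i + 1 \<and>
       standard A (\<alpha> s - \<epsilon> k) \<and> k \<notin> A} \<union>
    {scale (sgn_in k (J \<union> {k})) (Lsym (J \<union> {k}) (\<alpha> s - \<epsilon> k)) -
     scale (sgn_in kt (J \<union> {kt})) (Lsym (J \<union> {kt}) (\<alpha> s - \<epsilon> kt)) |J s k kt.
       s \<in> {1..r} \<and> k \<in> Supp (\<alpha> s) \<and> card J = i \<and> k \<notin> J \<and>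
       kt \<in> Supp (\<alpha> s) \<and> {k' \<in> Supp (\<alpha> s). k' < kt} \<subseteq> J \<and> kt \<notin> J \<and>
       standard (J \<union> {k}) (\<alpha> s - \<epsilon> k) \<and> standard (J \<union> {kt}) (\<alpha> s - \<epsilon> kt)}"

definition LB ::
    "nat \<Rightarrow> nat \<Rightarrow> (nat \<Rightarrow> 'n expo) \<Rightarrow> nat \<Rightarrow> ('n::{finite,linorder}, 'k::comm_ring_1) WS set"
  where "LB d r \<alpha> i = module.span scale (LB_gens d r \<alpha> i)"

lemma LB_subset_L:
  assumes d: "d \<ge> 1" and "\<And>s. s \<in> {1..r} \<Longrightarrow> expo_deg (\<alpha> s) = d"
  shows "LB d r \<alpha> i \<subseteq> (L d i :: ('n::{finite,linorder}, 'k::comm_ring_1) WS set)"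
proof -
  interpret m: module "scale :: ('n, 'k) mpoly \<Rightarrow> ('n, 'k) WS \<Rightarrow> _" by (rule module_scale)
  have deg: "expo_deg (\<alpha> s - \<epsilon> k) + 1 = d" if "s \<in> {1..r}" "k \<in> Supp (\<alpha> s)" for s k
  proof -
    have "\<alpha> s - \<epsilon> k + \<epsilon> k = \<alpha> s"
      using that(2) by (intro poly_mapping_eqI)
        (auto simp: lookup_add lookup_minus lookup_single when_def in_keys_iff)
    then show ?thesis using assms(2)[OF that(1)] by (metis expo_deg_plus)
  qed
  have "LB_gens d r \<alpha> i \<subseteq> (L d i :: ('n, 'k) WS set)"
    unfolding LB_gens_def using d
    by (auto intro!: Lsym_in_L deg m.subspace_diff[OF subspace_L] m.subspace_scale[OF subspace_L]
         simp: deg simp del: One_nat_def)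
  then show ?thesis unfolding LB_def by (rule m.span_minimal[OF _ subspace_L])
qed

text \<open>\<open>S\<^sub>d(\<psi>)\<close>, with \<open>e\<^sup>\<beta> \<in> S\<^sub>d(F)\<close> identified with \<open>e\<^sub>\<emptyset> \<otimes> e\<^sup>\<beta> \<in> \<And>\<^sup>0 F \<otimes> S\<^sub>d(F)\<close>.\<close>

definition S_psi :: "('n::{finite,linorder}, 'k::comm_ring_1) WS \<Rightarrow> ('n, 'k) mpoly"
  where "S_psi u =
    (\<Sum>(A, \<beta>)\<in>Poly_Mapping.keys u. Poly_Mapping.lookup u (A, \<beta>) * (if A = {} then monom \<beta> else 0))"


section \<open>The complex\<close>

text \<open>
  \<open>(s, J)\<close> codes the basis element \<open>e\<^sub>J\<close> of the summand \<open>K\<^bsup>\<alpha>\<^sup>s\<^esup>\<close>; \<open>Ksum r \<alpha> i\<close> is the direct sum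
  of the \<open>K\<^bsup>\<alpha>\<^sup>s\<^esup>\<close> in (integer) degree \<open>i - n\<^bsub>\<alpha>\<^sup>s\<^esub>\<close> over \<open>1 \<le> s \<le> r\<close>.
\<close>

type_synonym ('n, 'k) KS = "(nat \<times> 'n set) \<Rightarrow>\<^sub>0 ('n, 'k) mpoly"

definition K_basis :: "'n expo \<Rightarrow> int \<Rightarrow> 'n set set"
  where "K_basis a j =
    (if card (Supp a) > 1 then {J. J \<inter> Supp a = {} \<and> int (card J) = j} else {})"

definition Ksum :: "nat \<Rightarrow> (nat \<Rightarrow> 'n expo) \<Rightarrow> nat \<Rightarrow> ('n::{finite,linorder}, 'k::comm_ring_1) KS set"
  where "Ksum r \<alpha> i = {v. \<forall>(s, J)\<in>Poly_Mapping.keys v.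
    s \<in> {1..r} \<and> J \<in> K_basis (\<alpha> s) (int i - int (card (Supp (\<alpha> s))))}"

definition Kos_K :: "('n::{finite,linorder}, 'k::comm_ring_1) KS \<Rightarrow> ('n, 'k) KS"
  where "Kos_K = lin_ext (\<lambda>(s, J).
    \<Sum>j\<in>J. scale (sgn_in j J * var j) (Poly_Mapping.single (s, J - {j}) 1))"

definition Theta_basis :: "'n expo \<Rightarrow> 'n set \<Rightarrow> ('n::{finite,linorder}, 'k::comm_ring_1) WS"
  where "Theta_basis a J =
    (let S = Supp a; sg = (\<lambda>k. sgn_in k (S \<union> J)) in
      scale (wedge_sgn J S)
        (\<Sum>k\<in>S. scale (sg k * var k ^ 2) (Lsym ((S - {k}) \<union> J) (a - \<epsilon> k))) +
      scale (wedge_sgn J S)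
        (\<Sum>(k, l)\<in>{(k, l). k \<in> S \<and> l \<in> S \<and> k < l}. scale (var k * var l)
          (scale (sg l) (Lsym ((S - {l}) \<union> J) (a - \<epsilon> k)) +
           scale (sg k) (Lsym ((S - {k}) \<union> J) (a - \<epsilon> l)))))"

text \<open>
  The defining formula does not depend on the homological degree, so \<open>Theta \<alpha>\<close> stands for all \<open>\<Theta>\<^sub>p\<close>.
\<close>

definition Theta :: "(nat \<Rightarrow> 'n expo) \<Rightarrow> ('n::{finite,linorder}, 'k::comm_ring_1) KS \<Rightarrow> ('n, 'k) WS"
  where "Theta \<alpha> = lin_ext (\<lambda>(s, J). Theta_basis (\<alpha> s) J)"

text \<open>
  All terms of the complex live in the ambient module \<open>R \<oplus> (\<And>F \<otimes> S(F)) \<oplus> K\<close>, where the first factor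
  is occupied only by \<open>F\<^sub>0 = R\<close>.
\<close>

type_synonym ('n, 'k) ambient = "('n, 'k) mpoly \<times> ('n, 'k) WS \<times> ('n, 'k) KS"

definition amb_scale ::
    "('n, 'k::comm_ring_1) mpoly \<Rightarrow> ('n, 'k) ambient \<Rightarrow> ('n, 'k) ambient"
  where "amb_scale c = (\<lambda>(p, u, v). (c * p, scale c u, scale c v))"

lemma module_amb_scale:
  "module (amb_scale :: ('n, 'k::comm_ring_1) mpoly \<Rightarrow> ('n, 'k) ambient \<Rightarrow> _)"
proof -
  interpret a: module "scale :: ('n, 'k) mpoly \<Rightarrow> ('n, 'k) WS \<Rightarrow> _" by (rule module_scale)
  interpret b: module "scale :: ('n, 'k) mpoly \<Rightarrow> ('n, 'k) KS \<Rightarrow> _" by (rule module_scale)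
  show ?thesis
    by unfold_locales
      (auto simp: amb_scale_def algebra_simps a.scale_right_distrib a.scale_left_distrib
        b.scale_right_distrib b.scale_left_distrib)
qed

definition amb_embed :: "('n, 'k::comm_ring_1) mpoly \<Rightarrow> ('n, 'k) ambient"
  where "amb_embed p = (p, 0, 0)"

definition res_mod ::
    "nat \<Rightarrow> nat \<Rightarrow> (nat \<Rightarrow> 'n expo) \<Rightarrow> nat \<Rightarrow> ('n::{finite,linorder}, 'k::comm_ring_1) ambient set"
  where "res_mod d r \<alpha> i =
    (if i = 0 then range amb_embed
     else {(0, u, v) |u v. u \<in> LB d r \<alpha> (i - 1) \<and> v \<in> Ksum r \<alpha> i})"

text \<open>\<open>F\<^sub>1\<close> has no \<open>K\<close>-part, because \<open>K\<^bsup>\<alpha>\<^sup>s\<^esup> = 0\<close> if \<open>n\<^bsub>\<alpha>\<^sup>s\<^esub> = 1\<close>.  The value at \<open>0\<close> is immaterial.\<close>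

definition res_diff ::
    "(nat \<Rightarrow> 'n expo) \<Rightarrow> nat \<Rightarrow>
     ('n::{finite,linorder}, 'k::comm_ring_1) ambient \<Rightarrow> ('n, 'k) ambient"
  where "res_diff \<alpha> i = (\<lambda>(p, u, v).
    if i = 0 then 0
    else if i = 1 then (S_psi u, 0, 0)
    else if i = 2 then (0, Kos_tensor u + Theta \<alpha> v, 0)
    else (0, Kos_tensor u + Theta \<alpha> v, - Kos_K v))"

definition K' :: "nat \<Rightarrow> 'n expo set \<Rightarrow> ('n::finite, 'k::comm_ring_1) mpoly set"
  where "K' d B = ideal {monom \<beta> |\<beta>. expo_deg \<beta> = d \<and> \<beta> \<notin> B}"

end

theory Submission
  imports Defs
begin

text \<open>
  The complexes \<open>L\<^sub>d\<^sup>\<bullet> \<rightarrow> R\<close> resolve \<open>\<mm>\<^sup>d\<close>.  Two observations reduce the theorem to this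
  fact.  First, \<open>L\<^sub>d\<^bsup>i,B\<^esup>\<close> consists of those elements of \<open>L\<^sub>d\<^sup>i\<close> in which no basis vector
  \<open>e\<^sub>J \<otimes> e\<^sup>\<beta>\<close> with \<open>\<beta> \<in> B\<close> occurs; the lcm condition makes the conditions for different \<open>\<alpha>\<^sup>s\<close>
  independent.  Secondly, \<open>\<Theta> = - (Kos \<lambda> + \<lambda> Kos)\<close> for
  \<open>\<lambda>(e\<^sub>J) = \<plusminus> \<Sum>\<^sub>k x\<^sub>k e\<^bsub>J \<union> Supp \<alpha>\<^esub> \<otimes> e\<^bsup>\<alpha> - \<epsilon>\<^sub>k\<^esup>\<close>, so \<open>(u, v) \<mapsto> u - \<lambda> v\<close> embeds the complex \<open>F\<close> into
  \<open>L\<^sub>d\<close>.  Exactness is then checked inside \<open>L\<^sub>d\<close>: for a cycle \<open>u\<close> of the image write \<open>u = Kos w\<close>;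
  the terms \<open>e\<^sub>J \<otimes> e\<^sup>\<beta>\<close>, \<open>\<beta> \<in> B\<close>, of \<open>w\<close> form, up to an element supported on \<open>J \<supseteq> Supp \<beta>\<close>, a cycle
  of a Koszul complex, which corrects \<open>w\<close>.
\<close>

text \<open>Where the summands K come from: let Q be the quotient of L_d by the subcomplex L_d^B. It
  has the basis e_J \<otimes> e^\<beta> with \<beta> in B and Supp \<beta> not inside J. If Supp
  \<beta> has more than one element, the part of Q over \<beta> is a subcomplex of the full Koszul
  complex on e^\<beta>. The quotient E, spanned by the J containing Supp \<beta>, is the Koszul
  complex in the remaining variables, shifted by n_\<beta>. The full Koszul complex is exact in
  positive degrees, so in positive degrees the homology of Q is that of E one degree higher; the
  summands K kill it. If Supp \<beta> is a singleton, Q over \<beta> is itself a Koszul complex and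
  K is 0. The map \<lambda> is a lift to L_d of the connecting map from E to Q. Therefore the image
  of F in L_d can be recognised by B-parts alone: it consists of the u whose B-part is the Q-part of
  Kos z for some z in E. This replaces long exact sequences by direct corrections of a preimage. All
  homotopies move one chosen variable instead of averaging over the variables, so nothing is divided
  by and the characteristic is arbitrary.\<close>

declare One_nat_def [simp del] add_2_eq_Suc [simp del] add_2_eq_Suc' [simp del]


section \<open>Free modules\<close>

abbreviation "lookup \<equiv> Poly_Mapping.lookup"
abbreviation "keys \<equiv> Poly_Mapping.keys"
abbreviation "single \<equiv> Poly_Mapping.single"

interpretation fm: module "scale :: 'r::comm_ring_1 \<Rightarrow> ('b \<Rightarrow>\<^sub>0 'r) \<Rightarrow> _"
  by (rule module_scale)

interpretation amb: module "amb_scale :: ('n, 'k::comm_ring_1) mpoly \<Rightarrow> ('n, 'k) ambient \<Rightarrow> _"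
  by (rule module_amb_scale)

lemma keys_scale: "keys (scale c u) \<subseteq> keys u"
  by (auto simp: in_keys_iff lookup_scale)

lemma poly_mapping_expand:
  fixes u :: "'b \<Rightarrow>\<^sub>0 'r::comm_ring_1"
  shows "u = (\<Sum>b\<in>keys u. scale (lookup u b) (single b 1))"
  by (rule poly_mapping_eqI)
    (auto simp: lookup_sum lookup_scale lookup_single when_def in_keys_iff if_distrib[of "(*) _"]
      cong: if_cong)

text \<open>Reduces identities between R-linear maps to basis vectors. The set \<open>X\<close>
  allows identities that hold only on a coordinate submodule.\<close>

lemma free_module_induct [consumes 1, case_names basis zero add scale]:
  fixes u :: "'b \<Rightarrow>\<^sub>0 'r::comm_ring_1"
  assumes "keys u \<subseteq> X"
    and "\<And>b. b \<in> X \<Longrightarrow> P (single b 1)" "P 0"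
    and "\<And>u v. P u \<Longrightarrow> P v \<Longrightarrow> P (u + v)" "\<And>c u. P u \<Longrightarrow> P (scale c u)"
  shows "P u"
proof -
  have "P (\<Sum>b\<in>Y. scale (lookup u b) (single b 1))" if "finite Y" "Y \<subseteq> X" for Y
    using that by (induction Y) (auto intro: assms)
  from this[OF finite_keys assms(1)] show ?thesis
    using poly_mapping_expand[of u] by simp
qed

lemma keys_subset_add: "keys u \<subseteq> X \<Longrightarrow> keys v \<subseteq> X \<Longrightarrow> keys (u + v) \<subseteq> X"
  using Poly_Mapping.keys_add[of u v] by blast

lemma keys_subset_minus:
  fixes u v :: "'b \<Rightarrow>\<^sub>0 'r::comm_ring_1"
  shows "keys u \<subseteq> X \<Longrightarrow> keys v \<subseteq> X \<Longrightarrow> keys (u - v) \<subseteq> X"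
  using keys_subset_add[of u X "- v"] by (simp add: Poly_Mapping.keys.rep_eq)

lemma keys_subset_scale: "keys u \<subseteq> X \<Longrightarrow> keys (scale c u) \<subseteq> X"
  using keys_scale[of c u] by blast

lemma keys_subset_sum: "(\<And>i. i \<in> I \<Longrightarrow> keys (f i) \<subseteq> X) \<Longrightarrow> keys (sum f I) \<subseteq> X"
  by (induction I rule: infinite_finite_induct) (simp_all add: keys_subset_add)

lemma keys_subset_lin_ext:
  assumes "keys u \<subseteq> X" "\<And>b. b \<in> X \<Longrightarrow> keys (f b) \<subseteq> Y"
  shows "keys (lin_ext f u) \<subseteq> Y"
  unfolding lin_ext_def using assms by (intro keys_subset_sum keys_subset_scale) blast

lemma keys_subset_single: "b \<in> X \<Longrightarrow> keys (single b c) \<subseteq> X"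
  by (simp split: if_splits)

lemma lookup_lin_ext: "lookup (lin_ext f u) c = (\<Sum>b\<in>keys u. lookup u b * lookup (f b) c)"
  by (simp add: lin_ext_def lookup_sum lookup_scale)

text \<open>Coordinate projection, written as a \<open>lin_ext\<close> so that linearity comes from
  \<open>module_hom_lin_ext\<close>.\<close>

definition restr :: "('b \<Rightarrow> bool) \<Rightarrow> ('b \<Rightarrow>\<^sub>0 'r) \<Rightarrow> ('b \<Rightarrow>\<^sub>0 'r::comm_ring_1)"
  where "restr P = lin_ext (\<lambda>b. if P b then single b 1 else 0)"

interpretation restr: module_hom scale scale "restr P :: ('b \<Rightarrow>\<^sub>0 'r::comm_ring_1) \<Rightarrow> _"
  unfolding restr_def by (rule module_hom_lin_ext)

lemma restr_single: "restr P (single b 1) = (if P b then single b 1 else 0)"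
  by (simp add: restr_def lin_ext_single)

lemma lookup_restr: "lookup (restr P u) b = (if P b then lookup u b else 0)"
proof -
  have "keys u \<subseteq> UNIV" by simp
  then show ?thesis
    by (induction rule: free_module_induct)
      (auto simp: restr_single restr.add restr.scale lookup_add lookup_scale lookup_single when_def)
qed

lemma keys_restr: "keys (restr P u) = {b \<in> keys u. P b}"
  by (auto simp: in_keys_iff lookup_restr split: if_splits)

lemma restr_id: "keys u \<subseteq> {b. P b} \<Longrightarrow> restr P u = u"
  by (rule poly_mapping_eqI) (auto simp: lookup_restr in_keys_iff)

lemma restr_eq_0: "keys u \<subseteq> {b. \<not> P b} \<Longrightarrow> restr P u = 0"
  by (rule poly_mapping_eqI) (auto simp: lookup_restr in_keys_iff)

lemma restr_split: "keys u \<subseteq> {b. P b \<or> Q b} \<Longrightarrow> (\<And>b. P b \<Longrightarrow> \<not> Q b) \<Longrightarrow> u = restr P u + restr Q u"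
  by (rule poly_mapping_eqI) (auto simp: lookup_restr lookup_add in_keys_iff)

text \<open>
  The contracting homotopy of the Koszul complex over \<open>k[x\<^sub>1,\<dots>,x\<^sub>n]\<close> shifts monomials and is not
  \<open>R\<close>-linear; this is why additive extensions are needed.
\<close>

definition add_ext :: "('b \<Rightarrow> 'a \<Rightarrow> 'v::comm_monoid_add) \<Rightarrow> ('b \<Rightarrow>\<^sub>0 'a::comm_monoid_add) \<Rightarrow> 'v"
  where "add_ext f u = (\<Sum>b\<in>keys u. f b (lookup u b))"

lemma add_ext_0 [simp]: "add_ext f 0 = 0"
  by (simp add: add_ext_def)

lemma add_ext_add:
  assumes "\<And>b. f b 0 = 0" "\<And>b x y. f b (x + y) = f b x + f b y"
  shows "add_ext f (u + v) = add_ext f u + add_ext f v"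
  unfolding add_ext_def by (rule setsum_keys_plus_distrib) (use assms in auto)

lemma add_ext_single: "f b 0 = 0 \<Longrightarrow> add_ext f (single b x) = f b x"
  by (simp add: add_ext_def)

text \<open>The counterpart of \<open>free_module_induct\<close> for maps that are only additive.
  Applied to basis vectors and again to the monomials of a coefficient, it reaches single
  terms.\<close>

lemma poly_mapping_additive_induct [case_names zero add single]:
  fixes u :: "'b \<Rightarrow>\<^sub>0 'a::comm_monoid_add"
  assumes "P 0" "\<And>u v. P u \<Longrightarrow> P v \<Longrightarrow> P (u + v)" "\<And>b x. b \<in> keys u \<Longrightarrow> P (single b x)"
  shows "P u"
proof -
  have "P (\<Sum>b\<in>Y. single b (lookup u b))" if "finite Y" "Y \<subseteq> keys u" for Y
    using that by (induction Y) (auto intro: assms)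
  moreover have "(\<Sum>b\<in>keys u. single b (lookup u b)) = u"
    by (rule poly_mapping_eqI) (auto simp: lookup_sum lookup_single when_def in_keys_iff)
  ultimately show ?thesis by (metis finite_keys order_refl)
qed


section \<open>Koszul-type differentials\<close>

lemma unit_expo_diff_add: "k \<in> Supp \<beta> \<Longrightarrow> \<beta> - \<epsilon> k + \<epsilon> k = \<beta>"
  by (rule poly_mapping_eqI) (auto simp: lookup_add lookup_minus lookup_single when_def in_keys_iff)

lemma expo_diff_add_swap: "k \<in> Supp \<beta> \<Longrightarrow> \<beta> - \<epsilon> k + \<epsilon> a = \<beta> + \<epsilon> a - \<epsilon> k"
  by (rule poly_mapping_eqI) (auto simp: lookup_add lookup_minus lookup_single when_def in_keys_iff)

lemma Supp_add_unit: "Supp (\<beta> + \<epsilon> a) = insert a (Supp \<beta>)"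
  by (auto simp: in_keys_iff lookup_add lookup_single when_def split: if_splits)

lemma expo_deg_diff: "k \<in> Supp \<beta> \<Longrightarrow> expo_deg (\<beta> - \<epsilon> k) + 1 = expo_deg \<beta>"
  by (metis unit_expo_diff_add expo_deg_plus)

lemma sgn_in_sq [simp]: "sgn_in a A * sgn_in a A = 1"
  by (simp add: sgn_in_def flip: power_add mult_2)

lemma sgn_in_sq' [simp]: "sgn_in a A * (sgn_in a A * x) = x"
  by (simp add: mult.assoc[symmetric])

lemma sgn_in_remove_greater:
  fixes A :: "'n::{finite,linorder} set"
  shows "a < b \<Longrightarrow> sgn_in a (A - {b}) = sgn_in a A"
  unfolding sgn_in_def by (rule arg_cong[where f = "\<lambda>B. (- 1) ^ card B"]) auto

lemma sgn_in_remove_less: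
  fixes A :: "'n::{finite,linorder} set"
  assumes "a \<in> A" "a < b"
  shows "sgn_in b (A - {a}) = - sgn_in b A"
proof -
  have "{c \<in> A. c < b} = insert a {c \<in> A - {a}. c < b}" using assms by auto
  then show ?thesis by (simp add: sgn_in_def)
qed

lemma sgn_in_anti:
  fixes A :: "'n::{finite,linorder} set"
  assumes "a \<in> A" "b \<in> A" "a \<noteq> b"
  shows "sgn_in b A * sgn_in a (A - {b}) = - (sgn_in a A * sgn_in b (A - {a}) :: 'r::comm_ring_1)"
proof (cases "a < b")
  case True
  then show ?thesis
    using assms by (simp add: sgn_in_remove_less sgn_in_remove_greater mult.commute)
next
  case False
  with assms have "b < a" by simp
  then show ?thesis
    using assms by (simp add: sgn_in_remove_less sgn_in_remove_greater mult.commute)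
qed

lemma double_sum_antisymmetric:
  fixes g :: "'n::linorder \<Rightarrow> 'n \<Rightarrow> 'v::ab_group_add"
  assumes "finite A" "\<And>a b. a \<in> A \<Longrightarrow> b \<in> A \<Longrightarrow> a < b \<Longrightarrow> g a b = - g b a"
  shows "(\<Sum>a\<in>A. \<Sum>b\<in>A - {a}. g a b) = 0"
proof -
  have "(\<Sum>a\<in>A. \<Sum>b\<in>A - {a}. g a b) = (\<Sum>a\<in>A. (\<Sum>b\<in>{b \<in> A. a < b}. g a b) + (\<Sum>b\<in>{b \<in> A. b < a}. g a b))"
    using assms(1) by (intro sum.cong refl, subst sum.union_disjoint[symmetric]) (auto intro!: sum.cong)
  also have "\<dots> = (\<Sum>a\<in>A. \<Sum>b\<in>{b \<in> A. a < b}. g a b) + (\<Sum>a\<in>A. \<Sum>b\<in>{b \<in> A. b < a}. g a b)"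
    by (rule sum.distrib)
  also have "(\<Sum>a\<in>A. \<Sum>b\<in>{b \<in> A. b < a}. g a b) = (\<Sum>b\<in>A. \<Sum>a\<in>{a \<in> A. b < a}. g a b)"
    using assms(1) by (intro sum.swap_restrict)
  also have "\<dots> = - (\<Sum>a\<in>A. \<Sum>b\<in>{b \<in> A. a < b}. g a b)"
    by (simp add: sum_negf[symmetric] assms(2))
  finally show ?thesis by simp
qed

lemma double_sum_swap_off_diagonal:
  fixes A :: "'n::finite set"
  shows "(\<Sum>a\<in>A. \<Sum>b\<in>A - {a}. g a b) = (\<Sum>a\<in>A. \<Sum>b\<in>A - {a}. g b a)"
proof -
  have "(\<Sum>a\<in>A. \<Sum>b\<in>A - {a}. g a b) = (\<Sum>a\<in>A. \<Sum>b\<in>{b \<in> A. b \<noteq> a}. g a b)"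
    by (intro sum.cong) auto
  also have "\<dots> = (\<Sum>b\<in>A. \<Sum>a\<in>{a \<in> A. b \<noteq> a}. g a b)"
    by (rule sum.swap_restrict) auto
  also have "\<dots> = (\<Sum>a\<in>A. \<Sum>b\<in>A - {a}. g b a)"
    by (intro sum.cong) auto
  finally show ?thesis .
qed

interpretation kappa: module_hom scale scale "kappa :: ('n::{finite,linorder}, 'k::comm_ring_1) WS \<Rightarrow> _"
  unfolding kappa_def by (rule module_hom_lin_ext)

interpretation Kos: module_hom scale scale "Kos_tensor :: ('n::{finite,linorder}, 'k::comm_ring_1) WS \<Rightarrow> _"
  unfolding Kos_tensor_def by (rule module_hom_lin_ext)

lemma kappa_single:
  "kappa (single (A, \<beta>) 1) = (\<Sum>a\<in>A. scale (sgn_in a A) (single (A - {a}, \<beta> + \<epsilon> a) 1))"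
  by (simp add: kappa_def lin_ext_single)

lemma Kos_single:
  "Kos_tensor (single (A, \<beta>) 1) = (\<Sum>a\<in>A. scale (sgn_in a A * var a) (single (A - {a}, \<beta>) 1))"
  by (simp add: Kos_tensor_def lin_ext_single)

lemma kappa_kappa: "kappa (kappa u) = 0"
proof -
  have "keys u \<subseteq> UNIV" by simp
  then show ?thesis
  proof (induction rule: free_module_induct)
    case (basis b)
    then show ?case by (cases b) (simp add: kappa_Lsym[unfolded Lsym_def])
  qed (simp_all add: kappa.add kappa.scale)
qed

lemma Kos_Kos: "Kos_tensor (Kos_tensor u) = (0 :: ('n::{finite,linorder}, 'k::comm_ring_1) WS)"
proof -
  have "keys u \<subseteq> UNIV" by simp
  then show ?thesis
  proof (induction rule: free_module_induct)
    case (basis b)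
    obtain A \<beta> where b: "b = (A, \<beta>)" by (cases b)
    define g :: "'n \<Rightarrow> 'n \<Rightarrow> ('n, 'k) WS" where
      "g x y = scale (sgn_in x A * sgn_in y (A - {x}) * (var x * var y)) (single (A - {x} - {y}, \<beta>) 1)" for x y
    have "Kos_tensor (Kos_tensor (single b 1)) = (\<Sum>x\<in>A. \<Sum>y\<in>A - {x}. g x y)"
      by (simp add: b Kos_single Kos.sum Kos.scale fm.scale_sum_right g_def ac_simps)
    also have "\<dots> = 0"
    proof (rule double_sum_antisymmetric)
      fix x y assume "x \<in> A" "y \<in> A" "x < y"
      then have *: "sgn_in x A * sgn_in y (A - {x}) = - (sgn_in y A * sgn_in x (A - {y}) :: ('n, 'k) mpoly)"
        by (intro sgn_in_anti) auto
      have "A - {x} - {y} = A - {y} - {x}" by auto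
      then show "g x y = - g y x"
        unfolding g_def * by (simp add: fm.scale_minus_left mult.commute[of "var x" "var y"])
    qed simp
    finally show ?case .
  qed (simp_all add: Kos.add Kos.scale)
qed

text \<open>Both composites remove two elements of A, one becoming a polynomial variable and the
  other a symmetric factor. Exchanging their roles matches the terms and flips the sign by
  \<open>sgn_in_anti\<close>. Hence Kos preserves the kernels \<open>L\<close>.\<close>

lemma Kos_kappa: "Kos_tensor (kappa u) = - kappa (Kos_tensor u :: ('n::{finite,linorder}, 'k::comm_ring_1) WS)"
proof -
  have "keys u \<subseteq> UNIV" by simp
  then show ?thesis
  proof (induction rule: free_module_induct)
    case (basis b)
    obtain A \<beta> where b: "b = (A, \<beta>)" by (cases b)
    define g :: "'n \<Rightarrow> 'n \<Rightarrow> ('n, 'k) WS" where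
      "g x y = scale (sgn_in x A * sgn_in y (A - {x}) * var y) (single (A - {x} - {y}, \<beta> + \<epsilon> x) 1)" for x y
    define g' :: "'n \<Rightarrow> 'n \<Rightarrow> ('n, 'k) WS" where
      "g' x y = scale (sgn_in x A * sgn_in y (A - {x}) * var x) (single (A - {x} - {y}, \<beta> + \<epsilon> y) 1)" for x y
    have "Kos_tensor (kappa (single b 1)) = (\<Sum>x\<in>A. \<Sum>y\<in>A - {x}. g x y)"
      by (simp add: b kappa_single Kos_single Kos.sum Kos.scale fm.scale_sum_right g_def ac_simps)
    also have "\<dots> = (\<Sum>x\<in>A. \<Sum>y\<in>A - {x}. - g' y x)"
    proof (intro sum.cong refl)
      fix x y assume "x \<in> A" "y \<in> A - {x}"
      then have *: "sgn_in x A * sgn_in y (A - {x}) = - (sgn_in y A * sgn_in x (A - {y}) :: ('n, 'k) mpoly)"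
        by (intro sgn_in_anti) auto
      have "A - {x} - {y} = A - {y} - {x}" by auto
      then show "g x y = - g' y x"
        unfolding g_def g'_def * by (simp add: fm.scale_minus_left)
    qed
    also have "\<dots> = - (\<Sum>x\<in>A. \<Sum>y\<in>A - {x}. g' x y)"
      by (simp add: sum_negf double_sum_swap_off_diagonal[where g = g'])
    also have "(\<Sum>x\<in>A. \<Sum>y\<in>A - {x}. g' x y) = kappa (Kos_tensor (single b 1))"
      by (simp add: b kappa_single Kos_single kappa.sum kappa.scale fm.scale_sum_right g'_def ac_simps)
    finally show ?case .
  qed (simp_all add: Kos.add Kos.scale kappa.add kappa.scale fm.scale_minus_right)
qed

section \<open>Contracting homotopies for the Koszul complex and for the maps kappa\<close>

definition contractible :: "'n::{finite,linorder} set \<Rightarrow> 'n set \<Rightarrow> 'n expo \<Rightarrow> bool"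
  where "contractible T A \<beta> \<longleftrightarrow> Supp \<beta> \<inter> T \<noteq> {} \<and> (\<forall>a\<in>A. Min (Supp \<beta> \<inter> T) < a)"

text \<open>The least variable is transferred only if it precedes all of A, so that its insertion
  carries the sign 1. The parameter \<open>G\<close> stands for the basis vector attached to a pair,
  or for its image under a differential.\<close>

definition contraction ::
    "'n::{finite,linorder} set \<Rightarrow> ('n set \<Rightarrow> 'n expo \<Rightarrow> 'v::zero) \<Rightarrow> 'n set \<Rightarrow> 'n expo \<Rightarrow> 'v"
  where "contraction T G A \<beta> = (if contractible T A \<beta>
    then G (insert (Min (Supp \<beta> \<inter> T)) A) (\<beta> - \<epsilon> (Min (Supp \<beta> \<inter> T))) else 0)"

text \<open>
  One sign computation serves both the Koszul complex of \<open>k[x\<^sub>t : t \<in> T]\<close>, where \<open>\<beta>\<close> is the exponent of a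
  coefficient, and the complex of the maps \<open>\<kappa>\<close>, where \<open>\<beta>\<close> indexes a basis vector of \<open>S(F)\<close>.
\<close>

lemma contraction_homotopy:
  fixes G :: "'n::{finite,linorder} set \<Rightarrow> 'n expo \<Rightarrow> ('b \<Rightarrow>\<^sub>0 'r::comm_ring_1)"
  assumes A: "A \<subseteq> T" "A \<noteq> {} \<or> Supp \<beta> \<inter> T \<noteq> {}"
  shows "contraction T (\<lambda>A \<beta>. \<Sum>a\<in>A. scale (sgn_in a A) (G (A - {a}) (\<beta> + \<epsilon> a))) A \<beta>
    + (\<Sum>a\<in>A. scale (sgn_in a A) (contraction T G (A - {a}) (\<beta> + \<epsilon> a))) = G A \<beta>"
proof (cases "contractible T A \<beta>")
  case True
  define m where "m = Min (Supp \<beta> \<inter> T)"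
  have m: "m \<in> Supp \<beta>" "m \<in> T" "\<And>a. a \<in> A \<Longrightarrow> m < a" "m \<notin> A"
    using True Min_in[of "Supp \<beta> \<inter> T"] unfolding contractible_def m_def by auto
  \<comment> \<open>The new least element m has sign 1 and shifts every a in A by one place. So the
    two sums over A cancel, and the term that removes m again is left.\<close>
  have "{b \<in> insert m A. b < m} = {}" using m by force
  then have s0: "sgn_in m (insert m A) = (1 :: 'r)" by (simp only: sgn_in_def) simp
  have s1: "sgn_in a (insert m A) = - (sgn_in a A :: 'r)" if "a \<in> A" for a
  proof -
    have "sgn_in a (insert m A - {m}) = - (sgn_in a (insert m A) :: 'r)"
      using m that by (intro sgn_in_remove_less) auto
    then show ?thesis using m that by simp
  qed
  have c1: "contraction T G (A - {a}) (\<beta> + \<epsilon> a) = G (insert m A - {a}) (\<beta> - \<epsilon> m + \<epsilon> a)"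
    if "a \<in> A" for a
  proof -
    have "Min (Supp (\<beta> + \<epsilon> a) \<inter> T) = m"
    proof (rule Min_eqI)
      fix y assume "y \<in> Supp (\<beta> + \<epsilon> a) \<inter> T"
      then have "y = a \<or> y \<in> Supp \<beta> \<inter> T" by (auto simp: Supp_add_unit)
      then show "m \<le> y" using m(3)[OF that] by (auto simp: m_def)
    qed (use m in \<open>auto simp: Supp_add_unit\<close>)
    moreover have "Supp (\<beta> + \<epsilon> a) \<inter> T \<noteq> {}" using m by (auto simp: Supp_add_unit)
    moreover have "insert m (A - {a}) = insert m A - {a}" using m that by auto
    ultimately show ?thesis
      using m expo_diff_add_swap[OF m(1), of a] by (simp add: contraction_def contractible_def)
  qed
  have "contraction T (\<lambda>A \<beta>. \<Sum>a\<in>A. scale (sgn_in a A) (G (A - {a}) (\<beta> + \<epsilon> a))) A \<beta>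
     = (\<Sum>a\<in>insert m A. scale (sgn_in a (insert m A)) (G (insert m A - {a}) (\<beta> - \<epsilon> m + \<epsilon> a)))"
    using True by (simp add: contraction_def m_def)
  also have "\<dots> = G A \<beta> - (\<Sum>a\<in>A. scale (sgn_in a A) (G (insert m A - {a}) (\<beta> - \<epsilon> m + \<epsilon> a)))"
    using m unit_expo_diff_add[OF m(1)]
    by (simp add: s0 s1 fm.scale_minus_left sum_negf)
  finally show ?thesis by (simp add: c1)
next
  case False
  have ne: "A \<noteq> {}" using A False by (auto simp: contractible_def)
  define b where "b = Min A"
  have b: "b \<in> A" "\<And>a. a \<in> A \<Longrightarrow> b \<le> a" "b \<in> T" using ne A(1) Min_in[of A] by (auto simp: b_def simp del: Min_in)
  have le: "b \<le> y" if "y \<in> Supp \<beta> \<inter> T" for y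
  proof -
    have "Min (Supp \<beta> \<inter> T) \<le> y" using that by simp
    moreover have "\<not> Min (Supp \<beta> \<inter> T) < b"
      using False that b unfolding contractible_def by fastforce
    ultimately show ?thesis by simp
  qed
  have "{c \<in> A. c < b} = {}" using b by force
  then have s0: "sgn_in b A = (1 :: 'r)" by (simp only: sgn_in_def) simp
  \<comment> \<open>As b stays in A, removing a different a never gives a contractible pair.
    Removing b gives one, and the contraction sends it back to (A, \<beta>).\<close>
  have z: "contraction T G (A - {a}) (\<beta> + \<epsilon> a) = 0" if "a \<in> A - {b}" for a
  proof -
    have "b \<le> y" if "y \<in> Supp (\<beta> + \<epsilon> a) \<inter> T" for y
      using that le b \<open>a \<in> A - {b}\<close> by (auto simp: Supp_add_unit)
    then have "b \<le> Min (Supp (\<beta> + \<epsilon> a) \<inter> T)" if "Supp (\<beta> + \<epsilon> a) \<inter> T \<noteq> {}"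
      using that by (subst Min_ge_iff) auto
    moreover have "b \<in> A - {a}" using b that by auto
    ultimately have "\<not> contractible T (A - {a}) (\<beta> + \<epsilon> a)"
      unfolding contractible_def by (meson leD)
    then show ?thesis by (simp add: contraction_def)
  qed
  have Min_b: "Min (Supp (\<beta> + \<epsilon> b) \<inter> T) = b"
    by (rule Min_eqI) (use b le in \<open>auto simp: Supp_add_unit\<close>)
  moreover note Min_b
  moreover have "Supp (\<beta> + \<epsilon> b) \<inter> T \<noteq> {}" using b by (auto simp: Supp_add_unit)
  moreover have "\<forall>a\<in>A - {b}. b < a" using b by force
  ultimately have "contractible T (A - {b}) (\<beta> + \<epsilon> b)"
    by (simp add: contractible_def)
  with Min_b have z': "contraction T G (A - {b}) (\<beta> + \<epsilon> b) = G A \<beta>"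
    using b by (simp add: contraction_def insert_absorb)
  have "(\<Sum>a\<in>A. scale (sgn_in a A) (contraction T G (A - {a}) (\<beta> + \<epsilon> a))) =
    (\<Sum>a\<in>{b}. scale (sgn_in a A) (contraction T G (A - {a}) (\<beta> + \<epsilon> a)))"
    by (rule sum.mono_neutral_right) (use b z in auto)
  moreover have "contraction T H A \<beta> = 0" for H :: "'n set \<Rightarrow> 'n expo \<Rightarrow> ('b \<Rightarrow>\<^sub>0 'r)"
    using False by (simp add: contraction_def)
  ultimately show ?thesis by (simp add: z' s0)
qed

lemma contractibleD:
  fixes T A \<beta>
  defines "m \<equiv> Min (Supp \<beta> \<inter> T)"
  assumes "contractible T A \<beta>"
  shows "m \<in> Supp \<beta>" "m \<in> T" "\<And>b. b \<in> Supp \<beta> \<Longrightarrow> b \<in> T \<Longrightarrow> m \<le> b" "\<And>a. a \<in> A \<Longrightarrow> m < a" "m \<notin> A"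
  using assms Min_in[of "Supp \<beta> \<inter> T"] by (auto simp: contractible_def)

lemma keys_Kos:
  fixes u :: "('n::{finite,linorder}, 'k::comm_ring_1) WS"
  assumes "keys u \<subseteq> X" "\<And>A \<beta> a. (A, \<beta>) \<in> X \<Longrightarrow> a \<in> A \<Longrightarrow> (A - {a}, \<beta>) \<in> Y"
  shows "keys (Kos_tensor u) \<subseteq> Y"
  unfolding Kos_tensor_def
  by (rule keys_subset_lin_ext[OF assms(1)])
    (auto intro!: keys_subset_sum keys_subset_scale keys_subset_single assms(2) simp del: keys_single)

lemma keys_kappa:
  fixes u :: "('n::{finite,linorder}, 'k::comm_ring_1) WS"
  assumes "keys u \<subseteq> X" "\<And>A \<beta> a. (A, \<beta>) \<in> X \<Longrightarrow> a \<in> A \<Longrightarrow> (A - {a}, \<beta> + \<epsilon> a) \<in> Y"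
  shows "keys (kappa u) \<subseteq> Y"
  unfolding kappa_def
  by (rule keys_subset_lin_ext[OF assms(1)])
    (auto intro!: keys_subset_sum keys_subset_scale keys_subset_single assms(2) simp del: keys_single)

definition kappa_contr :: "('n::{finite,linorder}, 'k::comm_ring_1) WS \<Rightarrow> ('n, 'k) WS"
  where "kappa_contr = lin_ext (\<lambda>(A, \<beta>). contraction UNIV (\<lambda>A \<beta>. single (A, \<beta>) 1) A \<beta>)"

interpretation kc: module_hom scale scale "kappa_contr :: ('n::{finite,linorder}, 'k::comm_ring_1) WS \<Rightarrow> _"
  unfolding kappa_contr_def by (rule module_hom_lin_ext)

lemma kappa_contr_single:
  "kappa_contr (single (A, \<beta>) 1) = contraction UNIV (\<lambda>A \<beta>. single (A, \<beta>) 1) A \<beta>"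
  by (simp add: kappa_contr_def lin_ext_single)

lemma keys_kappa_contr:
  fixes u :: "('n::{finite,linorder}, 'k::comm_ring_1) WS"
  assumes "keys u \<subseteq> X" and Y: "\<And>A \<beta> m. (A, \<beta>) \<in> X \<Longrightarrow> m \<in> Supp \<beta> \<Longrightarrow> (\<forall>b\<in>Supp \<beta>. m \<le> b) \<Longrightarrow>
    (\<forall>a\<in>A. m < a) \<Longrightarrow> (insert m A, \<beta> - \<epsilon> m) \<in> Y"
  shows "keys (kappa_contr u) \<subseteq> Y"
  unfolding kappa_contr_def
proof (rule keys_subset_lin_ext[OF assms(1)])
  fix b assume b: "b \<in> X"
  obtain A \<beta> where "b = (A, \<beta>)" by (cases b)
  with b contractibleD[of UNIV A \<beta>]
  show "keys (case b of (A, \<beta>) \<Rightarrow> contraction UNIV (\<lambda>A \<beta>. single (A, \<beta>) (1 :: ('n, 'k) mpoly)) A \<beta>) \<subseteq> Y"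
    by (auto simp: contraction_def intro!: Y)
qed

text \<open>The excluded vector e_\<emptyset> \<otimes> 1 is the only one with nothing to move in
  either direction.\<close>

lemma kappa_homotopy:
  fixes u :: "('n::{finite,linorder}, 'k::comm_ring_1) WS"
  assumes "keys u \<subseteq> {(A, \<beta>). A \<noteq> {} \<or> \<beta> \<noteq> 0}"
  shows "kappa (kappa_contr u) + kappa_contr (kappa u) = u"
  using assms
proof (induction rule: free_module_induct)
  case (basis b)
  obtain A \<beta> where b: "b = (A, \<beta>)" by (cases b)
  let ?G = "\<lambda>A \<beta>. single (A, \<beta>) 1 :: ('n, 'k) WS"
  have "contraction UNIV (\<lambda>A \<beta>. \<Sum>a\<in>A. scale (sgn_in a A) (?G (A - {a}) (\<beta> + \<epsilon> a))) A \<beta>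
    + (\<Sum>a\<in>A. scale (sgn_in a A) (contraction UNIV ?G (A - {a}) (\<beta> + \<epsilon> a))) = ?G A \<beta>"
  proof (rule contraction_homotopy)
    show "A \<noteq> {} \<or> Supp \<beta> \<inter> UNIV \<noteq> {}" using basis b by auto
  qed simp
  moreover have "kappa (kappa_contr (single b 1)) =
      contraction UNIV (\<lambda>A \<beta>. \<Sum>a\<in>A. scale (sgn_in a A) (?G (A - {a}) (\<beta> + \<epsilon> a))) A \<beta>"
    by (simp add: b kappa_contr_single contraction_def kappa_single)
  moreover have "kappa_contr (kappa (single b 1)) =
      (\<Sum>a\<in>A. scale (sgn_in a A) (contraction UNIV ?G (A - {a}) (\<beta> + \<epsilon> a)))"
    by (simp add: b kappa_contr_single kappa_single kc.sum kc.scale)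
  ultimately show ?case by (simp add: b)
qed (simp_all add: kappa.add kappa.scale kc.add kc.scale fm.scale_right_distrib[symmetric] algebra_simps)

lemma contraction_zero: "contraction T (\<lambda>A \<gamma>. 0) A \<gamma> = 0"
  by (simp add: contraction_def)

lemma contraction_add:
  "contraction T (\<lambda>A \<gamma>. G A \<gamma> + H A \<gamma>) A \<gamma> = contraction T G A \<gamma> + (contraction T H A \<gamma> :: 'v::monoid_add)"
  by (simp add: contraction_def)

text \<open>Kos leaves \<beta> fixed, so each \<beta> carries its own Koszul complex and
  \<open>T\<close> may choose its variables. The nested \<open>add_ext\<close> runs over basis
  vectors and then over the monomials of a coefficient; it is the exponent \<gamma> of such a
  monomial that is contracted.\<close>

definition Kos_contr ::
    "('n expo \<Rightarrow> 'n set) \<Rightarrow> ('n::{finite,linorder}, 'k::comm_ring_1) WS \<Rightarrow> ('n, 'k) WS"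
  where "Kos_contr T = add_ext (\<lambda>(A, \<beta>).
    add_ext (\<lambda>\<gamma> c. contraction (T \<beta>) (\<lambda>A \<gamma>. single (A, \<beta>) (single \<gamma> c)) A \<gamma>))"

lemma Kos_contr_add: "Kos_contr T (u + v) = Kos_contr T u + Kos_contr T v"
  unfolding Kos_contr_def
  by (rule add_ext_add) (auto simp: add_ext_add contraction_zero contraction_add single_add)

lemma Kos_contr_0 [simp]: "Kos_contr T 0 = 0"
  by (simp add: Kos_contr_def)

lemma Kos_contr_uminus: "Kos_contr T (- u) = - Kos_contr T u"
  using Kos_contr_add[of T "- u" u] by (simp add: eq_neg_iff_add_eq_0)

lemma Kos_contr_sum: "Kos_contr T (sum f I) = (\<Sum>i\<in>I. Kos_contr T (f i))"
  by (induction I rule: infinite_finite_induct) (auto simp: Kos_contr_add)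

text \<open>Additivity still allows the scalars 1 and -1, which are the only ones in
  \<open>contraction_homotopy\<close>.\<close>

lemma Kos_contr_sgn: "Kos_contr T (scale (sgn_in a A) u) = scale (sgn_in a A) (Kos_contr T u)"
proof -
  have "sgn_in a A = (1 :: ('a, 'b) mpoly) \<or> sgn_in a A = (- 1 :: ('a, 'b) mpoly)"
    by (simp add: sgn_in_def minus_one_power_iff)
  then show ?thesis by (auto simp: Kos_contr_uminus)
qed

lemma Kos_contr_monomial:
  "Kos_contr T (single (A, \<beta>) (single \<gamma> c)) =
    contraction (T \<beta>) (\<lambda>A \<gamma>. single (A, \<beta>) (single \<gamma> c)) A \<gamma>"
  by (simp add: Kos_contr_def add_ext_single contraction_zero)

lemma Kos_monomial:
  fixes c :: "'k::comm_ring_1" and A :: "'n::{finite,linorder} set"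
  shows "Kos_tensor (single (A, \<beta>) (single \<gamma> c)) =
    (\<Sum>a\<in>A. scale (sgn_in a A) (single (A - {a}, \<beta>) (single (\<gamma> + \<epsilon> a) c)))"
proof -
  have *: "scale p (single b q) = single b (p * q)" for p q :: "('n, 'k) mpoly" and b :: "'n set \<times> 'n expo"
    by (rule poly_mapping_eqI) (simp add: lookup_scale lookup_single when_def)
  have "single (A, \<beta>) (single \<gamma> c) = scale (single \<gamma> c) (single (A, \<beta>) 1)"
    by (simp add: *)
  then have "Kos_tensor (single (A, \<beta>) (single \<gamma> c)) =
      (\<Sum>a\<in>A. scale (sgn_in a A) (scale (var a * single \<gamma> c) (single (A - {a}, \<beta>) 1)))"
    by (simp only: Kos.scale Kos_single fm.scale_sum_right fm.scale_scale) (simp only: ac_simps)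
  then show ?thesis by (simp add: * var_def monom_def mult_single add.commute)
qed

text \<open>Nonempty A excludes exterior degree 0, where a nonzero coefficient free of the variables
  in \<open>T \<beta>\<close> is no boundary.\<close>

lemma Kos_homotopy:
  fixes u :: "('n::{finite,linorder}, 'k::comm_ring_1) WS"
  assumes "keys u \<subseteq> {(A, \<beta>). A \<noteq> {} \<and> A \<subseteq> T \<beta>}"
  shows "Kos_tensor (Kos_contr T u) + Kos_contr T (Kos_tensor u) = u"
proof (induction u rule: poly_mapping_additive_induct)
  case (single b p)
  obtain A \<beta> where b: "b = (A, \<beta>)" by (cases b)
  show ?case
  proof (induction p rule: poly_mapping_additive_induct)
    case (single \<gamma> c)
    let ?G = "\<lambda>A \<gamma>. single (A, \<beta>) (single \<gamma> c) :: ('n, 'k) WS"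
    have "contraction (T \<beta>) (\<lambda>A \<gamma>. \<Sum>a\<in>A. scale (sgn_in a A) (?G (A - {a}) (\<gamma> + \<epsilon> a))) A \<gamma>
      + (\<Sum>a\<in>A. scale (sgn_in a A) (contraction (T \<beta>) ?G (A - {a}) (\<gamma> + \<epsilon> a))) = ?G A \<gamma>"
    proof (rule contraction_homotopy)
      show "A \<subseteq> T \<beta>" "A \<noteq> {} \<or> Supp \<gamma> \<inter> T \<beta> \<noteq> {}"
        using assms \<open>b \<in> keys u\<close> b by auto
    qed
    moreover have "Kos_tensor (Kos_contr T (?G A \<gamma>)) =
        contraction (T \<beta>) (\<lambda>A \<gamma>. \<Sum>a\<in>A. scale (sgn_in a A) (?G (A - {a}) (\<gamma> + \<epsilon> a))) A \<gamma>"
      by (simp add: Kos_contr_monomial contraction_def Kos_monomial)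
    moreover have "Kos_contr T (Kos_tensor (?G A \<gamma>)) =
        (\<Sum>a\<in>A. scale (sgn_in a A) (contraction (T \<beta>) ?G (A - {a}) (\<gamma> + \<epsilon> a)))"
      by (simp add: Kos_monomial Kos_contr_sum Kos_contr_sgn Kos_contr_monomial)
    ultimately show ?case by (simp add: b)
  qed (simp_all add: single_add Kos.add Kos_contr_add algebra_simps)
qed (simp_all add: Kos.add Kos_contr_add algebra_simps)

lemma keys_Kos_contr:
  fixes u :: "('n::{finite,linorder}, 'k::comm_ring_1) WS"
  assumes "keys u \<subseteq> {(A, \<beta>). A \<subseteq> T \<beta> \<and> card A = i \<and> R \<beta>}"
  shows "keys (Kos_contr T u) \<subseteq> {(A, \<beta>). A \<subseteq> T \<beta> \<and> card A = i + 1 \<and> R \<beta>}"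
proof -
  have *: "keys (contraction (T \<beta>) (\<lambda>A \<gamma>. single (A, \<beta>) (single \<gamma> c)) A \<gamma>)
      \<subseteq> {(A, \<beta>). A \<subseteq> T \<beta> \<and> card A = i + 1 \<and> R \<beta>}"
    if "(A, \<beta>) \<in> keys u" for A \<beta> \<gamma> and c :: 'k
    using that assms contractibleD[of "T \<beta>" A \<gamma>] by (auto simp: contraction_def)
  have "keys (contraction (T (snd b)) (\<lambda>A \<gamma>. single (A, snd b) (single \<gamma> c)) (fst b) \<gamma>)
      \<subseteq> {(A, \<beta>). A \<subseteq> T \<beta> \<and> card A = i + 1 \<and> R \<beta>}"
    if "b \<in> keys u" for b \<gamma> and c :: 'k
    by (rule *) (use that in simp)
  then show ?thesis
    unfolding Kos_contr_def add_ext_def split_def by (rule keys_subset_sum[OF keys_subset_sum])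
qed

lemma Koszul_exact:
  fixes u :: "('n::{finite,linorder}, 'k::comm_ring_1) WS"
  assumes "Kos_tensor u = 0" "keys u \<subseteq> {(A, \<beta>). A \<subseteq> T \<beta> \<and> card A = i \<and> R \<beta>}" "i \<ge> 1"
  obtains y where "Kos_tensor y = u" "keys y \<subseteq> {(A, \<beta>). A \<subseteq> T \<beta> \<and> card A = i + 1 \<and> R \<beta>}"
proof
  have "keys u \<subseteq> {(A, \<beta>). A \<noteq> {} \<and> A \<subseteq> T \<beta>}" using assms by auto
  then show "Kos_tensor (Kos_contr T u) = u" using Kos_homotopy[of u T] assms(1) by simp
  show "keys (Kos_contr T u) \<subseteq> {(A, \<beta>). A \<subseteq> T \<beta> \<and> card A = i + 1 \<and> R \<beta>}"
    by (rule keys_Kos_contr[OF assms(2)])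
qed


section \<open>The resolution of a power of the maximal ideal\<close>

lemma wedge_sym_keys: "u \<in> wedge_sym i d \<longleftrightarrow> keys u \<subseteq> {(A, \<beta>). card A = i \<and> expo_deg \<beta> = d}"
  by (auto simp: wedge_sym_def)

lemma expo_deg_eq_0: "expo_deg \<beta> = 0 \<longleftrightarrow> \<beta> = 0"
  by (auto simp: expo_deg_def intro: poly_mapping_eqI)

lemma subspace_wedge_sym:
  "fm.subspace (wedge_sym i d :: ('n::{finite,linorder}, 'k::comm_ring_1) WS set)"
proof (rule fm.subspaceI)
  show "0 \<in> wedge_sym i d" by (simp add: wedge_sym_def)
  show "u + v \<in> wedge_sym i d" if "u \<in> wedge_sym i d" "v \<in> wedge_sym i d"
    for u v :: "('n, 'k) WS"
    using that unfolding wedge_sym_keys by (rule keys_subset_add)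
  show "scale c u \<in> wedge_sym i d" if "u \<in> wedge_sym i d"
    for c and u :: "('n, 'k) WS"
    using that unfolding wedge_sym_keys by (rule keys_subset_scale)
qed

lemma Kos_wedge_sym: "u \<in> wedge_sym (i + 1) d \<Longrightarrow> Kos_tensor u \<in> wedge_sym i d"
  unfolding wedge_sym_keys by (erule keys_Kos) auto

lemma kappa_wedge_sym: "u \<in> wedge_sym (i + 1) d \<Longrightarrow> kappa u \<in> wedge_sym i (d + 1)"
  unfolding wedge_sym_keys by (erule keys_kappa) (auto simp: expo_deg_plus)

lemma kappa_contr_wedge_sym: "u \<in> wedge_sym i (d + 1) \<Longrightarrow> kappa_contr u \<in> wedge_sym (i + 1) d"
  unfolding wedge_sym_keys
proof (erule keys_kappa_contr)
  fix A :: "'a set" and \<beta> m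
  assume *: "(A, \<beta>) \<in> {(A, \<beta>). card A = i \<and> expo_deg \<beta> = d + 1}" "m \<in> Supp \<beta>" "\<forall>a\<in>A. m < a"
  then have "m \<notin> A" by auto
  then show "(insert m A, \<beta> - \<epsilon> m) \<in> {(A, \<beta>). card A = i + 1 \<and> expo_deg \<beta> = d}"
    using * expo_deg_diff[of m \<beta>] by auto
qed

lemma L_kappa: "u \<in> wedge_sym (i + 1) d \<Longrightarrow> kappa u \<in> L (d + 1) i"
  by (simp add: L_def kappa_kappa kappa_wedge_sym)

text \<open>In positive symmetric degree the cycles of \<open>kappa\<close> are boundaries. The
  preimage chosen here also supplies the coordinates in the standard basis.\<close>

lemma kappa_kappa_contr: "u \<in> L (d + 1) i \<Longrightarrow> kappa (kappa_contr u) = u"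
proof -
  assume u: "u \<in> L (d + 1) i"
  then have "keys u \<subseteq> {(A, \<beta>). card A = i \<and> expo_deg \<beta> = d + 1}"
    by (simp add: L_def wedge_sym_keys)
  moreover have "expo_deg (0 :: 'a expo) = 0" by (simp add: expo_deg_eq_0)
  ultimately have "keys u \<subseteq> {(A, \<beta>). A \<noteq> {} \<or> \<beta> \<noteq> 0}" by auto
  from kappa_homotopy[OF this] u show "kappa (kappa_contr u) = u" by (simp add: L_def)
qed

lemma Kos_L: "u \<in> L d (i + 1) \<Longrightarrow> Kos_tensor u \<in> L d i"
  using Kos_kappa[of u] by (simp add: L_def Kos_wedge_sym)

text \<open>For d = 0 there is no symmetric factor to move, so the contraction vanishes and the
  homotopy identity forces u = 0.\<close>

lemma L_0_Suc: "u \<in> L 0 (i + 1) \<Longrightarrow> u = 0"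
proof -
  assume u: "u \<in> L 0 (i + 1)"
  then have k: "keys u \<subseteq> {(A, \<beta>). card A = i + 1 \<and> expo_deg \<beta> = 0}" and z: "kappa u = 0"
    by (auto simp: L_def wedge_sym_keys)
  from k have "keys (kappa_contr u) \<subseteq> {}"
    by (rule keys_kappa_contr) (auto simp: expo_deg_eq_0)
  moreover have "keys u \<subseteq> {(A, \<beta>). A \<noteq> {} \<or> \<beta> \<noteq> 0}" using k by auto
  ultimately show "u = 0" using kappa_homotopy[of u] z by simp
qed

text \<open>Viewing R as the free module over \<open>unit\<close> lets \<open>S_psi\<close> inherit
  linearity from \<open>lin_ext\<close>.\<close>

lemma S_psi_lin_ext: "S_psi u = lookup (lin_ext (\<lambda>(A, \<beta>). single () (if A = {} then monom \<beta> else 0)) u) ()"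
  unfolding S_psi_def lookup_lin_ext by (rule sum.cong) auto

lemma S_psi_add: "S_psi (u + v) = S_psi u + S_psi v"
  by (simp add: S_psi_lin_ext module_hom.add[OF module_hom_lin_ext] lookup_add)

lemma S_psi_scale: "S_psi (scale c u) = c * S_psi u"
  by (simp add: S_psi_lin_ext module_hom.scale[OF module_hom_lin_ext] lookup_scale)

lemma S_psi_0: "S_psi 0 = 0"
  by (simp add: S_psi_def)

lemma S_psi_sum: "S_psi (sum f I) = (\<Sum>i\<in>I. S_psi (f i))"
  by (induction I rule: infinite_finite_induct) (auto simp: S_psi_add S_psi_0)

lemma S_psi_single: "S_psi (single (A, \<beta>) 1) = (if A = {} then monom \<beta> else 0)"
  by (simp add: S_psi_lin_ext lin_ext_single)

lemma monom_add_unit: "monom (\<beta> + \<epsilon> a) = var a * monom \<beta>"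
  by (simp add: monom_def var_def mult_single add.commute)

text \<open>Only singletons A contribute, and there both sides give x_a x^\<beta>. So
  \<open>S_psi\<close> kills Kos of elements of \<open>L\<close>, and in the induction on d the
  condition on kappa w passes to Kos w.\<close>

lemma S_psi_Kos: "S_psi (Kos_tensor u) = S_psi (kappa u)"
proof -
  have "keys u \<subseteq> UNIV" by simp
  then show ?thesis
  proof (induction rule: free_module_induct)
    case (basis b)
    then show ?case
      by (cases b) (auto simp: kappa_single Kos_single S_psi_sum S_psi_scale S_psi_single monom_add_unit
        mult.assoc intro!: sum.cong)
  qed (simp_all add: kappa.add kappa.scale Kos.add Kos.scale S_psi_add S_psi_scale)
qed

text \<open>
  Induction on \<open>d\<close>: writing \<open>u = \<kappa> w\<close>, the element \<open>Kos w\<close> is a cycle of \<open>L\<^sub>d\<^sub>-\<^sub>1\<close>, hence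
  \<open>w = v + Kos y\<close> with \<open>\<kappa> v = 0\<close>, and \<open>u = - Kos (\<kappa> y)\<close>.
\<close>

lemma L_exact:
  fixes u :: "('n::{finite,linorder}, 'k::comm_ring_1) WS"
  assumes "u \<in> L d i" "Kos_tensor u = 0" "i = 0 \<Longrightarrow> S_psi u = 0"
  shows "\<exists>w\<in>L d (i + 1). Kos_tensor w = u"
  using assms
proof (induction d arbitrary: i u)
  case 0
  have "u = 0"
  proof (cases i)
    case 0
    have *: "keys u \<subseteq> {({}, 0)}"
      using \<open>u \<in> L 0 i\<close> 0 by (auto simp: L_def wedge_sym_keys expo_deg_eq_0)
    have u: "u = scale (lookup u ({}, 0)) (single ({}, 0) 1)"
    proof (rule poly_mapping_eqI)
      fix b
      show "lookup u b = lookup (scale (lookup u ({}, 0)) (single ({}, 0) 1)) b"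
      proof (cases "b = ({}, 0)")
        case False
        then have "b \<notin> keys u" using * by blast
        then show ?thesis using False by (simp add: lookup_scale lookup_single_not_eq in_keys_iff)
      qed (simp add: lookup_scale)
    qed
    \<comment> \<open>Here \<open>S_psi\<close> sends the only possible basis vector to 1, so it is
      injective.\<close>
    have "S_psi u = S_psi (scale (lookup u ({}, 0)) (single ({}, 0) 1))"
      by (rule arg_cong[OF u])
    then have "lookup u ({}, 0) = 0"
      using "0.prems"(3) 0 by (simp add: S_psi_scale S_psi_single monom_def)
    then show ?thesis using u by simp
  next
    case (Suc j)
    then show ?thesis using "0.prems"(1) L_0_Suc[of u j] by (simp add: Suc_eq_plus1)
  qed
  then show ?case using fm.subspace_0[OF subspace_L] by (intro bexI[of _ 0]) simp_all
next
  case (Suc d)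
  define w where "w = kappa_contr u"
  have u: "u \<in> L (d + 1) i" using Suc.prems(1) by (simp add: Suc_eq_plus1)
  have w: "kappa w = u" "w \<in> wedge_sym (i + 1) d"
    using kappa_kappa_contr[OF u] kappa_contr_wedge_sym[of u i d] u by (auto simp: w_def L_def)
  have "kappa (Kos_tensor w) = - Kos_tensor (kappa w)" by (simp add: Kos_kappa)
  then have "Kos_tensor w \<in> L d i"
    using w Suc.prems(2) by (simp add: L_def Kos_wedge_sym)
  moreover have "S_psi (Kos_tensor w) = 0" if "i = 0"
    using Suc.prems(3)[OF that] w by (simp add: S_psi_Kos)
  ultimately obtain v where v: "v \<in> L d (i + 1)" "Kos_tensor v = Kos_tensor w"
    using Suc.IH[of "Kos_tensor w" i] Kos_Kos[of w] by auto
  \<comment> \<open>The Koszul complex is exact in exterior degree at least 1. As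
    \<open>w - v\<close> has degree i + 1, no further condition arises even for i = 0.\<close>
  have "keys (w - v) \<subseteq> {(A, \<beta>). A \<subseteq> UNIV \<and> card A = i + 1 \<and> expo_deg \<beta> = d}"
    using fm.subspace_diff[OF subspace_wedge_sym, of w "i + 1" d v] w(2) v(1)
    by (auto simp: L_def wedge_sym_keys)
  with v obtain y where y: "Kos_tensor y = w - v"
    "keys y \<subseteq> {(A, \<beta>). A \<subseteq> UNIV \<and> card A = i + 1 + 1 \<and> expo_deg \<beta> = d}"
    using Koszul_exact[of "w - v" "\<lambda>_. UNIV" "i + 1" "\<lambda>\<beta>. expo_deg \<beta> = d"]
    by (auto simp: Kos.diff)
  have y': "y \<in> wedge_sym (i + 1 + 1) d" using y(2) by (simp add: wedge_sym_keys)
  have "Kos_tensor (- kappa y) = kappa (Kos_tensor y)" by (simp add: Kos.neg Kos_kappa)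
  also have "\<dots> = u" using y w v by (simp add: kappa.diff L_def)
  finally show ?case
    using fm.subspace_neg[OF subspace_L L_kappa[OF y']] by (auto simp: Suc_eq_plus1)
qed


section \<open>Ingredients of the maps $\Theta$\<close>

text \<open>Each element of the support counts once, without the multiplicity that a derivative
  would carry. This yields the coefficients of Theta in every characteristic.\<close>

definition nu :: "('n::{finite,linorder}, 'k::comm_ring_1) WS \<Rightarrow> ('n, 'k) WS"
  where "nu = lin_ext (\<lambda>(A, \<beta>). \<Sum>k\<in>Supp \<beta>. scale (var k) (single (A, \<beta> - \<epsilon> k) 1))"

interpretation nu: module_hom scale scale "nu :: ('n::{finite,linorder}, 'k::comm_ring_1) WS \<Rightarrow> _"
  unfolding nu_def by (rule module_hom_lin_ext)

interpretation Kos_K: module_hom scale scale "Kos_K :: ('n::{finite,linorder}, 'k::comm_ring_1) KS \<Rightarrow> _"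
  unfolding Kos_K_def by (rule module_hom_lin_ext)

interpretation Theta: module_hom scale scale "Theta \<alpha> :: ('n::{finite,linorder}, 'k::comm_ring_1) KS \<Rightarrow> _"
  unfolding Theta_def by (rule module_hom_lin_ext)

lemma nu_single:
  "nu (single (A, \<beta>) 1) = (\<Sum>k\<in>Supp \<beta>. scale (var k) (single (A, \<beta> - \<epsilon> k) 1))"
  by (simp add: nu_def lin_ext_single)

lemma Kos_K_single:
  "Kos_K (single (s, J) 1) = (\<Sum>j\<in>J. scale (sgn_in j J * var j) (single (s, J - {j}) 1))"
  by (simp add: Kos_K_def lin_ext_single)

lemma Kos_nu: "Kos_tensor (nu u) = nu (Kos_tensor u :: ('n::{finite,linorder}, 'k::comm_ring_1) WS)"
proof -
  have "keys u \<subseteq> UNIV" by simp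
  then show ?thesis
  proof (induction rule: free_module_induct)
    case (basis b)
    obtain A \<beta> where b: "b = (A, \<beta>)" by (cases b)
    define g :: "'n \<Rightarrow> 'n \<Rightarrow> ('n, 'k) WS" where
      "g k a = scale (sgn_in a A * (var a * var k)) (single (A - {a}, \<beta> - \<epsilon> k) 1)" for k a
    have "Kos_tensor (nu (single b 1)) = (\<Sum>k\<in>Supp \<beta>. \<Sum>a\<in>A. g k a)"
      by (simp add: b nu_single Kos_single Kos.sum Kos.scale fm.scale_sum_right g_def ac_simps)
    also have "\<dots> = (\<Sum>a\<in>A. \<Sum>k\<in>Supp \<beta>. g k a)" by (rule sum.swap)
    also have "\<dots> = nu (Kos_tensor (single b 1))"
      by (simp add: b nu_single Kos_single nu.sum nu.scale fm.scale_sum_right g_def ac_simps)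
    finally show ?case .
  qed (simp_all add: Kos.add Kos.scale nu.add nu.scale)
qed

lemma nu_wedge_sym: "u \<in> wedge_sym i (d + 1) \<Longrightarrow> nu u \<in> wedge_sym i d"
  unfolding wedge_sym_keys nu_def
  by (erule keys_subset_lin_ext)
    (auto intro!: keys_subset_sum keys_subset_scale keys_subset_single dest: expo_deg_diff simp del: keys_single)

lemma wedge_sgn_sq [simp]: "wedge_sgn J S * wedge_sgn J S = 1"
  by (simp add: wedge_sgn_def flip: power_add mult_2)

text \<open>If c elements of S precede j, then removing j from J loses exactly c inversions, and c
  is also the contribution of S to the position of j in J \<union> S. This makes \<open>tau\<close>
  compatible with the Koszul differentials.\<close>

lemma wedge_sgn_remove:
  fixes J :: "'n::{finite,linorder} set"
  assumes "j \<in> J" "J \<inter> S = {}"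
  shows "wedge_sgn J S * sgn_in j (J \<union> S) = sgn_in j J * (wedge_sgn (J - {j}) S :: 'r::comm_ring_1)"
proof -
  let ?P = "\<lambda>J. {(j, s). j \<in> J \<and> s \<in> S \<and> s < j}" and ?c = "card {s \<in> S. s < j}"
  have "?P J = ?P (J - {j}) \<union> {j} \<times> {s \<in> S. s < j}" using assms by auto
  also have "card \<dots> = card (?P (J - {j})) + ?c"
    by (subst card_Un_disjoint) (auto simp: card_cartesian_product)
  finally have 1: "card (?P J) = card (?P (J - {j})) + ?c" .
  have "{b \<in> J \<union> S. b < j} = {b \<in> J. b < j} \<union> {s \<in> S. s < j}" by auto
  also have "card \<dots> = card {b \<in> J. b < j} + ?c"
    by (subst card_Un_disjoint) (use assms in auto)
  finally have 2: "card {b \<in> J \<union> S. b < j} = card {b \<in> J. b < j} + ?c" .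
  have "(- 1) ^ ?c * (- 1) ^ ?c = (1 :: 'r)" by (simp flip: power_add mult_2)
  then have "(- 1) ^ ?c * ((- 1) ^ ?c * x) = x" for x :: 'r by (simp add: mult.assoc[symmetric])
  then show ?thesis
    unfolding wedge_sgn_def sgn_in_def 1 2 power_add by (simp add: ac_simps)
qed

text \<open>Brings a sum over all pairs into the shape of the formula for Theta: the squares, then
  two mixed terms for each k < l.\<close>

lemma double_sum_split:
  fixes S :: "'n::{finite,linorder} set"
  shows "(\<Sum>l\<in>S. \<Sum>k\<in>S. f l k) =
    (\<Sum>k\<in>S. f k k) + (\<Sum>(k, l)\<in>{(k, l). k \<in> S \<and> l \<in> S \<and> k < l}. f l k + f k l)"
proof -
  let ?X = "{(k, l). k \<in> S \<and> l \<in> S \<and> k < l}"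
  have "(\<Sum>l\<in>S. \<Sum>k\<in>S. f l k) = (\<Sum>(l, k)\<in>S \<times> S. f l k)"
    by (simp add: sum.cartesian_product)
  also have "S \<times> S = (\<lambda>k. (k, k)) ` S \<union> (?X \<union> prod.swap ` ?X)"
    by (auto simp: image_iff not_less intro: antisym)
  also have "(\<Sum>(l, k)\<in>\<dots>. f l k) = (\<Sum>(l, k)\<in>(\<lambda>k. (k, k)) ` S. f l k)
      + (\<Sum>(l, k)\<in>?X \<union> prod.swap ` ?X. f l k)"
    by (rule sum.union_disjoint) auto
  also have "(\<Sum>(l, k)\<in>?X \<union> prod.swap ` ?X. f l k) =
      (\<Sum>(l, k)\<in>?X. f l k) + (\<Sum>(l, k)\<in>prod.swap ` ?X. f l k)"
    by (rule sum.union_disjoint) auto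
  also have "(\<Sum>(l, k)\<in>prod.swap ` ?X. f l k) = (\<Sum>(k, l)\<in>?X. f l k)"
    by (subst sum.reindex) (auto simp: case_prod_unfold)
  also have "(\<Sum>(l, k)\<in>(\<lambda>k. (k, k)) ` S. f l k) = (\<Sum>k\<in>S. f k k)"
    by (subst sum.reindex) (auto simp: inj_on_def)
  finally show ?thesis by (simp add: sum.distrib case_prod_unfold add.commute)
qed

lemma Kos_wedge_0: "u \<in> wedge_sym 0 d \<Longrightarrow> Kos_tensor u = 0"
proof -
  assume "u \<in> wedge_sym 0 d"
  then have "keys u \<subseteq> {(A, \<beta>). A = {}}" by (auto simp: wedge_sym_keys)
  then have "keys (Kos_tensor u) \<subseteq> {}" by (rule keys_Kos) auto
  then show ?thesis by simp
qed


section \<open>Homogeneous and maximal-ideal coefficients\<close>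

lemma homogeneous_0 [simp]: "homogeneous j 0"
  by (simp add: homogeneous_def)

lemma homogeneous_add: "homogeneous j p \<Longrightarrow> homogeneous j q \<Longrightarrow> homogeneous j (p + q)"
  unfolding homogeneous_def using Poly_Mapping.keys_add[of p q] by blast

lemma homogeneous_uminus: "homogeneous j p \<Longrightarrow> homogeneous j (- p)"
  by (simp add: homogeneous_def in_keys_iff)

lemma homogeneous_sum: "(\<And>i. i \<in> I \<Longrightarrow> homogeneous j (f i)) \<Longrightarrow> homogeneous j (sum f I)"
  by (induction I rule: infinite_finite_induct) (simp_all add: homogeneous_add)

lemma expo_deg_add: "expo_deg (\<beta> + \<gamma>) = expo_deg \<beta> + expo_deg \<gamma>"
  by (simp add: expo_deg_def lookup_add sum.distrib)

lemma homogeneous_mult: "homogeneous i p \<Longrightarrow> homogeneous j q \<Longrightarrow> homogeneous (i + j) (p * q)"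
  unfolding homogeneous_def using keys_mult[of p q] by (fastforce simp: expo_deg_add)

lemma homogeneous_monom: "homogeneous (int (expo_deg \<beta>)) (monom \<beta>)"
  by (simp add: homogeneous_def monom_def)

lemma homogeneous_var: "homogeneous 1 (var i)"
proof -
  have "expo_deg (0 + \<epsilon> i) = expo_deg (0 :: 'a expo) + 1" by (rule expo_deg_plus)
  then have "expo_deg (\<epsilon> i :: 'a expo) = 1" by (simp add: expo_deg_def)
  then show ?thesis using homogeneous_monom[of "\<epsilon> i"] by (simp add: var_def)
qed

lemma homogeneous_1: "homogeneous 0 1"
  using homogeneous_monom[of 0] by (simp add: monom_def expo_deg_def)

lemma homogeneous_neg_1_power: "homogeneous 0 ((- 1) ^ n)"
  by (simp add: minus_one_power_iff homogeneous_1 homogeneous_uminus)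

text \<open>Only coefficients are measured; every basis vector counts as degree 0. In these terms
  \<open>kappa\<close> and \<open>kappa_contr\<close> have degree 0, Kos and \<open>nu\<close>
  degree 1, and Theta degree 2.\<close>

definition hom_coeffs :: "int \<Rightarrow> ('b \<Rightarrow>\<^sub>0 ('n::finite, 'k::comm_ring_1) mpoly) \<Rightarrow> bool"
  where "hom_coeffs j u \<longleftrightarrow> (\<forall>b. homogeneous j (lookup u b))"

lemma hom_coeffs_0: "hom_coeffs j 0"
  by (simp add: hom_coeffs_def)

lemma hom_coeffs_add: "hom_coeffs j u \<Longrightarrow> hom_coeffs j v \<Longrightarrow> hom_coeffs j (u + v)"
  by (simp add: hom_coeffs_def lookup_add homogeneous_add)

lemma hom_coeffs_uminus: "hom_coeffs j u \<Longrightarrow> hom_coeffs j (- u)"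
  by (simp add: hom_coeffs_def homogeneous_uminus)

lemma hom_coeffs_sum: "(\<And>i. i \<in> I \<Longrightarrow> hom_coeffs j (f i)) \<Longrightarrow> hom_coeffs j (sum f I)"
  by (simp add: hom_coeffs_def lookup_sum homogeneous_sum)

lemma hom_coeffs_scale: "homogeneous i c \<Longrightarrow> hom_coeffs j u \<Longrightarrow> hom_coeffs (i + j) (scale c u)"
  by (simp add: hom_coeffs_def lookup_scale homogeneous_mult)

lemma hom_coeffs_single: "hom_coeffs 0 (single b 1)"
  by (simp add: hom_coeffs_def lookup_single when_def homogeneous_1)

lemma hom_coeffs_scale_single: "homogeneous i c \<Longrightarrow> hom_coeffs i (scale c (single b 1))"
  using hom_coeffs_scale[OF _ hom_coeffs_single] by force

lemma hom_coeffs_lin_ext: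
  assumes "hom_coeffs i u" "\<And>b. hom_coeffs j (f b)"
  shows "hom_coeffs (i + j) (lin_ext f u)"
  unfolding lin_ext_def using assms
  by (intro hom_coeffs_sum hom_coeffs_scale) (auto simp: hom_coeffs_def)

lemma hom_coeffs_lin_ext_0:
  "hom_coeffs i u \<Longrightarrow> (\<And>b. hom_coeffs 0 (f b)) \<Longrightarrow> hom_coeffs i (lin_ext f u)"
  using hom_coeffs_lin_ext[of i u 0 f] by simp

lemma homogeneous_wedge_sgn: "homogeneous 0 (wedge_sgn J S)"
  by (simp add: wedge_sgn_def homogeneous_neg_1_power)

lemma homogeneous_sgn_in: "homogeneous 0 (sgn_in a A)"
  by (simp add: sgn_in_def homogeneous_neg_1_power)

lemma homogeneous_sgn_var: "homogeneous 1 (sgn_in a A * var b)"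
  using homogeneous_mult[OF homogeneous_sgn_in homogeneous_var] by simp

lemma hom_coeffs_kappa: "hom_coeffs i u \<Longrightarrow> hom_coeffs i (kappa u)"
  unfolding kappa_def
  by (erule hom_coeffs_lin_ext_0)
    (auto intro!: hom_coeffs_sum hom_coeffs_scale_single homogeneous_sgn_in split: prod.split)

lemma hom_coeffs_Kos: "hom_coeffs i u \<Longrightarrow> hom_coeffs (i + 1) (Kos_tensor u)"
  unfolding Kos_tensor_def
  by (rule hom_coeffs_lin_ext)
    (auto intro!: hom_coeffs_sum hom_coeffs_scale_single homogeneous_sgn_var split: prod.split)

lemma hom_coeffs_Kos_K: "hom_coeffs i u \<Longrightarrow> hom_coeffs (i + 1) (Kos_K u)"
  unfolding Kos_K_def
  by (rule hom_coeffs_lin_ext)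
    (auto intro!: hom_coeffs_sum hom_coeffs_scale_single homogeneous_sgn_var split: prod.split)

lemma hom_coeffs_nu: "hom_coeffs i u \<Longrightarrow> hom_coeffs (i + 1) (nu u)"
  unfolding nu_def
  by (rule hom_coeffs_lin_ext)
    (auto intro!: hom_coeffs_sum hom_coeffs_scale_single homogeneous_var split: prod.split)

lemma hom_coeffs_kappa_contr: "hom_coeffs i u \<Longrightarrow> hom_coeffs i (kappa_contr u)"
  unfolding kappa_contr_def
  by (erule hom_coeffs_lin_ext_0)
    (auto simp: contraction_def hom_coeffs_0 hom_coeffs_single split: prod.split)

lemma hom_coeffs_restr: "hom_coeffs i u \<Longrightarrow> hom_coeffs i (restr P u)"
  by (simp add: hom_coeffs_def lookup_restr)

section \<open>Coefficients in the maximal ideal\<close>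

lemma max_ideal_0: "0 \<in> max_ideal"
  unfolding max_ideal_def by (rule module.span_zero[OF module_ring])

lemma max_ideal_mult: "p \<in> max_ideal \<Longrightarrow> q * p \<in> max_ideal"
  unfolding max_ideal_def by (rule module.span_scale[OF module_ring])

lemma max_ideal_add: "p \<in> max_ideal \<Longrightarrow> q \<in> max_ideal \<Longrightarrow> p + q \<in> max_ideal"
  unfolding max_ideal_def by (rule module.span_add[OF module_ring])

lemma max_ideal_uminus: "p \<in> max_ideal \<Longrightarrow> - p \<in> max_ideal"
  unfolding max_ideal_def by (rule module.span_neg[OF module_ring])

lemma max_ideal_sum: "(\<And>i. i \<in> I \<Longrightarrow> f i \<in> max_ideal) \<Longrightarrow> sum f I \<in> max_ideal"
  unfolding max_ideal_def by (rule module.span_sum[OF module_ring])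

lemma max_ideal_var: "var i \<in> max_ideal"
  unfolding max_ideal_def by (rule module.span_base[OF module_ring]) simp

lemma max_ideal_monom:
  assumes "\<beta> \<noteq> 0"
  shows "monom \<beta> \<in> max_ideal"
proof -
  obtain k where "k \<in> Supp \<beta>" using assms by (metis ex_in_conv keys_eq_empty)
  then have eq: "monom \<beta> = monom (\<beta> - \<epsilon> k) * (var k :: ('a, 'b) mpoly)"
    using monom_add_unit[of "\<beta> - \<epsilon> k" k] by (simp add: unit_expo_diff_add mult.commute)
  show ?thesis by (subst eq) (intro max_ideal_mult max_ideal_var)
qed

definition max_coeffs :: "('b \<Rightarrow>\<^sub>0 ('n, 'k::comm_ring_1) mpoly) \<Rightarrow> bool"
  where "max_coeffs u \<longleftrightarrow> (\<forall>b. lookup u b \<in> max_ideal)"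

lemma max_coeffs_add: "max_coeffs u \<Longrightarrow> max_coeffs v \<Longrightarrow> max_coeffs (u + v)"
  by (simp add: max_coeffs_def lookup_add max_ideal_add)

lemma max_coeffs_lin_ext_arg: "max_coeffs u \<Longrightarrow> max_coeffs (lin_ext f u)"
  by (simp add: max_coeffs_def lookup_lin_ext mult.commute[of "lookup u _"] max_ideal_sum max_ideal_mult)

lemma max_coeffs_lin_ext_fun: "(\<And>b. max_coeffs (f b)) \<Longrightarrow> max_coeffs (lin_ext f u)"
  by (simp add: max_coeffs_def lookup_lin_ext max_ideal_sum max_ideal_mult)

lemma max_coeffs_sum: "(\<And>i. i \<in> I \<Longrightarrow> max_coeffs (f i)) \<Longrightarrow> max_coeffs (sum f I)"
  by (simp add: max_coeffs_def lookup_sum max_ideal_sum)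

lemma max_coeffs_scale: "c \<in> max_ideal \<Longrightarrow> max_coeffs (scale c u)"
  by (simp add: max_coeffs_def lookup_scale mult.commute[of c] max_ideal_mult)

lemma max_coeffs_Kos: "max_coeffs (Kos_tensor u)"
  unfolding Kos_tensor_def
  by (rule max_coeffs_lin_ext_fun)
    (auto intro!: max_coeffs_sum max_coeffs_scale max_ideal_mult max_ideal_var split: prod.split)

lemma max_coeffs_Kos_K: "max_coeffs (Kos_K u)"
  unfolding Kos_K_def
  by (rule max_coeffs_lin_ext_fun)
    (auto intro!: max_coeffs_sum max_coeffs_scale max_ideal_mult max_ideal_var split: prod.split)

lemma max_coeffs_nu: "max_coeffs (nu u)"
  unfolding nu_def
  by (rule max_coeffs_lin_ext_fun)
    (auto intro!: max_coeffs_sum max_coeffs_scale max_ideal_var split: prod.split)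

lemma max_coeffs_kappa: "max_coeffs u \<Longrightarrow> max_coeffs (kappa u)"
  unfolding kappa_def by (rule max_coeffs_lin_ext_arg)

lemma max_coeffs_kappa_contr: "max_coeffs u \<Longrightarrow> max_coeffs (kappa_contr u)"
  unfolding kappa_contr_def by (rule max_coeffs_lin_ext_arg)

text \<open>Applying a dual functional \<open>c i\<close> to a linear relation isolates one
  coefficient. The same functionals later read off the matrix entries for grading and
  minimality.\<close>

lemma is_basis_coordinates:
  fixes sc :: "'r::comm_ring_1 \<Rightarrow> 'm::ab_group_add \<Rightarrow> 'm"
  assumes "module sc" and fin: "finite I" and sub: "module.subspace sc W"
    and lin: "\<And>i. i \<in> I \<Longrightarrow> module_hom sc (*) (c i)"
    and dual: "\<And>i j. i \<in> I \<Longrightarrow> j \<in> I \<Longrightarrow> c i (g j) = (if i = j then 1 else 0)"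
    and gW: "\<And>i. i \<in> I \<Longrightarrow> g i \<in> W"
    and expand: "\<And>u. u \<in> W \<Longrightarrow> u = (\<Sum>i\<in>I. sc (c i u) (g i))"
  shows "is_basis sc (g ` I) W" and "inj_on g I"
proof -
  interpret m: module sc by fact
  show inj: "inj_on g I" using dual by (metis inj_onI zero_neq_one)
  have "\<not> m.dependent (g ` I)"
  proof
    assume "m.dependent (g ` I)"
    then obtain t a v where t: "finite t" "t \<subseteq> g ` I" "(\<Sum>v\<in>t. sc (a v) v) = 0" "v \<in> t" "a v \<noteq> 0"
      unfolding m.dependent_explicit by blast
    obtain i where i: "i \<in> I" "v = g i" using t by blast
    have "0 = c i (\<Sum>v\<in>t. sc (a v) v)" using module_hom.zero[OF lin[OF i(1)]] t by simp
    also have "\<dots> = (\<Sum>w\<in>t. a w * c i w)"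
      by (simp add: module_hom.sum[OF lin[OF i(1)]] module_hom.scale[OF lin[OF i(1)]])
    also have "\<dots> = (\<Sum>w\<in>t. if w = v then a w else 0)"
    proof (intro sum.cong refl)
      fix w assume "w \<in> t"
      then obtain j where "j \<in> I" "w = g j" using t by blast
      then show "a w * c i w = (if w = v then a w else 0)"
        using i dual[OF i(1)] inj by (auto simp: inj_on_eq_iff)
    qed
    also have "\<dots> = a v" using t by simp
    finally show False using t by simp
  qed
  moreover have "m.span (g ` I) = W"
  proof
    show "m.span (g ` I) \<subseteq> W" using gW sub by (intro m.span_minimal) auto
    show "W \<subseteq> m.span (g ` I)"
    proof
      fix u assume u: "u \<in> W"
      have "(\<Sum>i\<in>I. sc (c i u) (g i)) \<in> m.span (g ` I)"
        by (intro m.span_sum m.span_scale m.span_base) simp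
      then show "u \<in> m.span (g ` I)" using expand[OF u] by simp
    qed
  qed
  ultimately show "is_basis sc (g ` I) W" by (simp add: is_basis_def)
qed


section \<open>A basis of the modules $L_d^{i,B}$\<close>

lemma Supp_diff_unit: "Supp (\<beta> - \<epsilon> k) \<subseteq> Supp \<beta>"
  by (auto simp: in_keys_iff lookup_minus)

lemma finite_expo_deg: "finite {\<beta> :: 'n::finite expo. expo_deg \<beta> \<le> m}"
proof -
  let ?S = "{\<beta> :: 'n expo. expo_deg \<beta> \<le> m}"
  have "lookup \<beta> i \<le> expo_deg \<beta>" for \<beta> :: "'n expo" and i
    unfolding expo_deg_def by (rule member_le_sum) auto
  then have "lookup ` ?S \<subseteq> {f. \<forall>x. (x \<in> UNIV \<longrightarrow> f x \<in> {..m}) \<and> (x \<notin> UNIV \<longrightarrow> f x = 0)}"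
    using order_trans by fastforce
  moreover have "finite {f :: 'n \<Rightarrow> nat. \<forall>x. (x \<in> UNIV \<longrightarrow> f x \<in> {..m}) \<and> (x \<notin> UNIV \<longrightarrow> f x = 0)}"
    by (rule finite_set_of_finite_funs) auto
  ultimately have "finite (lookup ` ?S)" by (rule finite_subset)
  moreover have "inj_on lookup ?S" by (auto simp: inj_on_def intro: poly_mapping_eqI)
  ultimately show ?thesis by (rule finite_imageD)
qed

text \<open>For a standard pair Min A is at most every element of the support, so the contraction
  kills \<open>w\<close> and the homotopy identity becomes a left inverse. Hence the standard
  elements are independent, and \<open>kappa_contr\<close> reads off their coefficients.\<close>

lemma kappa_contr_kappa:
  assumes "keys w \<subseteq> {(A, \<beta>). A \<noteq> {} \<and> standard A \<beta>}"
  shows "kappa_contr (kappa w) = w"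
proof -
  have "keys (kappa_contr w) \<subseteq> {}"
  proof (rule keys_kappa_contr[OF assms])
    fix A :: "'a set" and \<beta> m
    assume "(A, \<beta>) \<in> {(A, \<beta>). A \<noteq> {} \<and> standard A \<beta>}" "m \<in> Supp \<beta>"
      "\<forall>b\<in>Supp \<beta>. m \<le> b" "\<forall>a\<in>A. m < a"
    moreover from this have "Min (Supp \<beta>) = m" by (intro Min_eqI) auto
    ultimately have "Min A \<le> m" "m < Min A" by (auto simp: standard_def)
    then show "(insert m A, \<beta> - \<epsilon> m) \<in> {}" by simp
  qed
  moreover have "keys w \<subseteq> {(A, \<beta>). A \<noteq> {} \<or> \<beta> \<noteq> 0}" using assms by auto
  ultimately show ?thesis using kappa_homotopy[of w] by simp
qed

text \<open>Covers both choices of k made below: the least element of the support, and the first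
  element of the support missing from A.\<close>

lemma standard_insert:
  assumes "\<And>b. b \<in> Supp \<beta> \<Longrightarrow> b \<in> A \<or> k \<le> b"
  shows "standard (insert k A) (\<beta> - \<epsilon> k)"
proof -
  have "Min (insert k A) \<le> Min (Supp (\<beta> - \<epsilon> k))" if "Supp (\<beta> - \<epsilon> k) \<noteq> {}"
  proof -
    have "Min (Supp (\<beta> - \<epsilon> k)) \<in> Supp \<beta>"
      using Min_in[OF _ that] Supp_diff_unit[of \<beta> k] by auto
    then consider "Min (Supp (\<beta> - \<epsilon> k)) \<in> A" | "k \<le> Min (Supp (\<beta> - \<epsilon> k))" using assms by blast
    then show ?thesis
      by cases (auto intro: Min_le order_trans[OF Min_le[of "insert k A" k]])
  qed
  then show ?thesis unfolding standard_def by blast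
qed

locale removed_monomials =
  fixes \<alpha> :: "nat \<Rightarrow> 'n::{finite,linorder} expo" and d r :: nat
  assumes d_pos: "d \<ge> 1"
    and deg_\<alpha>: "\<And>s. s \<in> {1..r} \<Longrightarrow> expo_deg (\<alpha> s) = d"
    and deg_lcm: "\<And>s t. s \<in> {1..r} \<Longrightarrow> t \<in> {1..r} \<Longrightarrow> s \<noteq> t \<Longrightarrow>
      expo_deg (expo_lcm (\<alpha> s) (\<alpha> t)) \<ge> d + 2"
begin

definition B :: "'n expo set"
  where "B = \<alpha> ` {1..r}"

lemma d_eq [simp]: "d - 1 + 1 = d"
  using d_pos by simp

lemma deg_B: "\<beta> \<in> B \<Longrightarrow> expo_deg \<beta> = d"
  by (auto simp: B_def deg_\<alpha>)

lemma inj_\<alpha>: "inj_on \<alpha> {1..r}"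
proof (rule inj_onI, rule ccontr)
  fix s t assume *: "s \<in> {1..r}" "t \<in> {1..r}" "\<alpha> s = \<alpha> t" "s \<noteq> t"
  have "expo_lcm (\<alpha> s) (\<alpha> t) = \<alpha> s"
    by (rule poly_mapping_eqI) (simp add: lookup_expo_lcm *(3))
  then show False using deg_lcm[OF *(1,2,4)] deg_\<alpha>[OF *(1)] by simp
qed

text \<open>The lcm of the two monomials divides x^(\<beta> + \<epsilon> a), whose degree d + 1 is
  below the bound d + 2. So among the terms of the symbol e_A \<otimes> e^(\<beta> - \<epsilon> k)
  only the one that removes k can lie over B.\<close>

lemma exchange_notin_B:
  assumes "\<beta> \<in> B" "k \<in> Supp \<beta>" "a \<noteq> k"
  shows "\<beta> - \<epsilon> k + \<epsilon> a \<notin> B"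
proof
  let ?\<gamma> = "\<beta> - \<epsilon> k + \<epsilon> a"
  assume "?\<gamma> \<in> B"
  then obtain s t where st: "s \<in> {1..r}" "\<beta> = \<alpha> s" "t \<in> {1..r}" "?\<gamma> = \<alpha> t"
    using assms(1) by (auto simp: B_def)
  have "lookup ?\<gamma> k \<noteq> lookup \<beta> k"
    using assms by (simp add: lookup_add lookup_minus lookup_single in_keys_iff)
  then have "s \<noteq> t" using st by auto
  then have "d + 2 \<le> expo_deg (expo_lcm \<beta> ?\<gamma>)" using deg_lcm st by simp
  also have "\<dots> \<le> expo_deg (\<beta> + \<epsilon> a)"
    unfolding expo_deg_def by (rule sum_mono) (simp add: lookup_expo_lcm lookup_add lookup_minus)
  also have "\<dots> = d + 1" using deg_B[OF assms(1)] by (simp add: expo_deg_plus)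
  finally show False by simp
qed

section \<open>The projection to the removed monomials and a section of it\<close>

definition piB :: "('n, 'k::comm_ring_1) WS \<Rightarrow> ('n, 'k) WS"
  where "piB = restr (\<lambda>b. snd b \<in> B)"

text \<open>Composed with \<open>kappa\<close> it is a right inverse of \<open>piB\<close> on the
  B-terms that occur in \<open>L\<close>. The first element of the support missing from J is the
  index k_t of the generators of type (3), and it makes the lifted pair standard.\<close>

definition sec :: "('n, 'k::comm_ring_1) WS \<Rightarrow> ('n, 'k) WS"
  where "sec = lin_ext (\<lambda>(J, \<beta>). if \<beta> \<in> B \<and> \<not> Supp \<beta> \<subseteq> J then
    let k = Min (Supp \<beta> - J)
    in scale (sgn_in k (insert k J)) (single (insert k J, \<beta> - \<epsilon> k) 1) else 0)"

interpretation piB: module_hom scale scale "piB :: ('n, 'k::comm_ring_1) WS \<Rightarrow> _"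
  unfolding piB_def by (rule restr.module_hom_axioms)

interpretation sec: module_hom scale scale "sec :: ('n, 'k::comm_ring_1) WS \<Rightarrow> _"
  unfolding sec_def by (rule module_hom_lin_ext)

lemma piB_single: "piB (single (A, \<beta>) 1) = (if \<beta> \<in> B then single (A, \<beta>) 1 else 0)"
  by (simp add: piB_def restr_single)

lemma piB_Lsym_hit:
  fixes J :: "'n set"
  assumes "\<beta> \<in> B" "k \<in> Supp \<beta>" "k \<notin> J"
  shows "piB (Lsym (insert k J) (\<beta> - \<epsilon> k)) = scale (sgn_in k (insert k J)) (single (J, \<beta>) 1 :: ('n, 'k::comm_ring_1) WS)"
proof -
  have "piB (Lsym (insert k J) (\<beta> - \<epsilon> k) :: ('n, 'k) WS) =
      (\<Sum>a\<in>insert k J. scale (sgn_in a (insert k J)) (piB (single (insert k J - {a}, \<beta> - \<epsilon> k + \<epsilon> a) 1)))"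
    by (simp only: Lsym_def kappa_single piB.sum piB.scale)
  also have "\<dots> = (\<Sum>a\<in>{k}. scale (sgn_in a (insert k J)) (piB (single (insert k J - {a}, \<beta> - \<epsilon> k + \<epsilon> a) 1)))"
  proof (rule sum.mono_neutral_right)
    show "\<forall>a\<in>insert k J - {k}. scale (sgn_in a (insert k J))
        (piB (single (insert k J - {a}, \<beta> - \<epsilon> k + \<epsilon> a) 1)) = (0 :: ('n, 'k) WS)"
      using exchange_notin_B[OF assms(1,2)] by (simp add: piB_single)
  qed auto
  finally show ?thesis using assms by (simp add: piB_single unit_expo_diff_add)
qed

lemma piB_Lsym_miss: "(\<And>k. k \<in> A \<Longrightarrow> \<beta> + \<epsilon> k \<notin> B) \<Longrightarrow> piB (Lsym A \<beta>) = 0"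
  by (simp add: Lsym_def kappa_single piB.sum piB.scale piB_single)

lemma sec_single:
  assumes "\<beta> \<in> B" "k \<in> Supp \<beta>" "k \<notin> J" "\<And>l. l \<in> Supp \<beta> \<Longrightarrow> l < k \<Longrightarrow> l \<in> J"
  shows "sec (single (J, \<beta>) 1) = scale (sgn_in k (insert k J)) (single (insert k J, \<beta> - \<epsilon> k) 1 :: ('n, 'k::comm_ring_1) WS)"
proof -
  have "Min (Supp \<beta> - J) = k"
    by (rule Min_eqI) (use assms in \<open>auto simp: not_less[symmetric]\<close>)
  then show ?thesis using assms by (auto simp: sec_def lin_ext_single Let_def)
qed

lemma first_missing:
  fixes \<beta> :: "'n expo"
  assumes "\<not> Supp \<beta> \<subseteq> J"
  obtains k where "k \<in> Supp \<beta>" "k \<notin> J" "\<And>l. l \<in> Supp \<beta> \<Longrightarrow> l < k \<Longrightarrow> l \<in> J"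
proof
  have *: "Supp \<beta> - J \<noteq> {}" using assms by auto
  show "Min (Supp \<beta> - J) \<in> Supp \<beta>" "Min (Supp \<beta> - J) \<notin> J"
    using Min_in[OF _ *] by auto
  show "l \<in> J" if "l \<in> Supp \<beta>" "l < Min (Supp \<beta> - J)" for l
    using that Min_le[of "Supp \<beta> - J" l] by (auto simp: not_le[symmetric])
qed

lemma piB_kappa_sec:
  fixes u :: "('n, 'k::comm_ring_1) WS"
  assumes "keys u \<subseteq> {(J, \<beta>). \<beta> \<in> B \<and> \<not> Supp \<beta> \<subseteq> J}"
  shows "piB (kappa (sec u)) = u"
  using assms
proof (induction rule: free_module_induct)
  case (basis b)
  then obtain J \<beta> where b: "b = (J, \<beta>)" "\<beta> \<in> B" "\<not> Supp \<beta> \<subseteq> J" by auto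
  obtain k where k: "k \<in> Supp \<beta>" "k \<notin> J" "\<And>l. l \<in> Supp \<beta> \<Longrightarrow> l < k \<Longrightarrow> l \<in> J"
    using first_missing[OF b(3)] by blast
  have "piB (kappa (sec (single b 1))) =
      scale (sgn_in k (insert k J)) (piB (Lsym (insert k J) (\<beta> - \<epsilon> k) :: ('n, 'k) WS))"
    by (simp only: b(1) sec_single[OF b(2) k] kappa.scale piB.scale Lsym_def)
  then show ?case by (simp add: piB_Lsym_hit[OF b(2) k(1,2)] b(1))
qed (simp_all add: sec.add sec.scale kappa.add kappa.scale piB.add piB.scale)

text \<open>Elements of \<open>L\<close> are kappa-images, and each term of such an image has the
  moved element in its exponent but no longer in its exterior part.\<close>

lemma keys_L:
  assumes "u \<in> L d i"
  shows "keys u \<subseteq> {(J, \<beta>). \<not> Supp \<beta> \<subseteq> J \<and> card J = i}"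
proof -
  have "keys (kappa (kappa_contr u)) \<subseteq> {(J, \<beta>). \<not> Supp \<beta> \<subseteq> J}"
    by (rule keys_kappa[of _ UNIV]) (auto simp: Supp_add_unit)
  then show ?thesis
    using kappa_kappa_contr[of u "d - 1" i] assms by (auto simp: L_def wedge_sym_def)
qed

lemma keys_piB_L:
  assumes "u \<in> L d i"
  shows "keys (piB u) \<subseteq> {(J, \<beta>). \<beta> \<in> B \<and> \<not> Supp \<beta> \<subseteq> J \<and> card J = i}"
  using keys_L[OF assms] by (auto simp: piB_def keys_restr)

definition std :: "nat \<Rightarrow> ('n set \<times> 'n expo) set"
  where "std i = {(A, \<beta>). card A = i + 1 \<and> expo_deg \<beta> + 1 = d \<and> standard A \<beta>}"

text \<open>
  The standard elements \<open>e\<^bsub>J \<union> {k\<^sub>t}\<^esub> \<otimes> e\<^bsup>\<alpha> - \<epsilon>\<^bsub>k\<^sub>t\<^esub>\<^esup>\<close> that are subtracted in the generators of type (3).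
\<close>

definition pivot :: "'n set \<times> 'n expo \<Rightarrow> bool"
  where "pivot = (\<lambda>(A, \<beta>). \<exists>k\<in>A. \<beta> + \<epsilon> k \<in> B \<and> (\<forall>l\<in>Supp (\<beta> + \<epsilon> k). l < k \<longrightarrow> l \<in> A))"

lemma finite_std: "finite (std i)"
proof (rule finite_subset)
  show "std i \<subseteq> UNIV \<times> {\<beta>. expo_deg \<beta> \<le> d}" by (auto simp: std_def)
qed (simp add: finite_expo_deg)

lemma std_wedge_sym: "keys u \<subseteq> std i \<Longrightarrow> u \<in> wedge_sym (i + 1) (d - 1)"
  using d_pos by (auto simp: wedge_sym_keys std_def)

lemma keys_kappa_contr_std:
  assumes "u \<in> L d i"
  shows "keys (kappa_contr u) \<subseteq> std i"
proof (rule keys_kappa_contr)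
  show "keys u \<subseteq> {(A, \<beta>). card A = i \<and> expo_deg \<beta> = d}"
    using assms by (simp add: L_def wedge_sym_keys)
  fix A :: "'n set" and \<beta> m
  assume *: "(A, \<beta>) \<in> {(A, \<beta>). card A = i \<and> expo_deg \<beta> = d}" "m \<in> Supp \<beta>"
    "\<forall>b\<in>Supp \<beta>. m \<le> b" "\<forall>a\<in>A. m < a"
  then have "m \<notin> A" by auto
  then show "(insert m A, \<beta> - \<epsilon> m) \<in> std i"
    using * expo_deg_diff[of m \<beta>] standard_insert[of \<beta> A m] by (auto simp: std_def)
qed

lemma keys_sec:
  fixes u :: "('n, 'k::comm_ring_1) WS"
  assumes "keys u \<subseteq> {(J, \<beta>). \<beta> \<in> B \<and> \<not> Supp \<beta> \<subseteq> J \<and> card J = i}"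
  shows "keys (sec u) \<subseteq> {n \<in> std i. pivot n}"
  using assms
proof (induction rule: free_module_induct)
  case (basis b)
  then obtain J \<beta> where b: "b = (J, \<beta>)" "\<beta> \<in> B" "\<not> Supp \<beta> \<subseteq> J" "card J = i" by auto
  obtain k where k: "k \<in> Supp \<beta>" "k \<notin> J" "\<And>l. l \<in> Supp \<beta> \<Longrightarrow> l < k \<Longrightarrow> l \<in> J"
    using first_missing[OF b(3)] by blast
  have "standard (insert k J) (\<beta> - \<epsilon> k)"
    by (rule standard_insert) (use k(3) in \<open>auto simp: not_less[symmetric]\<close>)
  moreover have "pivot (insert k J, \<beta> - \<epsilon> k)"
    using b k by (auto simp: pivot_def unit_expo_diff_add)
  ultimately have "(insert k J, \<beta> - \<epsilon> k) \<in> {n \<in> std i. pivot n}"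
    using b k expo_deg_diff[OF k(1)] by (auto simp: std_def deg_B)
  moreover have "sec (single b 1) =
      scale (sgn_in k (insert k J)) (single (insert k J, \<beta> - \<epsilon> k) 1 :: ('n, 'k) WS)"
    by (simp only: b(1) sec_single[OF b(2) k])
  ultimately show ?case by (simp only: keys_subset_scale keys_subset_single)
qed (simp_all only: sec.add sec.scale sec.zero keys_zero keys_subset_add keys_subset_scale empty_subsetI)

section \<open>Elements of L without removed monomials\<close>

definition M :: "nat \<Rightarrow> ('n, 'k::comm_ring_1) WS set"
  where "M i = {u \<in> L d i. piB u = 0}"

definition projM :: "('n, 'k::comm_ring_1) WS \<Rightarrow> ('n, 'k) WS"
  where "projM u = u - kappa (sec (piB u))"

text \<open>If a term of the standard element lies over B, this is a generator of type (3) up to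
  sign; otherwise it is the standard element itself.\<close>

definition gen :: "'n set \<times> 'n expo \<Rightarrow> ('n, 'k::comm_ring_1) WS"
  where "gen n = projM (kappa (single n 1))"

definition N :: "nat \<Rightarrow> ('n set \<times> 'n expo) set"
  where "N i = {n \<in> std i. \<not> pivot n}"

lemma subspace_M: "fm.subspace (M i :: ('n, 'k::comm_ring_1) WS set)"
  using subspace_L[of d i, where ?'n = 'n and ?'k = 'k]
  by (auto simp: M_def fm.subspace_def piB.add piB.scale)

lemma projM_sum: "projM (sum f I) = (\<Sum>i\<in>I. projM (f i))"
  by (simp add: projM_def piB.sum sec.sum kappa.sum sum_subtractf)

lemma projM_scale: "projM (scale c u) = scale c (projM u)"
  by (simp add: projM_def piB.scale sec.scale kappa.scale fm.scale_right_diff_distrib)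

lemma projM_M:
  assumes "u \<in> L d i"
  shows "projM u \<in> M i"
proof -
  have 1: "keys (sec (piB u)) \<subseteq> std i"
    using keys_sec[OF keys_piB_L[OF assms]] by auto
  have "kappa (sec (piB u)) \<in> L (d - 1 + 1) i"
    by (rule L_kappa[OF std_wedge_sym[OF 1]])
  then have "projM u \<in> L d i"
    using assms fm.subspace_diff[OF subspace_L] by (simp add: projM_def)
  moreover have "piB (kappa (sec (piB u))) = piB u"
    by (rule piB_kappa_sec) (use keys_piB_L[OF assms] in auto)
  ultimately show ?thesis by (simp add: M_def projM_def piB.diff)
qed

lemma kappa_std_L: "n \<in> std i \<Longrightarrow> kappa (single n 1) \<in> L d i"
  using L_kappa[OF std_wedge_sym[OF keys_subset_single, of n i 1]] by simp

lemma gen_M: "n \<in> std i \<Longrightarrow> gen n \<in> M i"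
  unfolding gen_def by (intro projM_M kappa_std_L)

text \<open>A pivot element is already the chosen lift of its own B-part, so the projection removes
  it.\<close>

lemma gen_pivot:
  assumes "pivot n"
  shows "gen n = (0 :: ('n, 'k::comm_ring_1) WS)"
proof -
  obtain A \<beta> k where n: "n = (A, \<beta>)" "k \<in> A" "\<beta> + \<epsilon> k \<in> B"
    "\<And>l. l \<in> Supp (\<beta> + \<epsilon> k) \<Longrightarrow> l < k \<Longrightarrow> l \<in> A"
    using assms by (auto simp: pivot_def)
  have k: "k \<in> Supp (\<beta> + \<epsilon> k)" "k \<notin> A - {k}"
    "\<And>l. l \<in> Supp (\<beta> + \<epsilon> k) \<Longrightarrow> l < k \<Longrightarrow> l \<in> A - {k}"
    using n(4) by (auto simp: Supp_add_unit)
  have A: "insert k (A - {k}) = A" using n by auto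
  have "piB (kappa (single n 1)) = scale (sgn_in k A) (single (A - {k}, \<beta> + \<epsilon> k) 1 :: ('n, 'k) WS)"
    using piB_Lsym_hit[OF n(3) k(1,2), where ?'k = 'k] unfolding A n(1) Lsym_def by simp
  moreover have "sec (single (A - {k}, \<beta> + \<epsilon> k) 1) = scale (sgn_in k A) (single n 1 :: ('n, 'k) WS)"
    using sec_single[OF n(3) k, where ?'k = 'k] unfolding A n(1) by simp
  ultimately have "sec (piB (kappa (single n 1))) = (single n 1 :: ('n, 'k) WS)"
    by (simp add: sec.scale)
  then show ?thesis by (simp add: gen_def projM_def)
qed

text \<open>The correction made by \<open>projM\<close> is supported on pivots, so the coordinates
  at the other standard indices do not change.\<close>

lemma coord_gen:
  assumes "m \<in> N i" "n \<in> N i"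
  shows "lookup (kappa_contr (gen n :: ('n, 'k::comm_ring_1) WS)) m = (if m = n then 1 else 0)"
proof -
  let ?w = "sec (piB (kappa (single n 1))) :: ('n, 'k) WS"
  have n: "n \<in> std i" using assms by (simp add: N_def)
  have w: "keys ?w \<subseteq> {n \<in> std i. pivot n}"
    by (intro keys_sec keys_piB_L kappa_std_L n)
  have "gen n = kappa (single n 1 - ?w)"
    by (simp add: gen_def projM_def kappa.diff)
  also have "kappa_contr \<dots> = single n 1 - ?w"
  proof (rule kappa_contr_kappa)
    have "keys (single n 1 - ?w) \<subseteq> std i"
      by (intro keys_subset_minus keys_subset_single n) (use w in auto)
    also have "\<dots> \<subseteq> {(A, \<beta>). A \<noteq> {} \<and> standard A \<beta>}" by (auto simp: std_def)
    finally show "keys (single n 1 - ?w) \<subseteq> {(A, \<beta>). A \<noteq> {} \<and> standard A \<beta>}" .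
  qed
  moreover have "lookup ?w m = 0"
  proof -
    have "m \<notin> keys ?w" using w assms(1) by (auto simp: N_def)
    then show ?thesis by (simp add: in_keys_iff)
  qed
  ultimately show ?thesis by (simp add: lookup_minus lookup_single)
qed

lemma M_expand:
  fixes u :: "('n, 'k::comm_ring_1) WS"
  assumes "u \<in> M i"
  shows "u = (\<Sum>n\<in>N i. scale (lookup (kappa_contr u) n) (gen n))"
proof -
  have u: "u \<in> L d i" "piB u = 0" using assms by (auto simp: M_def)
  have "kappa_contr u = (\<Sum>n\<in>keys (kappa_contr u). scale (lookup (kappa_contr u) n) (single n 1))"
    by (rule poly_mapping_expand)
  also have "\<dots> = (\<Sum>n\<in>std i. scale (lookup (kappa_contr u) n) (single n 1))"
    by (rule sum.mono_neutral_left) (use keys_kappa_contr_std[OF u(1)] finite_std in \<open>auto simp: in_keys_iff\<close>)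
  finally have e: "kappa_contr u = (\<Sum>n\<in>std i. scale (lookup (kappa_contr u) n) (single n 1))" .
  have "u = projM u" by (simp add: projM_def u)
  also have "\<dots> = projM (kappa (kappa_contr u))"
    using kappa_kappa_contr[of u "d - 1" i] u by simp
  also have "\<dots> = projM (kappa (\<Sum>n\<in>std i. scale (lookup (kappa_contr u) n) (single n 1)))"
    by (subst e) (rule refl)
  also have "\<dots> = (\<Sum>n\<in>std i. scale (lookup (kappa_contr u) n) (gen n))"
    by (simp add: kappa.sum kappa.scale projM_sum projM_scale gen_def)
  also have "\<dots> = (\<Sum>n\<in>N i. scale (lookup (kappa_contr u) n) (gen n))"
    by (rule sum.mono_neutral_right) (auto simp: finite_std N_def gen_pivot)
  finally show ?thesis .
qed

lemma gen_LB:
  assumes "n \<in> std i"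
  shows "gen n \<in> (LB d r \<alpha> i :: ('n, 'k::comm_ring_1) WS set)"
proof -
  obtain A \<beta> where n: "n = (A, \<beta>)" by (cases n)
  have A: "card A = i + 1" "expo_deg \<beta> + 1 = d" "standard A \<beta>" using assms n by (auto simp: std_def)
  show ?thesis
  proof (cases "\<exists>k\<in>A. \<beta> + \<epsilon> k \<in> B")
    case True
    then obtain k s where k: "k \<in> A" "\<beta> + \<epsilon> k \<in> B" "s \<in> {1..r}" "\<alpha> s = \<beta> + \<epsilon> k"
      by (auto simp: B_def)
    \<comment> \<open>This is the J of the type (3) generator. Its second term is the lift chosen by
      \<open>sec\<close>, and \<open>gen n\<close> is that generator times the sign of k.\<close>
    define J where "J = A - {k}"
    have J: "insert k J = A" "k \<notin> J" "card J = i" using k A by (auto simp: J_def)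
    have b: "\<alpha> s - \<epsilon> k = \<beta>" "k \<in> Supp (\<alpha> s)" by (auto simp: k Supp_add_unit)
    have "\<not> Supp (\<alpha> s) \<subseteq> J" using b J by auto
    then obtain kt where kt: "kt \<in> Supp (\<alpha> s)" "kt \<notin> J" "\<And>l. l \<in> Supp (\<alpha> s) \<Longrightarrow> l < kt \<Longrightarrow> l \<in> J"
      using first_missing by blast
    have st: "standard (insert kt J) (\<alpha> s - \<epsilon> kt)"
      by (rule standard_insert) (use kt(3) in \<open>auto simp: not_less[symmetric]\<close>)
    have "piB (kappa (single n 1)) = scale (sgn_in k (insert k J)) (single (J, \<alpha> s) 1 :: ('n, 'k) WS)"
      using piB_Lsym_hit[of "\<alpha> s" k J, where ?'k = 'k] k b J by (simp add: n Lsym_def)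
    then have "gen n = Lsym A \<beta> - scale (sgn_in k (insert k J) * sgn_in kt (insert kt J))
        (Lsym (insert kt J) (\<alpha> s - \<epsilon> kt) :: ('n, 'k) WS)"
      using sec_single[OF _ kt, where ?'k = 'k] k
      by (simp add: gen_def projM_def sec.scale kappa.scale n Lsym_def)
    also have "\<dots> = scale (sgn_in k (J \<union> {k})) (scale (sgn_in k (J \<union> {k})) (Lsym (J \<union> {k}) (\<alpha> s - \<epsilon> k)) -
        scale (sgn_in kt (J \<union> {kt})) (Lsym (J \<union> {kt}) (\<alpha> s - \<epsilon> kt)))" (is "_ = scale _ ?g")
      by (simp add: fm.scale_right_diff_distrib J b)
    also have "\<dots> \<in> LB d r \<alpha> i"
    proof -
      have "?g \<in> LB_gens d r \<alpha> i"
        unfolding LB_gens_def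
        by (rule UnI2, rule CollectI, rule exI[of _ J], rule exI[of _ s], rule exI[of _ k], rule exI[of _ kt])
          (use A J b kt k st in \<open>simp del: insert_iff\<close>, blast)
      then show ?thesis unfolding LB_def by (intro fm.span_scale fm.span_base)
    qed
    finally show ?thesis .
  next
    case False
    then have "piB (Lsym A \<beta> :: ('n, 'k) WS) = 0" by (intro piB_Lsym_miss) auto
    then have g: "gen n = (Lsym A \<beta> :: ('n, 'k) WS)" by (simp add: gen_def projM_def n Lsym_def)
    \<comment> \<open>No term lies over B. The element has type (2) if its exponent still has the
      form \<alpha> s - \<epsilon> k, and type (1) otherwise.\<close>
    have "Lsym A \<beta> \<in> (LB_gens d r \<alpha> i :: ('n, 'k) WS set)"
    proof (cases "\<exists>s\<in>{1..r}. \<exists>k\<in>Supp (\<alpha> s). \<beta> = \<alpha> s - \<epsilon> k")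
      case True
      then obtain s k where s: "s \<in> {1..r}" "k \<in> Supp (\<alpha> s)" "\<beta> = \<alpha> s - \<epsilon> k" by blast
      then have "\<beta> + \<epsilon> k \<in> B" by (auto simp: unit_expo_diff_add B_def)
      then have "k \<notin> A" using False by auto
      then show ?thesis
        unfolding LB_gens_def s(3)
        by (intro UnI1 UnI2 CollectI exI[of _ A] exI[of _ s] exI[of _ k]) (use s A in simp)
    next
      case False
      have "expo_deg \<beta> = d - 1" using A(2) by simp
      with False A show ?thesis
        unfolding LB_gens_def
        by (intro UnI1 CollectI exI[of _ A] exI[of _ \<beta>]) simp
    qed
    then show ?thesis unfolding g LB_def by (rule fm.span_base)
  qed
qed

text \<open>Types (1) and (2) have no term over B, the latter by \<open>exchange_notin_B\<close>. In
  type (3) the signs turn both B-parts into e_J \<otimes> e^\<alpha>, and they cancel.\<close>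

lemma LB_gens_M: "LB_gens d r \<alpha> i \<subseteq> (M i :: ('n, 'k::comm_ring_1) WS set)"
proof
  fix u :: "('n, 'k) WS" assume u: "u \<in> LB_gens d r \<alpha> i"
  then have "u \<in> LB d r \<alpha> i" unfolding LB_def by (rule fm.span_base)
  then have uL: "u \<in> L d i" using LB_subset_L[of d r \<alpha> i] d_pos deg_\<alpha> by blast
  from u consider (1) A \<beta> where "u = Lsym A \<beta>" "\<forall>s\<in>{1..r}. \<forall>k\<in>Supp (\<alpha> s). \<beta> \<noteq> \<alpha> s - \<epsilon> k"
    | (2) A s k where "u = Lsym A (\<alpha> s - \<epsilon> k)" "s \<in> {1..r}" "k \<in> Supp (\<alpha> s)" "k \<notin> A"
    | (3) J s k l where "u = scale (sgn_in k (J \<union> {k})) (Lsym (J \<union> {k}) (\<alpha> s - \<epsilon> k)) -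
        scale (sgn_in l (J \<union> {l})) (Lsym (J \<union> {l}) (\<alpha> s - \<epsilon> l))" "s \<in> {1..r}" "k \<in> Supp (\<alpha> s)"
        "l \<in> Supp (\<alpha> s)" "k \<notin> J" "l \<notin> J"
    unfolding LB_gens_def by blast
  then have "piB u = 0"
  proof cases
    case 1
    have "\<beta> + \<epsilon> k \<notin> B" for k
    proof
      assume "\<beta> + \<epsilon> k \<in> B"
      then obtain s where s: "s \<in> {1..r}" "\<alpha> s = \<beta> + \<epsilon> k" by (auto simp: B_def)
      then have "k \<in> Supp (\<alpha> s)" "\<beta> = \<alpha> s - \<epsilon> k" by (auto simp: Supp_add_unit)
      with 1(2) s(1) show False by blast
    qed
    then show ?thesis unfolding 1(1) by (intro piB_Lsym_miss)
  next
    case 2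
    have "\<alpha> s \<in> B" using 2 by (simp add: B_def)
    then have "\<alpha> s - \<epsilon> k + \<epsilon> a \<notin> B" if "a \<in> A" for a
      using exchange_notin_B[of "\<alpha> s" k a] 2 that by auto
    then show ?thesis unfolding 2(1) by (intro piB_Lsym_miss)
  next
    case 3
    have "\<alpha> s \<in> B" using 3 by (simp add: B_def)
    then show ?thesis unfolding 3(1) by (simp add: piB.diff piB.scale piB_Lsym_hit 3)
  qed
  with uL show "u \<in> M i" by (simp add: M_def)
qed

lemma LB_eq_M: "LB d r \<alpha> i = (M i :: ('n, 'k::comm_ring_1) WS set)"
proof
  show "LB d r \<alpha> i \<subseteq> (M i :: ('n, 'k) WS set)"
    unfolding LB_def by (rule fm.span_minimal[OF LB_gens_M subspace_M])
  show "(M i :: ('n, 'k) WS set) \<subseteq> LB d r \<alpha> i"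
  proof
    fix u :: "('n, 'k) WS" assume "u \<in> M i"
    have "(\<Sum>n\<in>N i. scale (lookup (kappa_contr u) n) (gen n)) \<in> LB d r \<alpha> i"
      using gen_LB[where ?'k = 'k] unfolding LB_def N_def
      by (intro fm.span_sum fm.span_scale) blast
    then show "u \<in> LB d r \<alpha> i" by (subst M_expand[OF \<open>u \<in> M i\<close>])
  qed
qed


section \<open>The maps $\Theta$ as a homotopy defect\<close>

text \<open>The wedge product of e_J with e_(Supp \<alpha>), placed over e^\<alpha>. It identifies
  the summands K with the coordinates \<open>inE\<close>.\<close>

definition tau :: "('n, 'k::comm_ring_1) KS \<Rightarrow> ('n, 'k) WS"
  where "tau = lin_ext (\<lambda>(s, J).
    scale (wedge_sgn J (Supp (\<alpha> s))) (single (J \<union> Supp (\<alpha> s), \<alpha> s) 1))"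

interpretation tau: module_hom scale scale "tau :: ('n, 'k::comm_ring_1) KS \<Rightarrow> _"
  unfolding tau_def by (rule module_hom_lin_ext)

lemma tau_single:
  "tau (single (s, J) 1) = scale (wedge_sgn J (Supp (\<alpha> s))) (single (J \<union> Supp (\<alpha> s), \<alpha> s) 1)"
  by (simp add: tau_def lin_ext_single)

definition lam :: "('n, 'k::comm_ring_1) KS \<Rightarrow> ('n, 'k) WS"
  where "lam v = kappa (nu (tau v))"

text \<open>The coordinates over B that can occur in \<open>L\<close>. Together with
  \<open>inE\<close> they form a Koszul complex over each \<beta> in B, on all variables if the
  support has several elements and on those outside the support if it has one.\<close>

definition inQ :: "'n set \<times> 'n expo \<Rightarrow> bool"
  where "inQ = (\<lambda>(J, \<beta>). \<beta> \<in> B \<and> \<not> Supp \<beta> \<subseteq> J)"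

definition inE :: "'n set \<times> 'n expo \<Rightarrow> bool"
  where "inE = (\<lambda>(J, \<beta>). \<beta> \<in> B \<and> Supp \<beta> \<subseteq> J \<and> card (Supp \<beta>) > 1)"

definition KX :: "(nat \<times> 'n set) set"
  where "KX = {(s, J). s \<in> {1..r} \<and> J \<inter> Supp (\<alpha> s) = {} \<and> card (Supp (\<alpha> s)) > 1}"

lemma Ksum_keys: "v \<in> Ksum r \<alpha> i \<longleftrightarrow>
    keys v \<subseteq> {(s, J). (s, J) \<in> KX \<and> card J + card (Supp (\<alpha> s)) = i}"
proof -
  have "s \<in> {1..r} \<and> J \<in> K_basis (\<alpha> s) (int i - int (card (Supp (\<alpha> s)))) \<longleftrightarrow>
      (s, J) \<in> KX \<and> card J + card (Supp (\<alpha> s)) = i" for s J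
    by (auto simp: K_basis_def KX_def)
  then show ?thesis
    unfolding Ksum_def mem_Collect_eq subset_eq by (intro ball_cong refl) (auto simp only: split: prod.split)
qed

lemma subspace_Ksum: "fm.subspace (Ksum r \<alpha> i :: ('n, 'k::comm_ring_1) KS set)"
proof (rule fm.subspaceI)
  show "0 \<in> Ksum r \<alpha> i" by (simp add: Ksum_def)
  show "u + v \<in> Ksum r \<alpha> i" if "u \<in> Ksum r \<alpha> i" "v \<in> Ksum r \<alpha> i" for u v :: "('n, 'k) KS"
    using that unfolding Ksum_keys by (rule keys_subset_add)
  show "scale c u \<in> Ksum r \<alpha> i" if "u \<in> Ksum r \<alpha> i" for c and u :: "('n, 'k) KS"
    using that unfolding Ksum_keys by (rule keys_subset_scale)
qed

lemma Ksum_KX: "v \<in> Ksum r \<alpha> i \<Longrightarrow> keys v \<subseteq> KX"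
  by (auto simp: Ksum_keys)

text \<open>A nonzero K-part sits in degree at least the size of a support, hence at least
  2.\<close>

lemma Ksum_1: "v \<in> Ksum r \<alpha> 1 \<Longrightarrow> v = 0"
  by (auto simp: Ksum_keys KX_def simp flip: keys_eq_empty)

lemma Kos_K_Ksum:
  fixes v :: "('n, 'k::comm_ring_1) KS"
  assumes "v \<in> Ksum r \<alpha> (i + 1)"
  shows "Kos_K v \<in> Ksum r \<alpha> i"
  unfolding Ksum_keys Kos_K_def
proof (rule keys_subset_lin_ext)
  show "keys v \<subseteq> {(s, J). (s, J) \<in> KX \<and> card J + card (Supp (\<alpha> s)) = i + 1}"
    using assms by (simp only: Ksum_keys)
  fix b assume "b \<in> {(s, J). (s, J) \<in> KX \<and> card J + card (Supp (\<alpha> s)) = i + 1}"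
  then obtain s J where b: "b = (s, J)" "(s, J) \<in> KX" "card J + card (Supp (\<alpha> s)) = i + 1" by auto
  have "(s, J - {j}) \<in> {(s, J). (s, J) \<in> KX \<and> card J + card (Supp (\<alpha> s)) = i}" if "j \<in> J" for j
  proof -
    have "card J > 0" using that by (auto simp: card_gt_0_iff)
    then show ?thesis using b that by (auto simp: KX_def)
  qed
  then show "keys (case b of (s, J) \<Rightarrow> \<Sum>j\<in>J. scale (sgn_in j J * var j) (single (s, J - {j}) (1 :: ('n, 'k) mpoly)))
      \<subseteq> {(s, J). (s, J) \<in> KX \<and> card J + card (Supp (\<alpha> s)) = i}"
    unfolding b(1) prod.case by (intro keys_subset_sum keys_subset_scale keys_subset_single)
qed

lemma KX_D:
  assumes "(s, J) \<in> KX"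
  shows "\<alpha> s \<in> B" "J \<inter> Supp (\<alpha> s) = {}" "inE (J \<union> Supp (\<alpha> s), \<alpha> s)"
  using assms by (auto simp: KX_def inE_def B_def)

lemma keys_tau:
  fixes v :: "('n, 'k::comm_ring_1) KS"
  assumes "v \<in> Ksum r \<alpha> i"
  shows "keys (tau v) \<subseteq> {(I, \<beta>). inE (I, \<beta>) \<and> card I = i}"
  unfolding tau_def
proof (rule keys_subset_lin_ext)
  show "keys v \<subseteq> {(s, J). (s, J) \<in> KX \<and> card J + card (Supp (\<alpha> s)) = i}"
    using assms by (simp only: Ksum_keys)
  fix b assume "b \<in> {(s, J). (s, J) \<in> KX \<and> card J + card (Supp (\<alpha> s)) = i}"
  then obtain s J where b: "b = (s, J)" "(s, J) \<in> KX" "card J + card (Supp (\<alpha> s)) = i" by auto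
  have "card (J \<union> Supp (\<alpha> s)) = card J + card (Supp (\<alpha> s))"
    using KX_D[OF b(2)] by (intro card_Un_disjoint) auto
  then have "(J \<union> Supp (\<alpha> s), \<alpha> s) \<in> {(I, \<beta>). inE (I, \<beta>) \<and> card I = i}"
    using b KX_D[OF b(2)] by simp
  then show "keys (case b of (s, J) \<Rightarrow> scale (wedge_sgn J (Supp (\<alpha> s)))
      (single (J \<union> Supp (\<alpha> s), \<alpha> s) (1 :: ('n, 'k) mpoly))) \<subseteq> {(I, \<beta>). inE (I, \<beta>) \<and> card I = i}"
    unfolding b(1) prod.case by (intro keys_subset_scale keys_subset_single)
qed

lemma tau_surj:
  fixes z :: "('n, 'k::comm_ring_1) WS"
  assumes "keys z \<subseteq> {(I, \<beta>). inE (I, \<beta>) \<and> card I = i}"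
  shows "\<exists>v\<in>Ksum r \<alpha> i. tau v = z"
  using assms
proof (induction rule: free_module_induct)
  case (basis b)
  then obtain I s where b: "b = (I, \<alpha> s)" "s \<in> {1..r}" "Supp (\<alpha> s) \<subseteq> I" "card (Supp (\<alpha> s)) > 1" "card I = i"
    by (auto simp: inE_def B_def)
  let ?J = "I - Supp (\<alpha> s)"
  have c: "card ?J + card (Supp (\<alpha> s)) = i"
    using b card_mono[of I "Supp (\<alpha> s)"] by (simp add: card_Diff_subset)
  have "single (s, ?J) 1 \<in> (Ksum r \<alpha> i :: ('n, 'k) KS set)"
    unfolding Ksum_keys by (rule keys_subset_single) (use b c in \<open>auto simp: KX_def\<close>)
  moreover have "tau (scale (wedge_sgn ?J (Supp (\<alpha> s))) (single (s, ?J) 1)) = (single b 1 :: ('n, 'k) WS)"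
    using b by (simp add: tau.scale tau_single Un_absorb2)
  ultimately show ?case using fm.subspace_scale[OF subspace_Ksum] by blast
next
  case zero
  show ?case using fm.subspace_0[OF subspace_Ksum] tau.zero by blast
next
  case (add u v)
  then show ?case using fm.subspace_add[OF subspace_Ksum] tau.add by metis
next
  case (scale c u)
  then show ?case using fm.subspace_scale[OF subspace_Ksum] tau.scale by metis
qed

text \<open>The index s is recovered from \<alpha> s by \<open>inj_\<alpha>\<close> and J from J
  \<union> Supp by disjointness, so distinct basis vectors have distinct images up to sign.\<close>

lemma tau_inj:
  fixes v :: "('n, 'k::comm_ring_1) KS"
  assumes "keys v \<subseteq> KX" "tau v = 0"
  shows "v = 0"
proof -
  have "lookup (tau v) (J \<union> Supp (\<alpha> s), \<alpha> s) = wedge_sgn J (Supp (\<alpha> s)) * lookup v (s, J)"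
    if sJ: "(s, J) \<in> KX" for s J
    using assms(1)
  proof (induction rule: free_module_induct)
    case (basis b)
    obtain t I where b: "b = (t, I)" by (cases b)
    have "(I \<union> Supp (\<alpha> t), \<alpha> t) = (J \<union> Supp (\<alpha> s), \<alpha> s) \<longleftrightarrow> (t, I) = (s, J)"
    proof
      assume *: "(I \<union> Supp (\<alpha> t), \<alpha> t) = (J \<union> Supp (\<alpha> s), \<alpha> s)"
      have "t \<in> {1..r}" "s \<in> {1..r}" using basis sJ by (auto simp: KX_def b)
      then have t: "t = s" using inj_onD[OF inj_\<alpha>, of t s] * by simp
      have "I = (I \<union> Supp (\<alpha> s)) - Supp (\<alpha> s)" using KX_D(2)[of t I] basis b t by blast
      also have "\<dots> = (J \<union> Supp (\<alpha> s)) - Supp (\<alpha> s)" using * t by simp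
      also have "\<dots> = J" using KX_D(2)[OF sJ] by blast
      finally show "(t, I) = (s, J)" using t by simp
    qed simp
    then show ?case unfolding b tau_single by (simp add: lookup_scale lookup_single when_def)
  qed (simp_all add: tau.add tau.scale lookup_add lookup_scale algebra_simps)
  then have "wedge_sgn J (Supp (\<alpha> s)) * (wedge_sgn J (Supp (\<alpha> s)) * lookup v (s, J)) = 0"
    if "(s, J) \<in> KX" for s J
    using that assms(2) by (simp add: eq_commute[of 0])
  then have "lookup v (s, J) = 0" if "(s, J) \<in> KX" for s J
    using that by (simp add: mult.assoc[symmetric])
  moreover have "lookup v b = 0" if "b \<notin> KX" for b
    using that assms(1) by (auto simp: in_keys_iff)
  ultimately have "lookup v b = 0" for b by (cases b) blast
  then show ?thesis by (intro poly_mapping_eqI) simp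
qed

section \<open>The Koszul differential on the coordinates over B\<close>

lemma inQ_inE: "inQ b \<Longrightarrow> \<not> inE b"
  by (auto simp: inQ_def inE_def)

lemma keys_Kos_Q: "keys z \<subseteq> Collect inQ \<Longrightarrow> keys (Kos_tensor z) \<subseteq> Collect inQ"
  by (erule keys_Kos) (auto simp: inQ_def)

lemma Kos_E_split:
  assumes "keys z \<subseteq> Collect inE"
  shows "Kos_tensor z = restr inQ (Kos_tensor z) + restr inE (Kos_tensor z)"
proof (rule restr_split)
  show "keys (Kos_tensor z) \<subseteq> {b. inQ b \<or> inE b}"
    by (rule keys_Kos[OF assms]) (auto simp: inQ_def inE_def)
qed (rule inQ_inE)

lemma piB_Kos: "piB (Kos_tensor u) = Kos_tensor (piB u :: ('n, 'k::comm_ring_1) WS)"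
proof -
  have "keys u \<subseteq> UNIV" by simp
  then show ?thesis
  proof (induction rule: free_module_induct)
    case (basis b)
    then show ?case by (cases b) (simp add: Kos_single piB_single piB.sum piB.scale)
  qed (simp_all add: Kos.add Kos.scale piB.add piB.scale)
qed

text \<open>Over B, the summand of \<open>kappa (nu z)\<close> that lowers \<beta> at k leaves
  exactly the Koszul term that removes k. So \<open>kappa\<close> after \<open>nu\<close> lifts the
  connecting map from E to Q into \<open>L\<close>.\<close>

lemma piB_kappa_nu:
  fixes z :: "('n, 'k::comm_ring_1) WS"
  assumes "keys z \<subseteq> Collect inE"
  shows "piB (kappa (nu z)) = restr inQ (Kos_tensor z)"
  using assms
proof (induction rule: free_module_induct)
  case (basis b)
  then obtain I \<beta> where b: "b = (I, \<beta>)" "\<beta> \<in> B" "Supp \<beta> \<subseteq> I" by (cases b) (auto simp: inE_def)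
  have "piB (kappa (nu (single b 1))) = (\<Sum>k\<in>Supp \<beta>. scale (var k) (piB (Lsym I (\<beta> - \<epsilon> k)) :: ('n, 'k) WS))"
    by (simp add: b(1) nu_single kappa.sum kappa.scale piB.sum piB.scale Lsym_def)
  also have "\<dots> = (\<Sum>k\<in>Supp \<beta>. scale (sgn_in k I * var k) (single (I - {k}, \<beta>) 1))"
  proof (intro sum.cong refl)
    fix k assume k: "k \<in> Supp \<beta>"
    then have I: "insert k (I - {k}) = I" using b by auto
    have "piB (Lsym I (\<beta> - \<epsilon> k)) = scale (sgn_in k I) (single (I - {k}, \<beta>) 1 :: ('n, 'k) WS)"
      using piB_Lsym_hit[OF b(2) k, of "I - {k}", where ?'k = 'k] unfolding I by simp
    then show "scale (var k) (piB (Lsym I (\<beta> - \<epsilon> k))) = scale (sgn_in k I * var k) (single (I - {k}, \<beta>) 1 :: ('n, 'k) WS)"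
      by (simp add: mult.commute)
  qed
  also have "\<dots> = (\<Sum>k\<in>I. if k \<in> Supp \<beta> then scale (sgn_in k I * var k) (single (I - {k}, \<beta>) 1) else 0)"
    using b by (simp add: sum.inter_restrict[symmetric] Int_absorb1)
  also have "\<dots> = restr inQ (Kos_tensor (single b 1))"
    unfolding b(1) Kos_single restr.sum restr.scale restr_single
    by (intro sum.cong refl) (use b in \<open>auto simp: inQ_def\<close>)
  finally show ?case .
qed (simp_all add: Kos.add Kos.scale piB.add piB.scale restr.add restr.scale kappa.add kappa.scale nu.add nu.scale)

text \<open>
  For \<open>k \<in> Supp \<beta>\<close> the only \<open>E\<close>-basis vector whose Koszul image involves \<open>e\<^bsub>I - k\<^esub> \<otimes> e\<^sup>\<beta>\<close> is
  \<open>e\<^sub>I \<otimes> e\<^sup>\<beta>\<close>.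
\<close>

lemma restr_Kos_inj:
  fixes z :: "('n, 'k::field) WS"
  assumes E: "keys z \<subseteq> Collect inE" and 0: "restr inQ (Kos_tensor z) = 0"
  shows "z = 0"
proof (rule ccontr)
  assume "z \<noteq> 0"
  then have "keys z \<noteq> {}" by simp
  then obtain b where "b \<in> keys z" by blast
  then obtain I \<beta> where I: "(I, \<beta>) \<in> keys z" by (cases b) simp
  then have b: "\<beta> \<in> B" "Supp \<beta> \<subseteq> I" "card (Supp \<beta>) > 1" using E by (auto simp: inE_def)
  then obtain k where k: "k \<in> Supp \<beta>" by fastforce
  have "lookup (Kos_tensor z) (I - {k}, \<beta>) = sgn_in k I * var k * lookup z (I, \<beta>)"
    using E
  proof (induction rule: free_module_induct)
    case (basis c)
    obtain I' \<beta>' where c: "c = (I', \<beta>')" by (cases c)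
    have *: "(I' - {a}, \<beta>') = (I - {k}, \<beta>) \<longleftrightarrow> a = k \<and> (I', \<beta>') = (I, \<beta>)" if "a \<in> I'" for a
    proof
      assume eq: "(I' - {a}, \<beta>') = (I - {k}, \<beta>)"
      then have "k \<in> I'" "k \<in> I" using basis k b by (auto simp: c inE_def)
      moreover have "k \<notin> I' - {a}" using eq by simp
      ultimately have "a = k" by blast
      then have "insert k (I' - {k}) = insert k (I - {k})" using eq by simp
      then show "a = k \<and> (I', \<beta>') = (I, \<beta>)"
        using eq \<open>a = k\<close> \<open>k \<in> I'\<close> \<open>k \<in> I\<close> by (simp add: insert_absorb)
    qed simp
    have "lookup (Kos_tensor (single c 1)) (I - {k}, \<beta>) =
        (\<Sum>a\<in>I'. if a = k then (if (I', \<beta>') = (I, \<beta>) then sgn_in a I' * var a else 0) else (0 :: ('n, 'k) mpoly))"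
      unfolding c Kos_single lookup_sum lookup_scale lookup_single when_def
      by (intro sum.cong refl) (simp only: *, simp)
    also have "\<dots> = sgn_in k I * var k * lookup (single c 1) (I, \<beta>)"
    proof (cases "(I', \<beta>') = (I, \<beta>)")
      case True
      then have "k \<in> I'" using b k by auto
      then show ?thesis using True by (simp add: c)
    next
      case False
      then have "lookup (single c 1) (I, \<beta>) = (0 :: ('n, 'k) mpoly)"
        unfolding c by (rule lookup_single_not_eq)
      then show ?thesis by (simp only: False if_False if_cancel sum.neutral_const mult_zero_right)
    qed
    finally show ?case .
  qed (simp_all add: Kos.add Kos.scale lookup_add lookup_scale algebra_simps)
  moreover have "lookup (restr inQ (Kos_tensor z)) (I - {k}, \<beta>) = lookup (Kos_tensor z) (I - {k}, \<beta>)"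
    using b k by (auto simp: lookup_restr inQ_def)
  ultimately have *: "sgn_in k I * (var k * lookup z (I, \<beta>)) = 0" by (simp add: 0 mult.assoc)
  have "sgn_in k I * (sgn_in k I * (var k * lookup z (I, \<beta>))) = 0" by (simp only: * mult_zero_right)
  then have "var k * lookup z (I, \<beta>) = 0" by (simp only: sgn_in_sq')
  \<comment> \<open>Over a field R has no zero divisors, so x_k can be cancelled.\<close>
  moreover have "var k \<noteq> (0 :: ('n, 'k) mpoly)"
    by (simp add: var_def monom_def flip: keys_eq_empty)
  ultimately show False using I by (simp add: in_keys_iff)
qed

text \<open>Removing an element of the support leaves E, so only the elements of J contribute; the
  signs agree by \<open>wedge_sgn_remove\<close>.\<close>

lemma tau_Kos_K:
  fixes v :: "('n, 'k::comm_ring_1) KS"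
  assumes "keys v \<subseteq> KX"
  shows "tau (Kos_K v) = restr inE (Kos_tensor (tau v))"
  using assms
proof (induction rule: free_module_induct)
  case (basis b)
  then obtain s J where b: "b = (s, J)" "(s, J) \<in> KX" by (cases b) auto
  let ?S = "Supp (\<alpha> s)"
  have S: "J \<inter> ?S = {}" "\<alpha> s \<in> B" "card ?S > 1" using KX_D[OF b(2)] by (auto simp: inE_def)
  have "restr inE (Kos_tensor (tau (single b 1))) = (\<Sum>a\<in>J \<union> ?S. scale (wedge_sgn J ?S * sgn_in a (J \<union> ?S) * var a)
      (restr inE (single ((J \<union> ?S) - {a}, \<alpha> s) 1) :: ('n, 'k) WS))"
    by (simp add: b(1) tau_single Kos.scale Kos_single restr.scale restr.sum fm.scale_sum_right mult.assoc)
  also have "\<dots> = (\<Sum>a\<in>J. scale (wedge_sgn J ?S * sgn_in a (J \<union> ?S) * var a)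
      (restr inE (single ((J \<union> ?S) - {a}, \<alpha> s) 1)))"
    by (rule sum.mono_neutral_right) (auto simp: restr_single inE_def)
  also have "\<dots> = (\<Sum>a\<in>J. scale (sgn_in a J * var a) (scale (wedge_sgn (J - {a}) ?S)
      (single ((J - {a}) \<union> ?S, \<alpha> s) 1)))"
  proof (intro sum.cong refl)
    fix a assume a: "a \<in> J"
    have "(J \<union> ?S) - {a} = (J - {a}) \<union> ?S" using S a by auto
    moreover have "inE ((J - {a}) \<union> ?S, \<alpha> s)" using S by (simp add: inE_def)
    ultimately show "scale (wedge_sgn J ?S * sgn_in a (J \<union> ?S) * var a)
        (restr inE (single ((J \<union> ?S) - {a}, \<alpha> s) 1)) = scale (sgn_in a J * var a) (scale (wedge_sgn (J - {a}) ?S)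
        (single ((J - {a}) \<union> ?S, \<alpha> s) 1 :: ('n, 'k) WS))"
      by (simp add: restr_single wedge_sgn_remove[OF a S(1)] ac_simps)
  qed
  also have "\<dots> = tau (Kos_K (single b 1))"
    by (simp add: b(1) Kos_K_single tau.sum tau.scale tau_single)
  finally show ?case ..
qed (simp_all add: Kos.add Kos.scale restr.add restr.scale tau.add tau.scale Kos_K.add Kos_K.scale)

text \<open>The Q-part of Kos removes some l of the support, and \<open>nu\<close> lowers the
  exponent at some k: l = k gives the squares, l \<noteq> k the mixed terms. This closed form
  replaces the explicit formula from here on.\<close>

lemma Theta_eq:
  fixes v :: "('n, 'k::comm_ring_1) KS"
  assumes "keys v \<subseteq> KX"
  shows "Theta \<alpha> v = kappa (nu (restr inQ (Kos_tensor (tau v))))"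
  using assms
proof (induction rule: free_module_induct)
  case (basis b)
  then obtain s J where b: "b = (s, J)" "(s, J) \<in> KX" by (cases b) auto
  let ?S = "Supp (\<alpha> s)"
  have S: "J \<inter> ?S = {}" "\<alpha> s \<in> B" "card ?S > 1" using KX_D[OF b(2)] by (auto simp: inE_def)
  let ?g = "\<lambda>l k. scale (sgn_in l (?S \<union> J) * var l * var k) (Lsym ((?S - {l}) \<union> J) (\<alpha> s - \<epsilon> k)) :: ('n, 'k) WS"
  have "restr inQ (Kos_tensor (tau (single b 1))) = scale (wedge_sgn J ?S) (\<Sum>a\<in>J \<union> ?S. scale (sgn_in a (J \<union> ?S) * var a)
      (restr inQ (single ((J \<union> ?S) - {a}, \<alpha> s) 1) :: ('n, 'k) WS))"
    by (simp add: b(1) tau_single Kos.scale Kos_single restr.scale restr.sum)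
  also have "(\<Sum>a\<in>J \<union> ?S. scale (sgn_in a (J \<union> ?S) * var a) (restr inQ (single ((J \<union> ?S) - {a}, \<alpha> s) 1))) =
      (\<Sum>a\<in>?S. scale (sgn_in a (J \<union> ?S) * var a) (restr inQ (single ((J \<union> ?S) - {a}, \<alpha> s) 1) :: ('n, 'k) WS))"
    by (rule sum.mono_neutral_right) (use S in \<open>auto simp: restr_single inQ_def\<close>)
  also have "\<dots> = (\<Sum>a\<in>?S. scale (sgn_in a (?S \<union> J) * var a) (single ((?S - {a}) \<union> J, \<alpha> s) 1))"
  proof (intro sum.cong refl)
    fix a assume a: "a \<in> ?S"
    have "(J \<union> ?S) - {a} = (?S - {a}) \<union> J" using S a by auto
    moreover have "inQ ((?S - {a}) \<union> J, \<alpha> s)" using S a by (auto simp: inQ_def)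
    ultimately show "scale (sgn_in a (J \<union> ?S) * var a) (restr inQ (single ((J \<union> ?S) - {a}, \<alpha> s) 1)) =
        scale (sgn_in a (?S \<union> J) * var a) (single ((?S - {a}) \<union> J, \<alpha> s) 1 :: ('n, 'k) WS)"
      by (simp add: restr_single Un_commute)
  qed
  finally have "kappa (nu (restr inQ (Kos_tensor (tau (single b 1))))) =
      scale (wedge_sgn J ?S) (\<Sum>l\<in>?S. \<Sum>k\<in>?S. ?g l k)"
    by (simp add: nu.scale nu.sum nu_single kappa.scale kappa.sum fm.scale_sum_right Lsym_def mult.assoc)
  also have "(\<Sum>l\<in>?S. \<Sum>k\<in>?S. ?g l k) =
      (\<Sum>k\<in>?S. ?g k k) + (\<Sum>(k, l)\<in>{(k, l). k \<in> ?S \<and> l \<in> ?S \<and> k < l}. ?g l k + ?g k l)"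
    by (rule double_sum_split)
  also have "scale (wedge_sgn J ?S) \<dots> = Theta_basis (\<alpha> s) J"
    unfolding Theta_basis_def Let_def
    by (simp add: fm.scale_right_distrib power2_eq_square ac_simps)
  also have "\<dots> = Theta \<alpha> (single b 1)"
    by (simp add: Theta_def lin_ext_single b(1))
  finally show ?case ..
qed (simp_all add: Kos.add Kos.scale restr.add restr.scale tau.add tau.scale Theta.add Theta.scale
  kappa.add kappa.scale nu.add nu.scale)

lemma lam_diff: "lam (v - w) = lam v - lam w"
  by (simp add: lam_def tau.diff nu.diff kappa.diff)

lemma lam_neg: "lam (- v) = - lam v"
  by (simp add: lam_def tau.neg nu.neg kappa.neg)

lemma keys_tau_E: "v \<in> Ksum r \<alpha> i \<Longrightarrow> keys (tau v) \<subseteq> Collect inE"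
  using keys_tau[of v i] by auto

text \<open>Kos anticommutes with \<open>kappa\<close> and commutes with \<open>nu\<close>. The
  Q-part of Kos (tau v) then yields Theta, and its E-part yields
  \<open>lam (Kos_K v)\<close>.\<close>

lemma Kos_lam:
  assumes "v \<in> Ksum r \<alpha> i"
  shows "Kos_tensor (lam v) = - Theta \<alpha> v - lam (Kos_K v)"
proof -
  have "Kos_tensor (lam v) = - kappa (nu (Kos_tensor (tau v)))"
    by (simp add: lam_def Kos_kappa Kos_nu)
  also have "\<dots> = - kappa (nu (restr inQ (Kos_tensor (tau v)) + restr inE (Kos_tensor (tau v))))"
    by (subst Kos_E_split[OF keys_tau_E[OF assms]]) (rule refl)
  finally show ?thesis
    using Ksum_KX[OF assms] by (simp add: nu.add kappa.add Theta_eq lam_def tau_Kos_K)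
qed

lemma lam_L:
  assumes "v \<in> Ksum r \<alpha> (j + 1)"
  shows "lam v \<in> L d j"
proof -
  have "tau v \<in> wedge_sym (j + 1) (d - 1 + 1)"
    using keys_tau[OF assms] by (auto simp: wedge_sym_keys inE_def deg_B)
  from L_kappa[OF nu_wedge_sym[OF this]] show ?thesis by (simp add: lam_def)
qed

lemma piB_lam: "v \<in> Ksum r \<alpha> i \<Longrightarrow> piB (lam v) = restr inQ (Kos_tensor (tau v))"
  unfolding lam_def by (intro piB_kappa_nu keys_tau_E)

lemma lam_inj:
  fixes v :: "('n, 'k::field) KS"
  assumes "v \<in> Ksum r \<alpha> i" "piB (lam v) = 0"
  shows "v = 0"
  using assms restr_Kos_inj[OF keys_tau_E[OF assms(1)]] tau_inj[OF Ksum_KX] by (simp add: piB_lam)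

text \<open>The B-part of Theta v is minus the Q-part of Kos (Kos (tau v)), hence 0.\<close>

lemma Theta_M:
  fixes v :: "('n, 'k::comm_ring_1) KS"
  assumes v: "v \<in> Ksum r \<alpha> (j + 1 + 1)"
  shows "Theta \<alpha> v \<in> M j"
proof -
  have T: "Theta \<alpha> v = - Kos_tensor (lam v) - lam (Kos_K v)" using Kos_lam[OF v] by simp
  have Kv: "Kos_K v \<in> Ksum r \<alpha> (j + 1)" by (rule Kos_K_Ksum[OF v])
  have "Theta \<alpha> v \<in> L d j"
    unfolding T by (intro fm.subspace_diff[OF subspace_L] fm.subspace_neg[OF subspace_L] Kos_L lam_L v Kv)
  moreover have "piB (Theta \<alpha> v) = 0"
  proof -
    let ?q = "restr inQ (Kos_tensor (tau v))" and ?e = "restr inE (Kos_tensor (tau v))"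
    have "0 = Kos_tensor (Kos_tensor (tau v))" by (simp add: Kos_Kos)
    also have "\<dots> = Kos_tensor (?q + ?e)"
      by (subst Kos_E_split[OF keys_tau_E[OF v]]) (rule refl)
    finally have "restr inQ (Kos_tensor (?q + ?e)) = 0" by (simp add: restr.zero)
    moreover have "restr inQ (Kos_tensor ?q) = Kos_tensor ?q"
    proof (rule restr_id)
      have "keys ?q \<subseteq> Collect inQ" by (auto simp: keys_restr)
      from keys_Kos_Q[OF this] show "keys (Kos_tensor ?q) \<subseteq> {b. inQ b}" by simp
    qed
    ultimately have "Kos_tensor ?q + restr inQ (Kos_tensor ?e) = 0"
      by (simp add: Kos.add restr.add)
    moreover have "piB (Theta \<alpha> v) = - (Kos_tensor ?q + restr inQ (Kos_tensor ?e))"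
      unfolding T
      by (simp add: piB.diff piB.neg piB_Kos piB_lam[OF v] piB_lam[OF Kv] tau_Kos_K[OF Ksum_KX[OF v]])
    ultimately show ?thesis by simp
  qed
  ultimately show ?thesis by (simp add: M_def)
qed

lemma Kos_M: "u \<in> M (j + 1) \<Longrightarrow> Kos_tensor u \<in> M j"
  by (simp add: M_def Kos_L piB_Kos)

text \<open>
  If \<open>\<alpha>\<^sup>s\<close> has a single support element \<open>k\<close>, the chains on \<open>e\<^sub>J \<otimes> e\<^bsup>\<alpha>\<^sup>s\<^esup>\<close> with \<open>k \<notin> J\<close> form a Koszul complex
  in the remaining variables; hence the choice of \<open>?T\<close> below.
\<close>

lemma subcomplex_exact:
  fixes u z :: "('n, 'k::field) WS"
  assumes u: "u \<in> L d j" "Kos_tensor u = 0" "j = 0 \<Longrightarrow> S_psi u = 0"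
    and z: "keys z \<subseteq> {(I, \<beta>). inE (I, \<beta>) \<and> card I = j + 1}"
    and uz: "piB u = restr inQ (Kos_tensor z)"
  obtains w y where "w \<in> L d (j + 1)" "Kos_tensor w = u"
    "keys y \<subseteq> {(I, \<beta>). inE (I, \<beta>) \<and> card I = j + 1 + 1}" "piB w = restr inQ (Kos_tensor y)"
proof -
  obtain w where w: "w \<in> L d (j + 1)" "Kos_tensor w = u" using L_exact[OF u] by auto
  have zE: "keys z \<subseteq> Collect inE" using z by auto
  have pw: "keys (piB w) \<subseteq> {(J, \<beta>). inQ (J, \<beta>) \<and> card J = j + 1}"
    using keys_piB_L[OF w(1)] by (auto simp: inQ_def)
  let ?q = "restr inQ (Kos_tensor z)" and ?e = "restr inE (Kos_tensor z)"
  have q: "Kos_tensor (piB w) = ?q" using w(2) uz by (simp flip: piB_Kos)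
  have "Kos_tensor (?q + ?e) = 0"
    by (subst Kos_E_split[OF zE, symmetric]) (rule Kos_Kos)
  then have "Kos_tensor ?e = 0" by (simp add: Kos.add Kos_Kos flip: q)
  then have "restr inQ (Kos_tensor ?e) = 0" by (simp add: restr.zero)
  moreover have "keys ?e \<subseteq> Collect inE" by (auto simp: keys_restr)
  \<comment> \<open>So \<open>Kos_tensor z\<close> has only a Q-part, which equals that of Kos (piB
    w), and \<open>piB w - z\<close> becomes a Koszul cycle.\<close>
  ultimately have "?e = 0" by (rule restr_Kos_inj[rotated])
  then have "Kos_tensor (piB w - z) = 0"
    using Kos_E_split[OF zE] q by (simp add: Kos.diff)
  moreover define T :: "'n expo \<Rightarrow> 'n set" where "T = (\<lambda>\<beta>. if card (Supp \<beta>) > 1 then UNIV else - Supp \<beta>)"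
  have "keys (piB w - z) \<subseteq> {(A, \<beta>). A \<subseteq> T \<beta> \<and> card A = j + 1 \<and> \<beta> \<in> B}"
  proof (rule keys_subset_minus)
    show "keys (piB w) \<subseteq> {(A, \<beta>). A \<subseteq> T \<beta> \<and> card A = j + 1 \<and> \<beta> \<in> B}"
    proof
      fix b assume "b \<in> keys (piB w)"
      then have "b \<in> {(J, \<beta>). inQ (J, \<beta>) \<and> card J = j + 1}" using pw by blast
      then obtain J \<beta> where b: "b = (J, \<beta>)" "\<beta> \<in> B" "\<not> Supp \<beta> \<subseteq> J" "card J = j + 1"
        by (cases b) (simp add: inQ_def)
      have "J \<subseteq> - Supp \<beta>" if "\<not> card (Supp \<beta>) > 1"
      proof -
        obtain k where k: "k \<in> Supp \<beta>" "k \<notin> J" using b by auto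
        have "Supp \<beta> = {k}" using k that card_le_Suc0_iff_eq[of "Supp \<beta>"] by (auto simp: One_nat_def)
        then show ?thesis using k by auto
      qed
      then show "b \<in> {(A, \<beta>). A \<subseteq> T \<beta> \<and> card A = j + 1 \<and> \<beta> \<in> B}" using b by (auto simp: T_def)
    qed
    show "keys z \<subseteq> {(A, \<beta>). A \<subseteq> T \<beta> \<and> card A = j + 1 \<and> \<beta> \<in> B}"
      using z by (auto simp: inE_def T_def)
  qed
  ultimately obtain x where x: "Kos_tensor x = piB w - z"
    "keys x \<subseteq> {(A, \<beta>). A \<subseteq> T \<beta> \<and> card A = j + 1 + 1 \<and> \<beta> \<in> B}"
    by (rule Koszul_exact) auto
  have "inQ b \<or> inE b" if b: "b \<in> keys x" for b
  proof -
    obtain A \<beta> where A: "b = (A, \<beta>)" "A \<subseteq> T \<beta>" "\<beta> \<in> B" using b x(2) by auto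
    have "Supp \<beta> \<noteq> {}"
    proof
      assume "Supp \<beta> = {}"
      then have "expo_deg \<beta> = 0" by (simp add: expo_deg_eq_0)
      then show False using deg_B[OF A(3)] d_pos by simp
    qed
    then obtain k where "k \<in> Supp \<beta>" by blast
    then show ?thesis using A by (auto simp: inQ_def inE_def T_def split: if_splits)
  qed
  then have sx: "x = restr inQ x + restr inE x" (is "_ = ?xQ + ?xE")
    by (intro restr_split inQ_inE) auto
  have xQ: "keys ?xQ \<subseteq> {(J, \<beta>). \<beta> \<in> B \<and> \<not> Supp \<beta> \<subseteq> J \<and> card J = j + 1 + 1}"
    using x(2) by (auto simp: keys_restr inQ_def)
  \<comment> \<open>As \<open>piB w\<close> lies in Q and \<open>z\<close> in E, taking Q-parts of
    Kos x discards \<open>z\<close>.\<close>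
  have "piB w = restr inQ (piB w - z)"
    using pw zE inQ_inE by (subst restr.diff, subst restr_id, blast, subst restr_eq_0) auto
  also have "\<dots> = restr inQ (Kos_tensor (?xQ + ?xE))" by (simp only: x(1)[symmetric] sx[symmetric])
  also have "\<dots> = Kos_tensor ?xQ + restr inQ (Kos_tensor ?xE)"
  proof -
    have "restr inQ (Kos_tensor ?xQ) = Kos_tensor ?xQ"
    proof (rule restr_id)
      have "keys ?xQ \<subseteq> Collect inQ" by (auto simp: keys_restr)
      from keys_Kos_Q[OF this] show "keys (Kos_tensor ?xQ) \<subseteq> {b. inQ b}" by simp
    qed
    then show ?thesis by (simp add: Kos.add restr.add)
  qed
  finally have pw': "piB w = Kos_tensor ?xQ + restr inQ (Kos_tensor ?xE)" .
  \<comment> \<open>Lifting \<open>?xQ\<close> to \<open>L\<close> gives the correction: subtracting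
    Kos of the lift does not change Kos w, and it reduces the B-part of w to the contribution of
    \<open>?xE\<close>.\<close>
  let ?l = "kappa (sec ?xQ)"
  have "keys (sec ?xQ) \<subseteq> std (j + 1 + 1)" using keys_sec[OF xQ] by auto
  from L_kappa[OF std_wedge_sym[OF this]] have l: "?l \<in> L d (j + 1 + 1)" by simp
  have pl: "piB ?l = ?xQ" by (rule piB_kappa_sec) (use xQ in auto)
  show ?thesis
  proof
    show "w - Kos_tensor ?l \<in> L d (j + 1)"
      by (intro fm.subspace_diff[OF subspace_L] w Kos_L l)
    show "Kos_tensor (w - Kos_tensor ?l) = u" using w by (simp add: Kos.diff Kos_Kos)
    show "keys ?xE \<subseteq> {(I, \<beta>). inE (I, \<beta>) \<and> card I = j + 1 + 1}"
      using x(2) by (auto simp: keys_restr)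
    show "piB (w - Kos_tensor ?l) = restr inQ (Kos_tensor ?xE)"
      by (simp add: piB.diff piB_Kos pl pw')
  qed
qed

text \<open>A preimage w of u - lam v is taken in \<open>L\<close>. Its B-part determines v', and
  adding lam v' moves w into \<open>M\<close>. The resulting pair has a boundary with the same image
  in \<open>L\<close> as (u, v), so injectivity of the embedding gives equality.\<close>

lemma complex_exact:
  fixes u :: "('n, 'k::field) WS"
  assumes u: "u \<in> M j" and v: "v \<in> Ksum r \<alpha> (j + 1)"
    and cycle: "Kos_tensor (u - lam v) = 0" "j = 0 \<Longrightarrow> S_psi (u - lam v) = 0"
  obtains u' v' where "u' \<in> M (j + 1)" "v' \<in> Ksum r \<alpha> (j + 1 + 1)"
    "Kos_tensor u' + Theta \<alpha> v' = u" "- Kos_K v' = v"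
proof -
  have uL: "u \<in> L d j" "piB u = 0" using u by (auto simp: M_def)
  obtain w y where w: "w \<in> L d (j + 1)" "Kos_tensor w = u - lam v"
    "keys y \<subseteq> {(I, \<beta>). inE (I, \<beta>) \<and> card I = j + 1 + 1}" "piB w = restr inQ (Kos_tensor y)"
  proof (rule subcomplex_exact)
    show "u - lam v \<in> L d j" by (intro fm.subspace_diff[OF subspace_L] uL lam_L v)
    show "keys (tau (- v)) \<subseteq> {(I, \<beta>). inE (I, \<beta>) \<and> card I = j + 1}"
      by (intro keys_tau fm.subspace_neg[OF subspace_Ksum] v)
    show "piB (u - lam v) = restr inQ (Kos_tensor (tau (- v)))"
      by (simp add: piB.diff uL piB_lam[OF v] tau.neg Kos.neg restr.neg)
  qed (use cycle in auto)
  have "keys (- y) \<subseteq> {(I, \<beta>). inE (I, \<beta>) \<and> card I = j + 1 + 1}"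
    using keys_subset_minus[of 0 _ y] w(3) by simp
  then obtain v' where v': "v' \<in> Ksum r \<alpha> (j + 1 + 1)" "tau v' = - y" using tau_surj by blast
  define u' where "u' = w + lam v'"
  have "u' \<in> L d (j + 1)"
    unfolding u'_def by (intro fm.subspace_add[OF subspace_L] w lam_L v')
  then have u': "u' \<in> M (j + 1)"
    by (simp add: M_def u'_def piB.add w(4) piB_lam[OF v'(1)] v'(2) Kos.neg restr.neg)
  define u1 where "u1 = Kos_tensor u' + Theta \<alpha> v'"
  define v1 where "v1 = - Kos_K v'"
  have u1: "u1 \<in> M j"
    unfolding u1_def by (intro fm.subspace_add[OF subspace_M] Kos_M u' Theta_M v')
  have v1: "v1 \<in> Ksum r \<alpha> (j + 1)"
    unfolding v1_def by (intro fm.subspace_neg[OF subspace_Ksum] Kos_K_Ksum v')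
  have "u1 - lam v1 = u - lam v"
    by (simp add: u1_def v1_def u'_def Kos.add w(2) Kos_lam[OF v'(1)] lam_neg)
  then have e: "lam (v1 - v) = u1 - u" by (simp add: lam_diff algebra_simps)
  moreover have "piB (u1 - u) = 0" using u u1 by (simp add: M_def piB.diff)
  ultimately have "v1 - v = 0"
    by (intro lam_inj[of _ "j + 1"] fm.subspace_diff[OF subspace_Ksum] v v1) simp
  then have "v1 = v" "u1 = u" using e by (simp_all add: lam_def tau.zero nu.zero kappa.zero)
  then show ?thesis using that[OF u' v'(1)] by (simp add: u1_def v1_def)
qed


section \<open>The minimal free resolution\<close>

lemma hom_coeffs_tau: "hom_coeffs i v \<Longrightarrow> hom_coeffs i (tau v)"
  unfolding tau_def
  by (erule hom_coeffs_lin_ext_0)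
    (auto intro!: hom_coeffs_scale_single homogeneous_wedge_sgn split: prod.split)

lemma hom_coeffs_sec: "hom_coeffs i v \<Longrightarrow> hom_coeffs i (sec v)"
  unfolding sec_def
  by (erule hom_coeffs_lin_ext_0)
    (auto intro!: hom_coeffs_scale_single homogeneous_sgn_in simp: hom_coeffs_0 Let_def split: prod.split)

lemma hom_coeffs_piB: "hom_coeffs i u \<Longrightarrow> hom_coeffs i (piB u)"
  by (simp add: piB_def hom_coeffs_restr)

lemma hom_coeffs_gen: "hom_coeffs 0 (gen n :: ('n, 'k::comm_ring_1) WS)"
proof -
  have "hom_coeffs 0 (kappa (single n 1) + - kappa (sec (piB (kappa (single n 1)))) :: ('n, 'k) WS)"
    by (intro hom_coeffs_add hom_coeffs_uminus hom_coeffs_kappa hom_coeffs_sec hom_coeffs_piB hom_coeffs_single)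
  then show ?thesis by (simp add: gen_def projM_def)
qed

lemma hom_coeffs_Theta:
  assumes "keys v \<subseteq> KX" "hom_coeffs i v"
  shows "hom_coeffs (i + 2) (Theta \<alpha> v)"
proof -
  have "hom_coeffs (i + 1 + 1) (Theta \<alpha> v)"
    unfolding Theta_eq[OF assms(1)]
    by (intro hom_coeffs_kappa hom_coeffs_nu hom_coeffs_restr hom_coeffs_Kos hom_coeffs_tau assms)
  then show ?thesis by (simp add: add.assoc)
qed

lemma max_coeffs_Theta: "keys v \<subseteq> KX \<Longrightarrow> max_coeffs (Theta \<alpha> v)"
  by (simp add: Theta_eq max_coeffs_kappa max_coeffs_nu)

lemma keys_M_0:
  assumes "u \<in> M 0" "(A, \<beta>) \<in> keys u"
  shows "A = {}" "expo_deg \<beta> = d" "\<beta> \<notin> B"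
proof -
  have "u \<in> wedge_sym 0 d" and 0: "lookup (piB u) (A, \<beta>) = 0" using assms by (auto simp: M_def L_def)
  then have "(A, \<beta>) \<in> {(A, \<beta>). card A = 0 \<and> expo_deg \<beta> = d}"
    using assms(2) unfolding wedge_sym_keys by blast
  then show "A = {}" "expo_deg \<beta> = d" by simp_all
  show "\<beta> \<notin> B" using 0 assms(2) by (simp add: piB_def lookup_restr in_keys_iff split: if_splits)
qed

text \<open>In exterior degree 0 the kernel condition is void, so \<open>M 0\<close> is spanned by
  the e_\<emptyset> \<otimes> e^\<beta> with \<beta> of degree d outside B.\<close>

lemma S_psi_M_0: "S_psi ` M 0 = (K' d B :: ('n, 'k::comm_ring_1) mpoly set)"
proof
  let ?G = "{monom \<beta> |\<beta>. expo_deg \<beta> = d \<and> \<beta> \<notin> B} :: ('n, 'k) mpoly set"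
  show "S_psi ` M 0 \<subseteq> (K' d B :: ('n, 'k) mpoly set)"
  proof
    fix p :: "('n, 'k) mpoly" assume "p \<in> S_psi ` M 0"
    then obtain u :: "('n, 'k) WS" where u: "u \<in> M 0" "p = S_psi u" by auto
    have "lookup u b * (if fst b = {} then monom (snd b) else 0) \<in> ideal ?G" if "b \<in> keys u" for b
    proof -
      have "(fst b, snd b) \<in> keys u" using that by simp
      note b = keys_M_0[OF u(1) this]
      have "monom (snd b) \<in> ?G" using b by blast
      then show ?thesis
        unfolding b(1) by (simp only: simp_thms if_True)
          (intro module.span_scale[OF module_ring] module.span_base[OF module_ring])
    qed
    then show "p \<in> K' d B"
      unfolding u(2) S_psi_def K'_def split_def prod.collapse by (rule module.span_sum[OF module_ring])
  qed
  have "?G \<subseteq> S_psi ` M 0"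
  proof
    fix p :: "('n, 'k) mpoly" assume "p \<in> ?G"
    then obtain \<beta> where b: "p = monom \<beta>" "expo_deg \<beta> = d" "\<beta> \<notin> B" by auto
    have "single ({}, \<beta>) 1 \<in> (M 0 :: ('n, 'k) WS set)"
      using b by (simp add: M_def L_def kappa_single wedge_sym_def piB_single)
    moreover have "p = S_psi (single ({}, \<beta>) 1)" by (simp add: S_psi_single b)
    ultimately show "p \<in> S_psi ` M 0" by blast
  qed
  moreover have "module.subspace (*) (S_psi ` M 0 :: ('n, 'k) mpoly set)"
  proof (rule module.subspaceI[OF module_ring])
    show "0 \<in> S_psi ` (M 0 :: ('n, 'k) WS set)"
      using fm.subspace_0[OF subspace_M] S_psi_0 by (metis image_eqI)
    show "x + y \<in> S_psi ` (M 0 :: ('n, 'k) WS set)"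
      if "x \<in> S_psi ` (M 0 :: ('n, 'k) WS set)" "y \<in> S_psi ` (M 0 :: ('n, 'k) WS set)" for x y
      using that by (auto simp flip: S_psi_add intro!: imageI fm.subspace_add[OF subspace_M])
    show "c * x \<in> S_psi ` (M 0 :: ('n, 'k) WS set)" if "x \<in> S_psi ` (M 0 :: ('n, 'k) WS set)" for c x
      using that by (auto simp flip: S_psi_scale intro!: imageI fm.subspace_scale[OF subspace_M])
  qed
  ultimately show "K' d B \<subseteq> (S_psi ` M 0 :: ('n, 'k) mpoly set)"
    unfolding K'_def by (rule module.span_minimal[OF module_ring])
qed

section \<open>Bases and coordinates of the terms of the complex\<close>

definition KI :: "nat \<Rightarrow> (nat \<times> 'n set) set"
  where "KI i = {(s, J). (s, J) \<in> KX \<and> card J + card (Supp (\<alpha> s)) = i}"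

definition idx :: "nat \<Rightarrow> ('n set \<times> 'n expo + nat \<times> 'n set) set"
  where "idx i = N (i - 1) <+> KI i"

definition bvec :: "'n set \<times> 'n expo + nat \<times> 'n set \<Rightarrow> ('n, 'k::comm_ring_1) ambient"
  where "bvec = case_sum (\<lambda>n. (0, gen n, 0)) (\<lambda>b. (0, 0, single b 1))"

definition coord :: "'n set \<times> 'n expo + nat \<times> 'n set \<Rightarrow> ('n, 'k::comm_ring_1) ambient \<Rightarrow> ('n, 'k) mpoly"
  where "coord = case_sum (\<lambda>n (p, u, v). lookup (kappa_contr u) n) (\<lambda>b (p, u, v). lookup v b)"

lemma Ksum_KI: "v \<in> Ksum r \<alpha> i \<longleftrightarrow> keys v \<subseteq> KI i"
  by (simp only: Ksum_keys KI_def)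

lemma finite_idx: "finite (idx i)"
proof -
  have "finite (KI i)"
    by (rule finite_subset[of _ "{1..r} \<times> UNIV"]) (auto simp: KI_def KX_def)
  moreover have "finite (N (i - 1))" using finite_std by (simp add: N_def)
  ultimately show ?thesis by (simp add: idx_def)
qed

lemma res_mod_Suc:
  "(res_mod d r \<alpha> (j + 1) :: ('n, 'k::comm_ring_1) ambient set) =
    {(0, u, v) |u v. u \<in> M j \<and> v \<in> Ksum r \<alpha> (j + 1)}"
  by (simp add: res_mod_def LB_eq_M)

lemma subspace_res_mod: "amb.subspace (res_mod d r \<alpha> (j + 1) :: ('n, 'k::comm_ring_1) ambient set)"
  unfolding res_mod_Suc
proof (rule amb.subspaceI)
  show "(0 :: ('n, 'k) ambient) \<in> {(0, u, v) |u v. u \<in> M j \<and> v \<in> Ksum r \<alpha> (j + 1)}"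
    using fm.subspace_0[OF subspace_M] fm.subspace_0[OF subspace_Ksum] by (auto simp: zero_prod_def)
qed (auto simp: amb_scale_def intro: fm.subspace_add[OF subspace_M] fm.subspace_add[OF subspace_Ksum]
      fm.subspace_scale[OF subspace_M] fm.subspace_scale[OF subspace_Ksum])

lemma module_hom_coord: "module_hom amb_scale (*) (coord m :: ('n, 'k::comm_ring_1) ambient \<Rightarrow> _)"
proof (rule module_hom.intro[OF module_amb_scale module_ring], rule module_hom_axioms.intro)
  show "coord m (x + y) = coord m x + coord m y" for x y :: "('n, 'k) ambient"
    by (cases m; cases x; cases y) (simp_all add: coord_def kc.add lookup_add)
  show "coord m (amb_scale c x) = c * coord m x" for c and x :: "('n, 'k) ambient"
    by (cases m; cases x) (simp_all add: coord_def amb_scale_def kc.scale lookup_scale)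
qed

lemma coord_bvec:
  assumes "m \<in> idx i" "n \<in> idx i"
  shows "coord m (bvec n) = (if m = n then 1 else 0)"
  using assms unfolding idx_def
  by (elim PlusE) (simp_all add: coord_def bvec_def coord_gen kc.zero lookup_single when_def eq_commute)

lemma bvec_res_mod: "n \<in> idx (j + 1) \<Longrightarrow> (bvec n :: ('n, 'k::comm_ring_1) ambient) \<in> res_mod d r \<alpha> (j + 1)"
  unfolding res_mod_Suc using fm.subspace_0[OF subspace_M] fm.subspace_0[OF subspace_Ksum]
  by (auto simp: idx_def bvec_def N_def gen_M Ksum_KI)

lemma sum_amb: "(\<Sum>i\<in>I. (f i, g i, h i)) = (sum f I, sum g I, sum h I)"
  by (induction I rule: infinite_finite_induct) (auto simp: zero_prod_def)

lemma res_mod_expand: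
  fixes x :: "('n, 'k::comm_ring_1) ambient"
  assumes "x \<in> res_mod d r \<alpha> (j + 1)"
  shows "x = (\<Sum>m\<in>idx (j + 1). amb_scale (coord m x) (bvec m))"
proof -
  obtain u v where x: "x = (0, u, v)" "u \<in> M j" "v \<in> Ksum r \<alpha> (j + 1)"
    using assms by (auto simp: res_mod_Suc)
  have "(\<Sum>m\<in>idx (j + 1). amb_scale (coord m x) (bvec m)) =
      (\<Sum>n\<in>N j. amb_scale (coord (Inl n) x) (bvec (Inl n))) + (\<Sum>b\<in>KI (j + 1). amb_scale (coord (Inr b) x) (bvec (Inr b)))"
    using finite_idx[of "j + 1"] by (simp add: idx_def sum.Plus comp_def)
  also have "(\<Sum>n\<in>N j. amb_scale (coord (Inl n) x) (bvec (Inl n))) = (0, u, 0)"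
    using M_expand[OF x(2)] by (simp add: x(1) coord_def bvec_def amb_scale_def sum_amb)
  also have "(\<Sum>b\<in>KI (j + 1). amb_scale (coord (Inr b) x) (bvec (Inr b))) = (0, 0, v)"
  proof -
    have "v = (\<Sum>b\<in>keys v. scale (lookup v b) (single b 1))" by (rule poly_mapping_expand)
    also have "\<dots> = (\<Sum>b\<in>KI (j + 1). scale (lookup v b) (single b 1))"
      by (rule sum.mono_neutral_left)
        (use x(3) finite_idx[of "j + 1"] in \<open>auto simp: Ksum_KI idx_def in_keys_iff\<close>)
    finally show ?thesis by (simp add: x(1) coord_def bvec_def amb_scale_def sum_amb)
  qed
  finally show ?thesis by (simp add: x)
qed

lemma basis_res_mod:
  shows "is_basis amb_scale (bvec ` idx (j + 1)) (res_mod d r \<alpha> (j + 1) :: ('n, 'k::comm_ring_1) ambient set)"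
    and "inj_on (bvec :: _ \<Rightarrow> ('n, 'k) ambient) (idx (j + 1))"
  by (rule is_basis_coordinates[OF module_amb_scale finite_idx subspace_res_mod,
        where c = coord, OF module_hom_coord coord_bvec bvec_res_mod res_mod_expand]; assumption)+

lemma basis_res_mod_0: "is_basis amb_scale {amb_embed 1} (res_mod d r \<alpha> 0 :: ('n, 'k::comm_ring_1) ambient set)"
proof -
  have "is_basis amb_scale ((\<lambda>_::unit. amb_embed 1) ` UNIV) (res_mod d r \<alpha> 0 :: ('n, 'k) ambient set)"
  proof (rule is_basis_coordinates(1)[where c = "\<lambda>_. fst"])
    show "amb.subspace (res_mod d r \<alpha> 0 :: ('n, 'k) ambient set)"
      by (rule amb.subspaceI)
        (auto simp: res_mod_def amb_embed_def amb_scale_def zero_prod_def)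
    show "module_hom amb_scale (*) (fst :: ('n, 'k) ambient \<Rightarrow> _)"
      by (rule module_hom.intro[OF module_amb_scale module_ring], rule module_hom_axioms.intro)
        (auto simp: amb_scale_def)
  qed (auto simp: module_amb_scale res_mod_def amb_embed_def amb_scale_def UNIV_unit)
  then show ?thesis by simp
qed

section \<open>The differentials and exactness\<close>

lemma res_diff_1: "res_diff \<alpha> 1 (0, u, v) = amb_embed (S_psi u)"
  by (simp add: res_diff_def amb_embed_def)

text \<open>In degree 2 the definition omits the K-component, which would land in
  \<open>Ksum r \<alpha> 1\<close> and hence be 0. So one formula covers all degrees from 2
  on.\<close>

lemma res_diff_Suc:
  fixes u :: "('n, 'k::comm_ring_1) WS"
  assumes "v \<in> Ksum r \<alpha> (j + 2)"
  shows "res_diff \<alpha> (j + 2) (0, u, v) = (0, Kos_tensor u + Theta \<alpha> v, - Kos_K v)"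
proof (cases "j = 0")
  case True
  have "v \<in> Ksum r \<alpha> (1 + 1)" using assms True by simp
  then have "Kos_K v = 0" by (intro Ksum_1 Kos_K_Ksum)
  then show ?thesis using True by (simp add: res_diff_def)
qed (simp add: res_diff_def)

lemma res_diff_mem:
  fixes u :: "('n, 'k::comm_ring_1) WS"
  assumes "u \<in> M (j + 1)" "v \<in> Ksum r \<alpha> (j + 2)"
  shows "Kos_tensor u + Theta \<alpha> v \<in> M j" "- Kos_K v \<in> Ksum r \<alpha> (j + 1)"
proof -
  have v: "v \<in> Ksum r \<alpha> (j + 1 + 1)" using assms by (simp add: add.assoc)
  show "Kos_tensor u + Theta \<alpha> v \<in> M j"
    by (intro fm.subspace_add[OF subspace_M] Kos_M Theta_M v assms)
  show "- Kos_K v \<in> Ksum r \<alpha> (j + 1)"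
    by (intro fm.subspace_neg[OF subspace_Ksum] Kos_K_Ksum v)
qed

lemma linear_res_diff:
  "linear_between amb_scale (res_mod d r \<alpha> (j + 1) :: ('n, 'k::comm_ring_1) ambient set)
    (res_mod d r \<alpha> j) (res_diff \<alpha> (j + 1))"
proof (cases j)
  case 0
  then show ?thesis
    unfolding linear_between_def res_mod_Suc
    by (auto simp: res_diff_1 amb_scale_def amb_embed_def S_psi_add S_psi_scale res_mod_def)
next
  case (Suc i)
  have j: "j + 1 = i + 2" "j = i + 1" using Suc by simp_all
  show ?thesis
    unfolding linear_between_def j(1)
    unfolding j(2) res_mod_Suc[of "i + 1", unfolded add.assoc one_add_one] res_mod_Suc
    using res_diff_mem[of _ i, where ?'k = 'k]
    by (auto simp: res_diff_Suc amb_scale_def Kos.add Kos.scale Kos_K.add Kos_K.scale Theta.add Theta.scale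
      fm.subspace_add[OF subspace_Ksum] fm.subspace_scale[OF subspace_Ksum]
      fm.scale_right_distrib simp del: add_2_eq_Suc' )
qed

text \<open>The map taking (u, v) to u - lam v is a chain map into L_d.\<close>

lemma res_diff_lam:
  assumes "v \<in> Ksum r \<alpha> (j + 2)"
  shows "(Kos_tensor u + Theta \<alpha> v) - lam (- Kos_K v) = Kos_tensor (u - lam v)"
  by (simp add: Kos.diff Kos_lam[OF assms] lam_neg)

text \<open>Here the differential is \<open>S_psi\<close>, the K-part vanishes, and Kos is 0 in
  exterior degree 0, so the cycle condition in L_d is S_psi u = 0 alone.\<close>

lemma res_diff_exact_1:
  "{x \<in> res_mod d r \<alpha> 1. res_diff \<alpha> 1 x = 0} =
    res_diff \<alpha> 2 ` (res_mod d r \<alpha> 2 :: ('n, 'k::field) ambient set)"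
  (is "?K = ?I")
proof
  have m1: "res_mod d r \<alpha> 1 = {(0, u, v) |u v. u \<in> M 0 \<and> v \<in> Ksum r \<alpha> 1}"
    using res_mod_Suc[of 0] by simp
  have m2: "res_mod d r \<alpha> 2 = {(0, u, v) |u v. u \<in> M 1 \<and> v \<in> Ksum r \<alpha> 2}"
    using res_mod_Suc[of 1] by (simp only: one_add_one)
  show "?K \<subseteq> ?I"
  proof
    fix x :: "('n, 'k) ambient" assume "x \<in> ?K"
    then obtain u v where x: "x = (0, u, v)" "u \<in> M 0" "v \<in> Ksum r \<alpha> 1" "S_psi u = 0"
      by (auto simp: m1 res_diff_1 amb_embed_def zero_prod_def)
    have v: "v = 0" by (rule Ksum_1[OF x(3)])
    have "Kos_tensor u = 0" using x(2) by (intro Kos_wedge_0[of _ d]) (simp add: M_def L_def)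
    moreover have "lam 0 = (0 :: ('n, 'k) WS)" using lam_diff[of 0 0] by simp
    ultimately obtain u' v' where "u' \<in> M (0 + 1)" "v' \<in> Ksum r \<alpha> (0 + 1 + 1)"
      "Kos_tensor u' + Theta \<alpha> v' = u" "- Kos_K v' = v"
      using complex_exact[of u 0 v] x v by auto
    then show "x \<in> ?I"
      using res_diff_Suc[of v' 0 u'] x(1) by (intro image_eqI[of _ _ "(0, u', v')"]) (auto simp: m2 one_add_one)
  qed
  show "?I \<subseteq> ?K"
  proof
    fix x :: "('n, 'k) ambient" assume "x \<in> ?I"
    then obtain u v where uv: "u \<in> M 1" "v \<in> Ksum r \<alpha> 2" "x = res_diff \<alpha> 2 (0, u, v)"
      by (auto simp: m2)
    have mem: "Kos_tensor u + Theta \<alpha> v \<in> M 0" "- Kos_K v \<in> Ksum r \<alpha> 1"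
      using res_diff_mem[of u 0 v] uv by simp_all
    have x: "x = (0, Kos_tensor u + Theta \<alpha> v, - Kos_K v)"
      using res_diff_Suc[of v 0 u] uv by simp
    have "lam (- Kos_K v) = (0 :: ('n, 'k) WS)"
      using Ksum_1[OF mem(2)] lam_diff[of 0 0] by simp
    then have "Kos_tensor u + Theta \<alpha> v = Kos_tensor (u - lam v)"
      using res_diff_lam[of v 0 u] uv by simp
    moreover have "u - lam v \<in> L d 1"
      using uv lam_L[of v 1] by (intro fm.subspace_diff[OF subspace_L]) (simp_all add: M_def one_add_one)
    ultimately have "S_psi (Kos_tensor u + Theta \<alpha> v) = 0" by (simp add: S_psi_Kos L_def S_psi_0)
    then show "x \<in> ?K" using mem by (auto simp: m1 x res_diff_1 amb_embed_def zero_prod_def)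
  qed
qed

lemma res_diff_exact_Suc:
  "{x \<in> res_mod d r \<alpha> (j + 2). res_diff \<alpha> (j + 2) x = 0} =
    res_diff \<alpha> (j + 3) ` (res_mod d r \<alpha> (j + 3) :: ('n, 'k::field) ambient set)"
  (is "?K = ?I")
proof
  have e: "j + 1 + 1 = j + 2" "j + 2 + 1 = j + 3" "j + 1 + 2 = j + 3" "j + 1 + 1 + 1 = j + 3" by simp_all
  have m2: "res_mod d r \<alpha> (j + 2) = {(0, u, v) |u v. u \<in> M (j + 1) \<and> v \<in> Ksum r \<alpha> (j + 2)}"
    using res_mod_Suc[of "j + 1"] by (simp only: e)
  have m3: "res_mod d r \<alpha> (j + 3) = {(0, u, v) |u v. u \<in> M (j + 2) \<and> v \<in> Ksum r \<alpha> (j + 3)}"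
    using res_mod_Suc[of "j + 2"] by (simp only: e)
  have d3: "res_diff \<alpha> (j + 3) (0, u, v) = (0, Kos_tensor u + Theta \<alpha> v, - Kos_K v)"
    if "v \<in> Ksum r \<alpha> (j + 3)" for u and v :: "('n, 'k) KS"
    using res_diff_Suc[of v "j + 1" u] that by (simp only: e)
  show "?K \<subseteq> ?I"
  proof
    fix x :: "('n, 'k) ambient" assume "x \<in> ?K"
    then obtain u v where x: "x = (0, u, v)" "u \<in> M (j + 1)" "v \<in> Ksum r \<alpha> (j + 2)"
      "Kos_tensor u + Theta \<alpha> v = 0" "- Kos_K v = 0"
      by (auto simp: m2 res_diff_Suc zero_prod_def simp del: add_2_eq_Suc')
    have "lam 0 = (0 :: ('n, 'k) WS)" using lam_diff[of 0 0] by simp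
    then have cycle: "Kos_tensor (u - lam v) = 0" using res_diff_lam[OF x(3), of u] x(4,5) by simp
    have x3: "v \<in> Ksum r \<alpha> (j + 1 + 1)" using x(3) by (simp only: e)
    obtain u' v' where uv: "u' \<in> M (j + 1 + 1)" "v' \<in> Ksum r \<alpha> (j + 1 + 1 + 1)"
      "Kos_tensor u' + Theta \<alpha> v' = u" "- Kos_K v' = v"
      by (rule complex_exact[OF x(2) x3 cycle]) auto
    then have "x = res_diff \<alpha> (j + 3) (0, u', v')" using x(1) d3[of v' u'] by (simp only: e)
    then show "x \<in> ?I" using uv unfolding m3 e by blast
  qed
  show "?I \<subseteq> ?K"
  proof
    fix x :: "('n, 'k) ambient" assume "x \<in> ?I"
    then obtain u v where uv: "u \<in> M (j + 2)" "v \<in> Ksum r \<alpha> (j + 3)" "x = res_diff \<alpha> (j + 3) (0, u, v)"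
      by (auto simp: m3)
    define u1 v1 where "u1 = Kos_tensor u + Theta \<alpha> v" and "v1 = - Kos_K v"
    have mem: "u1 \<in> M (j + 1)" "v1 \<in> Ksum r \<alpha> (j + 2)"
      using res_diff_mem[of u "j + 1" v] uv by (simp_all only: e u1_def v1_def)
    define u2 v2 where "u2 = Kos_tensor u1 + Theta \<alpha> v1" and "v2 = - Kos_K v1"
    have mem2: "u2 \<in> M j" "v2 \<in> Ksum r \<alpha> (j + 1)"
      using res_diff_mem[OF mem] by (simp_all only: u2_def v2_def)
    \<comment> \<open>The composite of two differentials becomes Kos after Kos under the embedding,
      so lam v2 = u2. This element has no B-part, which forces v2 = 0.\<close>
    have "u2 - lam v2 = Kos_tensor (u1 - lam v1)"
      unfolding u2_def v2_def by (rule res_diff_lam[OF mem(2)])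
    also have "u1 - lam v1 = Kos_tensor (u - lam v)"
      unfolding u1_def v1_def by (rule res_diff_lam[of _ "j + 1"]) (simp only: e uv)
    finally have eq: "lam v2 = u2" by (simp add: Kos_Kos)
    then have "v2 = 0" using lam_inj[OF mem2(2)] mem2(1) by (simp add: M_def)
    moreover from this have "u2 = 0" using eq lam_diff[of v2 v2] by simp
    moreover have "x = (0, u1, v1)" using uv d3 by (simp add: u1_def v1_def)
    ultimately show "x \<in> ?K"
      using mem res_diff_Suc[OF mem(2), of u1] unfolding m2 by (simp add: u2_def v2_def zero_prod_def)
  qed
qed

lemma free_resolution_res:
  "free_resolution amb_scale amb_embed (res_mod d r \<alpha>) (res_diff \<alpha>) (K' d B :: ('n, 'k::field) mpoly set)"
  unfolding free_resolution_def
proof (intro conjI allI impI)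
  show "module_hom (*) amb_scale (amb_embed :: ('n, 'k) mpoly \<Rightarrow> _)"
    by (rule module_hom.intro[OF module_ring module_amb_scale], rule module_hom_axioms.intro)
      (simp_all add: amb_embed_def amb_scale_def)
  show "bij_betw (amb_embed :: ('n, 'k) mpoly \<Rightarrow> _) UNIV (res_mod d r \<alpha> 0)"
    by (auto simp: bij_betw_def inj_on_def amb_embed_def res_mod_def)
  show "\<exists>X. finite X \<and> is_basis amb_scale X (res_mod d r \<alpha> i :: ('n, 'k) ambient set)" for i
  proof (cases i)
    case 0
    then show ?thesis using basis_res_mod_0 by blast
  next
    case (Suc j)
    then show ?thesis using basis_res_mod(1)[of j] finite_idx[of "j + 1"] unfolding Suc_eq_plus1 by blast
  qed
  show "linear_between amb_scale (res_mod d r \<alpha> i :: ('n, 'k) ambient set) (res_mod d r \<alpha> (i - 1)) (res_diff \<alpha> i)"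
    if "1 \<le> i" for i
    using linear_res_diff[of "i - 1"] that by simp
  show "res_diff \<alpha> 1 ` res_mod d r \<alpha> 1 = amb_embed ` (K' d B :: ('n, 'k) mpoly set)"
  proof -
    have "(0 :: ('n, 'k) KS) \<in> Ksum r \<alpha> 1" by (rule fm.subspace_0[OF subspace_Ksum])
    then have "res_diff \<alpha> 1 ` res_mod d r \<alpha> 1 = (\<lambda>u. amb_embed (S_psi u :: ('n, 'k) mpoly)) ` M 0"
      using res_mod_Suc[of 0, where ?'k = 'k]
      by (force simp: image_iff res_diff_1)
    then show ?thesis by (simp add: image_image flip: S_psi_M_0)
  qed
  show "{u \<in> res_mod d r \<alpha> i. res_diff \<alpha> i u = 0} =
      res_diff \<alpha> (i + 1) ` (res_mod d r \<alpha> (i + 1) :: ('n, 'k) ambient set)" if i: "1 \<le> i" for i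
  proof (cases "i = 1")
    case True
    then show ?thesis using res_diff_exact_1 by (simp only: one_add_one)
  next
    case False
    define j where "j = i - 2"
    have j: "i = j + 2" "i + 1 = j + 3" using i False by (simp_all add: j_def)
    show ?thesis unfolding j(2) unfolding j(1) by (rule res_diff_exact_Suc)
  qed
qed

text \<open>The L-part starts in degree d at i = 1 and rises by one with each Kos. Theta has
  coefficients of degree 2, which puts the K-part into degree d + i. A basis vector belongs to the
  K-part exactly if its last component is nonzero.\<close>

definition bdeg :: "nat \<Rightarrow> ('n, 'k::comm_ring_1) ambient \<Rightarrow> int"
  where "bdeg i = (\<lambda>(p, u, v). if i = 0 then 0 else if v = 0 then int d + int i - 1 else int d + int i)"

lemma graded_complex_res:
  "graded_complex amb_scale amb_embed (res_mod d r \<alpha>)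
    (res_diff \<alpha> :: nat \<Rightarrow> ('n, 'k::field) ambient \<Rightarrow> ('n, 'k) ambient)"
proof -
  define X :: "nat \<Rightarrow> ('n, 'k) ambient set"
    where "X i = (if i = 0 then {amb_embed 1} else bvec ` idx i)" for i
  have basis: "finite (X i) \<and> is_basis amb_scale (X i) (res_mod d r \<alpha> i)" for i
  proof (cases i)
    case 0
    then show ?thesis using basis_res_mod_0 by (simp add: X_def)
  next
    case (Suc j)
    then show ?thesis using basis_res_mod(1)[of j] finite_idx[of "j + 1"] by (simp add: X_def Suc_eq_plus1)
  qed
  have entry1: "\<exists>c. res_diff \<alpha> 1 x = (\<Sum>y\<in>X 0. amb_scale (c y) y) \<and>
      (\<forall>y\<in>X 0. homogeneous (bdeg 1 x - bdeg 0 y) (c y))" if x: "x \<in> X 1" for x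
  proof -
    have "KI 1 = {}" by (auto simp: KI_def KX_def)
    then obtain n where n: "x = (0, gen n, 0)" "n \<in> N 0"
      using x by (auto simp: X_def idx_def bvec_def)
    have "gen n \<in> (M 0 :: ('n, 'k) WS set)" using n(2) by (intro gen_M) (simp add: N_def)
    then have "homogeneous (int d) (lookup (gen n :: ('n, 'k) WS) b * (if fst b = {} then monom (snd b) else 0))"
      if "b \<in> keys (gen n :: ('n, 'k) WS)" for b
    proof -
      have "(fst b, snd b) \<in> keys (gen n :: ('n, 'k) WS)" using that by simp
      note b = keys_M_0(1,2)[OF \<open>gen n \<in> M 0\<close> this]
      have "homogeneous 0 (lookup (gen n :: ('n, 'k) WS) b)"
        using hom_coeffs_gen[of n, where ?'k = 'k] unfolding hom_coeffs_def by blast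
      moreover have "homogeneous (int d) (monom (snd b) :: ('n, 'k) mpoly)"
        using homogeneous_monom[of "snd b"] b by simp
      ultimately have "homogeneous (0 + int d) (lookup (gen n :: ('n, 'k) WS) b * monom (snd b))"
        by (rule homogeneous_mult)
      then show ?thesis by (simp only: b(1) add_0 simp_thms if_True)
    qed
    then have "homogeneous (int d) (S_psi (gen n :: ('n, 'k) WS))"
      unfolding S_psi_def split_def prod.collapse by (rule homogeneous_sum)
    then show ?thesis
      by (intro exI[of _ "\<lambda>_. S_psi (gen n)"])
        (simp add: X_def n res_diff_1 amb_scale_def amb_embed_def bdeg_def)
  qed
  have entry2: "\<exists>c. res_diff \<alpha> (j + 2) x = (\<Sum>y\<in>X (j + 1). amb_scale (c y) y) \<and>
      (\<forall>y\<in>X (j + 1). homogeneous (bdeg (j + 2) x - bdeg (j + 1) y) (c y))" if "x \<in> X (j + 2)" for j x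
  proof -
    have e: "j + 1 + 1 = j + 2" by simp
    have "x \<in> res_mod d r \<alpha> (j + 1 + 1)"
      using that bvec_res_mod[of _ "j + 1"] unfolding e by (auto simp: X_def)
    then have "res_diff \<alpha> (j + 2) x \<in> res_mod d r \<alpha> (j + 1)"
      using linear_res_diff[of "j + 1", where ?'k = 'k] unfolding linear_between_def e by blast
    from res_mod_expand[OF this]
    have ex: "res_diff \<alpha> (j + 2) x = (\<Sum>m\<in>idx (j + 1). amb_scale (coord m (res_diff \<alpha> (j + 2) x)) (bvec m))" .
    \<comment> \<open>The grading condition sums over basis vectors, not indices, so the coordinate
      is found through the inverse of \<open>bvec\<close> on the index set.\<close>
    define c :: "('n, 'k) ambient \<Rightarrow> ('n, 'k) mpoly"
      where "c y = coord (the_inv_into (idx (j + 1)) bvec y) (res_diff \<alpha> (j + 2) x)" for y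
    have c: "c (bvec m) = coord m (res_diff \<alpha> (j + 2) x)" if "m \<in> idx (j + 1)" for m
      by (simp add: c_def the_inv_into_f_f[OF basis_res_mod(2) that])
    have "res_diff \<alpha> (j + 2) x = (\<Sum>y\<in>X (j + 1). amb_scale (c y) y)"
      using ex by (simp add: X_def sum.reindex[OF basis_res_mod(2)] c)
    moreover have "homogeneous (bdeg (j + 2) x - bdeg (j + 1) (bvec m :: ('n, 'k) ambient)) (coord m (res_diff \<alpha> (j + 2) x))"
      if m: "m \<in> idx (j + 1)" for m
    proof -
      obtain n where n: "x = bvec n" "n \<in> idx (j + 2)" using \<open>x \<in> X (j + 2)\<close> by (auto simp: X_def)
      show ?thesis
      proof (cases n)
        case (Inl a)
        have x: "x = (0, gen a, 0)" by (simp add: n Inl bvec_def)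
        have "(0 :: ('n, 'k) KS) \<in> Ksum r \<alpha> (j + 2)" by (rule fm.subspace_0[OF subspace_Ksum])
        then have l: "res_diff \<alpha> (j + 2) x = (0, Kos_tensor (gen a), 0)"
          unfolding x using res_diff_Suc[where ?'k = 'k, of 0 j "gen a"]
          by (simp add: Theta.zero Kos_K.zero)
        have "hom_coeffs (0 + 1) (kappa_contr (Kos_tensor (gen a :: ('n, 'k) WS)))"
          by (intro hom_coeffs_kappa_contr hom_coeffs_Kos hom_coeffs_gen)
        then show ?thesis
          unfolding l by (cases m) (simp_all add: coord_def x bdeg_def bvec_def hom_coeffs_def del: split_paired_All)
      next
        case (Inr b)
        have x: "x = (0, 0, single b 1)" by (simp add: n Inr bvec_def)
        have b: "b \<in> KI (j + 2)" using n Inr by (auto simp: idx_def)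
        then have v: "single b 1 \<in> (Ksum r \<alpha> (j + 2) :: ('n, 'k) KS set)" by (simp add: Ksum_KI)
        have l: "res_diff \<alpha> (j + 2) x = (0, Theta \<alpha> (single b 1), - Kos_K (single b 1))"
          unfolding x using res_diff_Suc[OF v, of 0] by (simp add: Kos.zero)
        have "hom_coeffs (0 + 2) (kappa_contr (Theta \<alpha> (single b 1) :: ('n, 'k) WS))"
          by (intro hom_coeffs_kappa_contr hom_coeffs_Theta hom_coeffs_single Ksum_KX[OF v])
        moreover have "hom_coeffs (0 + 1) (- Kos_K (single b 1) :: ('n, 'k) KS)"
          by (intro hom_coeffs_uminus hom_coeffs_Kos_K hom_coeffs_single)
        moreover have "single b 1 \<noteq> (0 :: ('n, 'k) KS)" by (simp flip: keys_eq_empty)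
        moreover have "single b' 1 \<noteq> (0 :: ('n, 'k) KS)" for b' by (simp flip: keys_eq_empty)
        ultimately show ?thesis
          unfolding l by (cases m) (simp_all add: coord_def x bdeg_def bvec_def hom_coeffs_def del: split_paired_All)
      qed
    qed
    ultimately show ?thesis by (intro exI[of _ c]) (auto simp: X_def c)
  qed
  show ?thesis
    unfolding graded_complex_def
  proof (intro exI[of _ X] exI[of _ bdeg] conjI allI impI ballI)
    show "bdeg 0 (amb_embed 1 :: ('n, 'k) ambient) = 0" by (simp add: bdeg_def amb_embed_def)
    fix i x assume i: "1 \<le> i" and x: "x \<in> X i"
    show "\<exists>c. res_diff \<alpha> i x = (\<Sum>y\<in>X (i - 1). amb_scale (c y) y) \<and>
      (\<forall>y\<in>X (i - 1). homogeneous (bdeg i x - bdeg (i - 1) y) (c y))"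
    proof (cases "i = 1")
      case True
      then show ?thesis using entry1 x by simp
    next
      case False
      define j where "j = i - 2"
      have j: "i = j + 2" "i - 1 = j + 1" using i False by (simp_all add: j_def)
      have "x \<in> X (j + 2)" using x by (simp only: j(1))
      then show ?thesis unfolding j(2) unfolding j(1) by (rule entry2)
    qed
  qed (use basis in \<open>auto simp: X_def\<close>)
qed

text \<open>Coordinates of the L-part are taken through \<open>kappa_contr\<close>, which is
  R-linear and so keeps coefficients in the maximal ideal.\<close>

lemma res_diff_minimal:
  assumes "1 \<le> i"
  shows "res_diff \<alpha> i ` res_mod d r \<alpha> i \<subseteq>
    ideal_times amb_scale max_ideal (res_mod d r \<alpha> (i - 1) :: ('n, 'k::field) ambient set)"
proof
  fix x :: "('n, 'k) ambient" assume "x \<in> res_diff \<alpha> i ` res_mod d r \<alpha> i"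
  then obtain u v where uv: "u \<in> M (i - 1)" "v \<in> Ksum r \<alpha> i" "x = res_diff \<alpha> i (0, u, v)"
    using res_mod_Suc[of "i - 1", where ?'k = 'k] assms by auto
  show "x \<in> ideal_times amb_scale max_ideal (res_mod d r \<alpha> (i - 1))"
  proof (cases "i = 1")
    case True
    have "lookup u b * (if fst b = {} then monom (snd b) else 0) \<in> max_ideal" if "b \<in> keys u" for b
    proof -
      have "u \<in> M 0" "(fst b, snd b) \<in> keys u" using uv(1) True that by simp_all
      then have "expo_deg (snd b) = d" by (rule keys_M_0(2))
      then have "snd b \<noteq> 0" using d_pos by (auto simp: expo_deg_eq_0[symmetric])
      then show ?thesis by (simp add: max_ideal_mult max_ideal_monom max_ideal_0)
    qed
    then have "S_psi u \<in> max_ideal"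
      unfolding S_psi_def split_def prod.collapse by (rule max_ideal_sum)
    moreover have "x = amb_scale (S_psi u) (amb_embed 1)"
      using uv True by (simp add: res_diff_1 amb_scale_def amb_embed_def)
    moreover have "amb_embed 1 \<in> res_mod d r \<alpha> (i - 1)" using True by (simp add: res_mod_def)
    ultimately show ?thesis unfolding ideal_times_def by (intro amb.span_base) blast
  next
    case False
    define j where "j = i - 2"
    have j: "i = j + 2" "i - 1 = j + 1" using assms False by (simp_all add: j_def)
    have v: "v \<in> Ksum r \<alpha> (j + 2)" using uv j by simp
    have u: "u \<in> M (j + 1)" using uv(1) by (simp only: j(2))
    have x: "x = (0, Kos_tensor u + Theta \<alpha> v, - Kos_K v)"
      unfolding uv(3) j(1) by (rule res_diff_Suc[OF v])
    have "x \<in> res_mod d r \<alpha> (j + 1)"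
      unfolding x res_mod_Suc using res_diff_mem[OF u v] by blast
    from res_mod_expand[OF this]
    have ex: "x = (\<Sum>m\<in>idx (j + 1). amb_scale (coord m x) (bvec m))" .
    have "max_coeffs (kappa_contr (Kos_tensor u + Theta \<alpha> v))"
      by (intro max_coeffs_kappa_contr max_coeffs_add max_coeffs_Kos max_coeffs_Theta Ksum_KX[OF v])
    then have "coord m x \<in> max_ideal" for m
      using max_coeffs_Kos_K[of v]
      by (cases m) (simp_all add: x coord_def max_coeffs_def max_ideal_uminus del: split_paired_All)
    then have "(\<Sum>m\<in>idx (j + 1). amb_scale (coord m x) (bvec m)) \<in>
        ideal_times amb_scale max_ideal (res_mod d r \<alpha> (j + 1))"
      unfolding ideal_times_def using bvec_res_mod[where ?'k = 'k]
      by (intro amb.span_sum amb.span_base) blast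
    then show ?thesis unfolding j(2) ex[symmetric] .
  qed
qed

end

theorem theorem6p8:
  fixes \<alpha> :: "nat \<Rightarrow> 'n::{finite,linorder} expo" and d r :: nat
  assumes "d \<ge> 1"
    and "\<And>s. s \<in> {1..r} \<Longrightarrow> expo_deg (\<alpha> s) = d"
    and "\<And>s t. s \<in> {1..r} \<Longrightarrow> t \<in> {1..r} \<Longrightarrow> s \<noteq> t \<Longrightarrow> expo_deg (expo_lcm (\<alpha> s) (\<alpha> t)) \<ge> d + 2"
  shows "minimal_free_resolution amb_scale amb_embed (res_mod d r \<alpha>) (res_diff \<alpha>)
    (K' d (\<alpha> ` {1..r}) :: ('n, 'k::field) mpoly set)"
proof -
  interpret removed_monomials \<alpha> d r
    by unfold_locales (use assms in auto)
  show ?thesis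
    unfolding minimal_free_resolution_def
    using free_resolution_res graded_complex_res res_diff_minimal by (auto simp: B_def)
qed
end
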